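(* Let $m\ge 0$ be an integer and let $S_a$ be a linear univariate binary subdivision scheme whose mask has symbol $a(z)=\frac{(1+z)^m}{2^m}b(z)$, where the scheme $S_b$ with symbol $b(z)$ satisfies $S_b\in C^0$. Let $\{S_a\circ M^k\}$ be the PN subdivision scheme generalizing $S_a$. Then $\{S_a\circ M^k\}\in C^m$.
   Context: Linear scheme: $\mathbf{a}=\{a_i\}_{i\in\mathbb{Z}}$ is a finitely supported real mask with symbol $a(z)=\sum_i a_iz^i$ and $\sum_j a_{2j}=\sum_j a_{2j+1}=1$; $S_a=(a_{i-2j})_{i,j\in\mathbb{Z}}$ maps $P^k=(\mathbf{p}_j^k)_{j\in\mathbb{Z}}$ to $P^{k+1}=S_aP^k$. A scheme is in $C^0$ (convergent) if, for bounded initial data, the piecewise linear curves interpolating $\mathbf{p}_i^k$ at the knots $2^{-k}i$ converge uniformly to a (continuous) limit curve $P(t)$ as $k\to\infty$; it is in $C^m$ if the limit curves are $C^m$ in the parameter $t$. PN scheme: given points $\mathbf{p}_i^k$ and unit vectors $\mathbf{n}_i^k$ (on the unit circle or sphere), $i\in\mathbb{Z}$, $$\mathbf{q}_i^{k+1}=\sum_{j}a_{i-2j}\mathbf{p}_j^k,\qquad \mathbf{n}_i^{k+1}=\frac{\sum_j a_{i-2j}\mathbf{n}_j^k}{\left\|\sum_j a_{i-2j}\mathbf{n}_j^k\right\|},\qquad \mathbf{p}_i^{k+1}=\mathbf{q}_i^{k+1}+\sum_j a_{i-2j}h_{ij}^k\,\mathbf{n}_i^{k+1},$$ $$h_{ij}^k=\frac{(\mathbf{n}_j^k+\mathbf{n}_i^{k+1})^\top(\mathbf{p}_j^k-\mathbf{q}_i^{k+1})}{(\mathbf{n}_j^k+\mathbf{n}_i^{k+1})^\top\mathbf{n}_i^{k+1}}.$$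 With $A_{ij}^k=\frac{\mathbf{n}_i^{k+1}(\mathbf{n}_j^k+\mathbf{n}_i^{k+1})^\top}{(\mathbf{n}_j^k+\mathbf{n}_i^{k+1})^\top\mathbf{n}_i^{k+1}}$ and $M_{ij}^k=I+\sum_l a_{i-2l}(A_{ij}^k-A_{il}^k)$, this reads $\mathbf{p}_i^{k+1}=\sum_j a_{i-2j}M_{ij}^k\mathbf{p}_j^k$, i.e. $P^{k+1}=(S_a\circ M^k)P^k$ with $S_a\circ M^k=(a_{i-2j}M_{ij}^k)_{i,j\in\mathbb{Z}}$, whence the notation. Standing assumptions: $S_b$ has H\"older regularity $C^{0+\alpha}$ for some $0<\alpha\le 1$. The initial normals are locally dense enough that all denominators above (those occurring with non-zero weights) are non-zero, understood uniformly, i.e. bounded away from zero. As known from the literature, the limit curve $\mathbf{n}(t)$ of the projected normals then has the same smoothness and H\"older regularity $C^{m+\alpha}$ as $S_a$; in particular $\left\|\frac{\Delta^m\mathbf{n}_i^k}{2^{-km}}-\frac{\Delta^m\mathbf{n}_{i-1}^k}{2^{-km}}\right\|<c_1 2^{-k\alpha}$ for a constant $c_1$, where $\Delta\mathbf{n}_i^k=\mathbf{n}_i^k-\mathbf{n}_{i-1}^k$ and $\Delta^m=\Delta(\Delta^{m-1})$. *)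

theory Defs
  imports "HOL-Analysis.Analysis"
begin

section \<open>Subdivision schemes and the smoothness of their limit curves\<close>

text \<open>A (possibly level-dependent) scheme is the sequence of its refinement operators
  on control polygons; \<open>R k\<close> maps level \<open>k\<close> to level \<open>k + 1\<close>.\<close>

type_synonym 'a polygon = "int \<Rightarrow> 'a"
type_synonym 'a scheme = "nat \<Rightarrow> 'a polygon \<Rightarrow> 'a polygon"

primrec refine :: "'a scheme \<Rightarrow> 'a polygon \<Rightarrow> nat \<Rightarrow> 'a polygon" where
  "refine R P 0 = P"
| "refine R P (Suc k) = R k (refine R P k)"

text \<open>The piecewise linear curve with value \<open>P i\<close> at the knot \<open>i / 2 ^ k\<close>.\<close>

definition pl_curve :: "nat \<Rightarrow> 'a::real_vector polygon \<Rightarrow> real \<Rightarrow> 'a" where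
  "pl_curve k P t =
     (let i = \<lfloor>2 ^ k * t\<rfloor>; s = 2 ^ k * t - of_int i
      in (1 - s) *\<^sub>R P i + s *\<^sub>R P (i + 1))"

definition limit_curve :: "(nat \<Rightarrow> 'a::real_normed_vector polygon) \<Rightarrow> (real \<Rightarrow> 'a) \<Rightarrow> bool" where
  "limit_curve Ps f \<longleftrightarrow> uniform_limit UNIV (\<lambda>k. pl_curve k (Ps k)) f sequentially"

text \<open>Curves of class \<open>C\<^sup>m\<close>: \<open>D i\<close> is the \<open>i\<close>-th derivative.\<close>

definition C_curve :: "nat \<Rightarrow> (real \<Rightarrow> 'a::real_normed_vector) \<Rightarrow> bool" where
  "C_curve m f \<longleftrightarrow>
     (\<exists>D. D 0 = f \<and>
          (\<forall>i<m. \<forall>t. (D i has_vector_derivative D (Suc i) t) (at t)) \<and>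
          continuous_on UNIV (D m))"

definition Hoelder_curve :: "real \<Rightarrow> (real \<Rightarrow> 'a::real_normed_vector) \<Rightarrow> bool" where
  "Hoelder_curve \<alpha> f \<longleftrightarrow> (\<exists>C. \<forall>s t. norm (f s - f t) \<le> C * \<bar>s - t\<bar> powr \<alpha>)"

definition scheme_C :: "nat \<Rightarrow> 'a::real_normed_vector scheme \<Rightarrow> bool" where
  "scheme_C m R \<longleftrightarrow>
     (\<forall>P. bounded (range P) \<longrightarrow> (\<exists>f. limit_curve (refine R P) f \<and> C_curve m f))"

definition scheme_Hoelder :: "real \<Rightarrow> 'a::real_normed_vector scheme \<Rightarrow> bool" where
  "scheme_Hoelder \<alpha> R \<longleftrightarrow>
     (\<forall>P. bounded (range P) \<longrightarrow> (\<exists>f. limit_curve (refine R P) f \<and> Hoelder_curve \<alpha> f))"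


section \<open>Linear schemes\<close>

type_synonym mask = "int \<Rightarrow> real"

definition linear_mask :: "mask \<Rightarrow> bool" where
  "linear_mask a \<longleftrightarrow>
     finite {i. a i \<noteq> 0} \<and>
     (\<Sum>j | a (2 * j) \<noteq> 0. a (2 * j)) = 1 \<and>
     (\<Sum>j | a (2 * j + 1) \<noteq> 0. a (2 * j + 1)) = 1"

text \<open>The symbol is a Laurent polynomial, hence only meaningful for \<open>z \<noteq> 0\<close>.\<close>

definition symbol :: "mask \<Rightarrow> complex \<Rightarrow> complex" where
  "symbol a z = (\<Sum>i | a i \<noteq> 0. of_real (a i) * z powi i)"

definition subdiv :: "mask \<Rightarrow> 'a::real_vector polygon \<Rightarrow> 'a polygon" where
  "subdiv a P i = (\<Sum>j | a (i - 2 * j) \<noteq> 0. a (i - 2 * j) *\<^sub>R P j)"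

definition linear_scheme :: "mask \<Rightarrow> 'a::real_vector scheme" where
  "linear_scheme a = (\<lambda>k. subdiv a)"


section \<open>Point-normal schemes\<close>

text \<open>The normals evolve independently of the points.\<close>

primrec normals :: "mask \<Rightarrow> 'a::real_normed_vector polygon \<Rightarrow> nat \<Rightarrow> 'a polygon" where
  "normals a n0 0 = n0"
| "normals a n0 (Suc k) =
     (\<lambda>i. subdiv a (normals a n0 k) i /\<^sub>R norm (subdiv a (normals a n0 k) i))"

text \<open>The height \<open>h\<close> for old point \<open>p\<close> with normal \<open>n\<close>,
  linearly refined point \<open>q\<close> and new normal \<open>n'\<close>.\<close>

definition PN_height :: "'a::real_inner \<Rightarrow> 'a \<Rightarrow> 'a \<Rightarrow> 'a \<Rightarrow> real" where
  "PN_height n n' p q = ((n + n') \<bullet> (p - q)) / ((n + n') \<bullet> n')"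

text \<open>For fixed initial normals \<open>n0\<close>, the scheme \<open>{S\<^sub>a \<circ> M\<^sup>k}\<close> acting on the points.\<close>

definition PN_scheme :: "mask \<Rightarrow> 'a::real_inner polygon \<Rightarrow> 'a scheme" where
  "PN_scheme a n0 k P i =
     (let n = normals a n0 k; n' = normals a n0 (Suc k) i; q = subdiv a P i
      in q + (\<Sum>j | a (i - 2 * j) \<noteq> 0. a (i - 2 * j) * PN_height (n j) n' (P j) q) *\<^sub>R n')"

text \<open>All denominators are uniformly bounded away from zero.\<close>

definition PN_well_defined :: "mask \<Rightarrow> 'a::real_inner polygon \<Rightarrow> bool" where
  "PN_well_defined a n0 \<longleftrightarrow>
     (\<exists>\<delta>>0. \<forall>k i.
        \<delta> \<le> norm (subdiv a (normals a n0 k) i) \<and>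
        (\<forall>j. a (i - 2 * j) \<noteq> 0 \<longrightarrow>
           \<delta> \<le> \<bar>(normals a n0 k j + normals a n0 (Suc k) i) \<bullet> normals a n0 (Suc k) i\<bar>))"

definition bdiff :: "'a::ab_group_add polygon \<Rightarrow> 'a polygon" where
  "bdiff x i = x i - x (i - 1)"

text \<open>The Hoelder bound of order \<open>m + \<alpha>\<close> on the refined normals. It is not a consequence of
  \<open>PN_well_defined\<close>: without it the normals need not converge when the initial normals
  are too far apart, even if the linear scheme converges.\<close>

definition normals_Hoelder :: "nat \<Rightarrow> real \<Rightarrow> mask \<Rightarrow> 'a::real_normed_vector polygon \<Rightarrow> bool" where
  "normals_Hoelder m \<alpha> a n0 \<longleftrightarrow>
     (\<exists>c. \<forall>k i.
        norm ((bdiff ^^ m) (normals a n0 k) i /\<^sub>R 2 powr (- (real k * real m))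
            - (bdiff ^^ m) (normals a n0 k) (i - 1) /\<^sub>R 2 powr (- (real k * real m)))
        < c * 2 powr (- (real k * \<alpha>)))"

end

theory Submission
  imports Defs
begin

text \<open>Write the PN scheme as \<open>p (k + 1) = S\<^sub>a (p k) + E k\<close>. Since \<open>a(z) = ((1 + z) / 2)^m b(z)\<close>, the
  scaled differences \<open>2^(k m) \<Delta>^m (p k)\<close> follow \<open>S\<^sub>b\<close>, so by the power boundedness of \<open>S\<^sub>b\<close> and Gronwall
  it is enough that \<open>2^(k s) \<Delta>^s (E k)\<close> is summable in \<open>k\<close> relative to the scaled differences of
  \<open>p k\<close>, for all \<open>s \<le> m\<close>. For \<open>m = 0\<close> this is the Hoelder bound on the normals. For \<open>m > 0\<close> the point is that
  \<open>S\<^sub>a\<close> is multiplicative to leading order: the defect \<open>S\<^sub>a (x y) - S\<^sub>a x S\<^sub>a y\<close> gains a factor \<open>2^(-k)\<close>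
  at every order of differences. Expanding the denominator of the height
  into a geometric series makes it polynomial, and replacing \<open>S\<^sub>a\<close> of products by products of \<open>S\<^sub>a\<close>
  turns the sum of the weighted heights into a multiple of \<open>S\<^sub>a p - q = 0\<close>.\<close>

section \<open>Masks\<close>

text \<open>The points have no regularity to start from, so the perturbation is measured against the
  very scaled differences that are to be bounded; the estimate is relative and Gronwall closes the
  loop. Among the masks that govern the differences only \<open>b\<close> comes with convergence. It
  controls order \<open>m\<close>, while a difference of order \<open>s < m\<close> is controlled by
  the next one, whose unscaled size carries a factor 2^(-k). A second obstacle is that the Hoelder
  bound on the normals concerns order \<open>m + 1\<close> alone. The orders up to \<open>m\<close>
  are recovered by interpolation against the unit length, which loses a little, and are then
  sharpened through the recursion of the normals. The quotient in the height depends on the old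
  index \<open>j\<close> and on the new index \<open>i\<close>, so it is not a subdivided polygon.
  Its series is cut off after \<open>m\<close> terms: the factor \<open>\<delta> ^ m\<close> makes
  the remainder so small that crude bounds on its \<open>m\<close> differences suffice. For
  \<open>m = 0\<close> the heights are instead compared with \<open>n' \<bullet> (p - q)\<close>,
  whose weighted sum vanishes.\<close>

definition affine_mask :: "mask \<Rightarrow> bool" where
  "affine_mask c \<longleftrightarrow> finite {i. c i \<noteq> 0} \<and> (\<forall>i. (\<Sum>j | c (i - 2 * j) \<noteq> 0. c (i - 2 * j)) = 1)"

definition mask_norm :: "mask \<Rightarrow> real" where
  "mask_norm c = (\<Sum>i | c i \<noteq> 0. \<bar>c i\<bar>)"

lemma mask_norm_nonneg: "0 \<le> mask_norm c"
  by (simp add: mask_norm_def sum_nonneg)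

lemma stencil_image: "(\<lambda>j. i - 2 * j) ` {j. c (i - 2 * j) \<noteq> (0::real)} \<subseteq> {i. c i \<noteq> 0}"
  by auto

lemma finite_stencil:
  fixes c :: mask
  assumes "finite {i. c i \<noteq> 0}"
  shows "finite {j. c (i - 2 * j) \<noteq> 0}"
proof -
  have "inj_on (\<lambda>j. i - 2 * j) {j. c (i - 2 * j) \<noteq> 0}" by (auto intro: inj_onI)
  then show ?thesis
    using finite_subset[OF stencil_image assms] finite_imageD by blast
qed

lemma stencil_sum_le_mask_norm:
  fixes c :: mask
  assumes "finite {i. c i \<noteq> 0}"
  shows "(\<Sum>j | c (i - 2 * j) \<noteq> 0. \<bar>c (i - 2 * j)\<bar>) \<le> mask_norm c"
proof -
  have "(\<Sum>j | c (i - 2 * j) \<noteq> 0. \<bar>c (i - 2 * j)\<bar>)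
      = (\<Sum>l\<in>(\<lambda>j. i - 2 * j) ` {j. c (i - 2 * j) \<noteq> 0}. \<bar>c l\<bar>)"
    by (subst sum.reindex) (auto intro: inj_onI)
  also have "\<dots> \<le> mask_norm c"
    unfolding mask_norm_def by (rule sum_mono2[OF assms stencil_image]) auto
  finally show ?thesis .
qed

lemma affine_mask_finite: "affine_mask c \<Longrightarrow> finite {i. c i \<noteq> 0}"
  by (simp add: affine_mask_def)

lemma affine_mask_stencil_nonempty: "affine_mask c \<Longrightarrow> \<exists>j. c (i - 2 * j) \<noteq> 0"
  unfolding affine_mask_def by (metis (no_types, lifting) sum.neutral zero_neq_one mem_Collect_eq)

section \<open>Subdivision as a linear operator on polygons\<close>

lemma subdiv_eq_sum:
  assumes "finite A" and "{j. c (i - 2 * j) \<noteq> 0} \<subseteq> A"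
  shows "subdiv c P i = (\<Sum>j\<in>A. c (i - 2 * j) *\<^sub>R P j)"
  unfolding subdiv_def by (rule sum.mono_neutral_left) (use assms in auto)

lemma subdiv_cong:
  "(\<And>j. c (i - 2 * j) \<noteq> 0 \<Longrightarrow> P j = Q j) \<Longrightarrow> subdiv c P i = subdiv c Q i"
  unfolding subdiv_def by (rule sum.cong) auto

lemma subdiv_add: "subdiv c (\<lambda>j. P j + Q j) i = subdiv c P i + subdiv c Q i"
  by (simp add: subdiv_def scaleR_right_distrib sum.distrib)

lemma subdiv_diff: "subdiv c (\<lambda>j. P j - Q j) i = subdiv c P i - subdiv c Q i"
  by (simp add: subdiv_def scaleR_right_diff_distrib sum_subtractf)

lemma subdiv_linear:
  assumes "linear f" shows "subdiv c (\<lambda>j. f (P j)) i = f (subdiv c P i)"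
  unfolding subdiv_def by (simp add: linear_sum[OF assms] linear_cmul[OF assms])

lemma subdiv_scaleR: "subdiv c (\<lambda>j. r *\<^sub>R P j) i = r *\<^sub>R subdiv c P i"
  by (rule subdiv_linear) (simp add: linear_iff scaleR_right_distrib)

lemma subdiv_mult_left: "subdiv c (\<lambda>j. r * P j) i = (r::real) * subdiv c P i"
  using subdiv_scaleR[of c r P i] by simp

lemma subdiv_sum: "subdiv c (\<lambda>j. \<Sum>t\<in>A. P t j) i = (\<Sum>t\<in>A. subdiv c (P t) i)"
  unfolding subdiv_def scaleR_right.sum by (rule sum.swap)

lemma subdiv_const: "affine_mask c \<Longrightarrow> subdiv c (\<lambda>j. v) i = v"
  by (simp add: subdiv_def affine_mask_def flip: scaleR_left.sum)

lemma norm_subdiv_le: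
  assumes "finite {i. c i \<noteq> 0}" and "\<And>j. c (i - 2 * j) \<noteq> 0 \<Longrightarrow> norm (P j) \<le> B" and "0 \<le> B"
  shows "norm (subdiv c P i) \<le> mask_norm c * B"
proof -
  have "norm (subdiv c P i) \<le> (\<Sum>j | c (i - 2 * j) \<noteq> 0. \<bar>c (i - 2 * j)\<bar> * B)"
    unfolding subdiv_def by (rule sum_norm_le) (auto intro: mult_left_mono assms)
  also have "\<dots> \<le> mask_norm c * B"
    unfolding sum_distrib_right[symmetric]
    by (rule mult_right_mono[OF stencil_sum_le_mask_norm[OF assms(1)] assms(3)])
  finally show ?thesis .
qed

section \<open>Averaging a mask: the factor (1 + z) / 2 of its symbol\<close>

definition mask_avg :: "mask \<Rightarrow> mask" where
  "mask_avg c i = (c i + c (i - 1)) / 2"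

lemma finite_mask_shift:
  fixes c :: mask
  assumes "finite {i. c i \<noteq> 0}" shows "finite {i. c (i - 1) \<noteq> 0}"
proof -
  have "{i. c (i - 1) \<noteq> 0} \<subseteq> (\<lambda>i. i + 1) ` {i. c i \<noteq> 0}"
    by (auto intro!: image_eqI[of _ _ "_ - 1"])
  then show ?thesis by (rule finite_subset) (simp add: assms)
qed

lemma finite_mask_avg:
  assumes "finite {i. c i \<noteq> 0}" shows "finite {i. mask_avg c i \<noteq> 0}"
  by (rule finite_subset[OF _ finite_UnI[OF assms finite_mask_shift[OF assms]]])
     (auto simp: mask_avg_def)

lemma subdiv_mask_avg:
  assumes "finite {i. c i \<noteq> 0}"
  shows "subdiv (mask_avg c) P i = (1/2) *\<^sub>R (subdiv c P i + subdiv c P (i - 1))"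
proof -
  define A where "A = {j. c (i - 2 * j) \<noteq> 0} \<union> {j. c (i - 1 - 2 * j) \<noteq> 0}"
  have A: "finite A" unfolding A_def using finite_stencil[OF assms] by blast
  have eq: "subdiv c P l = (\<Sum>j\<in>A. c (l - 2 * j) *\<^sub>R P j)" if "l = i \<or> l = i - 1" for l
    by (rule subdiv_eq_sum[OF A]) (use that in \<open>auto simp: A_def\<close>)
  have "subdiv (mask_avg c) P i = (\<Sum>j\<in>A. mask_avg c (i - 2 * j) *\<^sub>R P j)"
    by (rule subdiv_eq_sum[OF A]) (auto simp: A_def mask_avg_def algebra_simps)
  also have "\<dots> = (1/2) *\<^sub>R ((\<Sum>j\<in>A. c (i - 2 * j) *\<^sub>R P j) + (\<Sum>j\<in>A. c (i - 1 - 2 * j) *\<^sub>R P j))"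
    unfolding sum.distrib[symmetric] scaleR_right.sum
    by (rule sum.cong) (auto simp: mask_avg_def algebra_simps add_divide_distrib)
  finally show ?thesis by (simp add: eq)
qed

lemma subdiv_shift: "subdiv c (\<lambda>j. P (j - e)) i = subdiv c P (i - 2 * e)"
  unfolding subdiv_def
  by (rule sum.reindex_bij_witness[of _ "\<lambda>j. j + e" "\<lambda>j. j - e"]) (auto simp: algebra_simps)

text \<open>On symbols this is (1 - z)(1 + z) = 1 - z^2: a shift by one of the coarse polygon is a
  shift by two of the refined one, so the factor 1 + z completes a fine difference to the image of a
  coarse one.\<close>

lemma bdiff_subdiv_mask_avg:
  assumes "finite {i. c i \<noteq> 0}"
  shows "bdiff (subdiv (mask_avg c) P) = (\<lambda>i. (1/2) *\<^sub>R subdiv c (bdiff P) i)"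
proof
  fix i
  have "subdiv c (bdiff P) i = subdiv c P i - subdiv c P (i - 2)"
    using subdiv_diff[of c P "\<lambda>j. P (j - 1)" i] subdiv_shift[of c P 1 i]
    by (simp add: bdiff_def[abs_def])
  then show "bdiff (subdiv (mask_avg c) P) i = (1/2) *\<^sub>R subdiv c (bdiff P) i"
    by (simp add: bdiff_def subdiv_mask_avg[OF assms] scaleR_right_diff_distrib[symmetric])
qed

lemma affine_mask_iff: "affine_mask c \<longleftrightarrow> finite {i. c i \<noteq> 0} \<and> (\<forall>i. subdiv c (\<lambda>_. 1::real) i = 1)"
  by (simp add: affine_mask_def subdiv_def)

lemma affine_mask_avg: "affine_mask c \<Longrightarrow> affine_mask (mask_avg c)"
  by (simp add: affine_mask_iff finite_mask_avg subdiv_mask_avg)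

lemma affine_mask_funpow_avg: "affine_mask c \<Longrightarrow> affine_mask ((mask_avg ^^ k) c)"
  by (induction k) (auto intro: affine_mask_avg)

lemma linear_mask_imp_affine:
  assumes "linear_mask c" shows "affine_mask c"
proof -
  have "(\<Sum>j | c (i - 2 * j) \<noteq> 0. c (i - 2 * j)) = 1" for i
  proof (cases "even i")
    case True
    then obtain l where "i = 2 * l" by blast
    then have "(\<Sum>j | c (i - 2 * j) \<noteq> 0. c (i - 2 * j)) = (\<Sum>j | c (2 * j) \<noteq> 0. c (2 * j))"
      by (intro sum.reindex_bij_witness[of _ "\<lambda>j. l - j" "\<lambda>j. l - j"]) (auto simp: algebra_simps)
    then show ?thesis using assms by (simp add: linear_mask_def)
  next
    case False
    then obtain l where "i = 2 * l + 1" using oddE by blast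
    then have "(\<Sum>j | c (i - 2 * j) \<noteq> 0. c (i - 2 * j)) = (\<Sum>j | c (2 * j + 1) \<noteq> 0. c (2 * j + 1))"
      by (intro sum.reindex_bij_witness[of _ "\<lambda>j. l - j" "\<lambda>j. l - j"]) (auto simp: algebra_simps)
    then show ?thesis using assms by (simp add: linear_mask_def)
  qed
  then show ?thesis using assms by (simp add: affine_mask_def linear_mask_def)
qed

section \<open>Symbols as Laurent polynomials\<close>

lemma symbol_eq_sum:
  assumes "finite A" and "{i. c i \<noteq> 0} \<subseteq> A"
  shows "symbol c z = (\<Sum>i\<in>A. of_real (c i) * z powi i)"
  unfolding symbol_def by (rule sum.mono_neutral_left) (use assms in auto)

lemma symbol_mask_avg:
  assumes "finite {i. c i \<noteq> 0}" and "z \<noteq> 0"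
  shows "symbol (mask_avg c) z = (1 + z) / 2 * symbol c z"
proof -
  define A where "A = {i. c i \<noteq> 0} \<union> {i. c (i - 1) \<noteq> 0}"
  have A: "finite A" unfolding A_def using assms finite_mask_shift by blast
  have "(\<Sum>i\<in>A. of_real (c (i - 1)) * z powi i) = (\<Sum>i | c (i - 1) \<noteq> 0. of_real (c (i - 1)) * z powi i)"
    by (rule sum.mono_neutral_right[OF A]) (auto simp: A_def)
  also have "\<dots> = (\<Sum>i | c i \<noteq> 0. of_real (c i) * z powi (i + 1))"
    by (rule sum.reindex_bij_witness[of _ "\<lambda>j. j + 1" "\<lambda>j. j - 1"]) auto
  also have "\<dots> = z * symbol c z"
    unfolding symbol_def sum_distrib_left
    by (rule sum.cong) (use assms in \<open>auto simp: power_int_add algebra_simps\<close>)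
  finally have sh: "(\<Sum>i\<in>A. of_real (c (i - 1)) * z powi i) = z * symbol c z" .
  have "symbol (mask_avg c) z = (\<Sum>i\<in>A. of_real (mask_avg c i) * z powi i)"
    by (rule symbol_eq_sum[OF A]) (auto simp: A_def mask_avg_def)
  also have "\<dots> = ((\<Sum>i\<in>A. of_real (c i) * z powi i) + (\<Sum>i\<in>A. of_real (c (i - 1)) * z powi i)) / 2"
    unfolding sum.distrib[symmetric] sum_divide_distrib
    by (rule sum.cong) (auto simp: mask_avg_def algebra_simps add_divide_distrib)
  also have "(\<Sum>i\<in>A. of_real (c i) * z powi i) = symbol c z"
    by (rule symbol_eq_sum[OF A, symmetric]) (auto simp: A_def)
  finally show ?thesis unfolding sh by (simp add: field_simps)
qed

lemma symbol_funpow_mask_avg: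
  assumes "finite {i. c i \<noteq> 0}" and "z \<noteq> 0"
  shows "finite {i. (mask_avg ^^ k) c i \<noteq> 0} \<and>
    symbol ((mask_avg ^^ k) c) z = (1 + z) ^ k / 2 ^ k * symbol c z"
proof (induction k)
  case (Suc k)
  have "symbol ((mask_avg ^^ Suc k) c) z = (1 + z) / 2 * symbol ((mask_avg ^^ k) c) z"
    using symbol_mask_avg[of "(mask_avg ^^ k) c" z] Suc assms(2) by simp
  then show ?case using Suc finite_mask_avg by simp
qed (use assms in auto)

text \<open>Divided by the lowest power of z, the difference of the symbols becomes a polynomial
  that vanishes on the punctured plane, which is too many roots for a nonzero one.\<close>

lemma symbol_inject:
  assumes fa: "finite {i. a i \<noteq> 0}" and fb: "finite {i. b i \<noteq> 0}"
    and eq: "\<And>z. z \<noteq> 0 \<Longrightarrow> symbol a z = symbol b z"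
  shows "a = b"
proof (rule ccontr)
  assume "a \<noteq> b"
  then obtain l where l: "a l \<noteq> b l" by blast
  define S where "S = insert l ({i. a i \<noteq> 0} \<union> {i. b i \<noteq> 0})"
  have S: "finite S" unfolding S_def using fa fb by simp
  define L where "L = Min S"
  define N where "N = nat (Max S - L)"
  have SI: "S \<subseteq> {L..L + int N}"
  proof
    fix i assume "i \<in> S"
    then have "L \<le> i" "i \<le> Max S" using S by (auto simp: L_def)
    then show "i \<in> {L..L + int N}" by (auto simp: N_def)
  qed
  define d where "d n = complex_of_real (a (L + int n) - b (L + int n))" for n
  have shift: "(\<Sum>i\<in>{L..L + int N}. f i) = (\<Sum>n\<le>N. f (L + int n))" for f :: "int \<Rightarrow> complex"
    by (rule sum.reindex_bij_witness[of _ "\<lambda>n. L + int n" "\<lambda>i. nat (i - L)"]) auto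
  have zero: "(\<Sum>n\<le>N. d n * z ^ n) = 0" if z: "z \<noteq> 0" for z
  proof -
    have "symbol a z - symbol b z = (\<Sum>i\<in>{L..L + int N}. of_real (a i - b i) * z powi i)"
      using SI by (subst (1 2) symbol_eq_sum[of "{L..L + int N}"])
        (auto simp: S_def sum_subtractf algebra_simps)
    also have "\<dots> = (\<Sum>n\<le>N. d n * z powi (L + int n))"
      by (simp add: shift d_def)
    also have "\<dots> = z powi L * (\<Sum>n\<le>N. d n * z ^ n)"
      unfolding sum_distrib_left by (rule sum.cong) (use z in \<open>auto simp: power_int_add\<close>)
    finally show ?thesis using eq[OF z] z by simp
  qed
  obtain n where n: "l = L + int n" "n \<le> N"
  proof
    have "l \<in> {L..L + int N}" using SI by (auto simp: S_def)
    then show "l = L + int (nat (l - L))" "nat (l - L) \<le> N" by auto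
  qed
  have "finite {z. (\<Sum>n\<le>N. d n * z ^ n) = 0}"
    by (rule polyfun_rootbound_finite) (use l n in \<open>auto simp: d_def intro!: exI[of _ n]\<close>)
  moreover have "- {0} \<subseteq> {z. (\<Sum>n\<le>N. d n * z ^ n) = 0}" using zero by auto
  ultimately have "finite (- {0::complex})" by (rule rev_finite_subset)
  then show False by (simp add: finite_compl infinite_UNIV_char_0)
qed

section \<open>Finite differences of families of polygons\<close>

definition bounded_by :: "(nat \<Rightarrow> real) \<Rightarrow> (nat \<Rightarrow> 'a::real_normed_vector polygon) \<Rightarrow> bool" where
  "bounded_by W x \<longleftrightarrow> (\<exists>C. \<forall>k i. norm (x k i) \<le> C * W k)"

text \<open>\<open>dominated m \<eta> W x\<close> says that the differences of order \<open>s \<le> m\<close> of \<open>x k\<close> are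
  \<open>O(W k * \<eta> k ^ s)\<close>, uniformly in \<open>k\<close>.\<close>

primrec dominated ::
  "nat \<Rightarrow> (nat \<Rightarrow> real) \<Rightarrow> (nat \<Rightarrow> real) \<Rightarrow> (nat \<Rightarrow> 'a::real_normed_vector polygon) \<Rightarrow> bool" where
  "dominated 0 \<eta> W x = bounded_by W x"
| "dominated (Suc m) \<eta> W x =
     (bounded_by W x \<and> dominated m \<eta> (\<lambda>k. W k * \<eta> k) (\<lambda>k. bdiff (x k)))"

lemma bounded_byI: "(\<And>k i. norm (x k i) \<le> C * W k) \<Longrightarrow> bounded_by W x"
  by (auto simp: bounded_by_def)

text \<open>Lifts an estimate for a single polygon, whose constant does not depend on the level, to
  families, so that the weights never enter the estimate itself.\<close>

lemma bounded_by_compose: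
  assumes "bounded_by W x"
    and "\<And>k A. (\<And>j. norm (x k j) \<le> A) \<Longrightarrow> (\<And>i. norm (y k i) \<le> K * A)"
  shows "bounded_by W y"
proof -
  obtain C where "\<And>k i. norm (x k i) \<le> C * W k" using assms(1) by (auto simp: bounded_by_def)
  then have "norm (y k i) \<le> K * (C * W k)" for k i using assms(2) by blast
  then show ?thesis by (intro bounded_byI[of _ "K * C"]) (simp add: mult.assoc)
qed

lemma bounded_by_compose2:
  assumes "bounded_by W x" and "bounded_by V y"
    and "\<And>k A B. (\<And>j. norm (x k j) \<le> A) \<Longrightarrow> (\<And>j. norm (y k j) \<le> B)
      \<Longrightarrow> (\<And>i. norm (z k i) \<le> K * A * B)"
  shows "bounded_by (\<lambda>k. W k * V k) z"
proof -
  obtain C where C: "\<And>k i. norm (x k i) \<le> C * W k" using assms(1) by (auto simp: bounded_by_def)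
  obtain D where "\<And>k i. norm (y k i) \<le> D * V k" using assms(2) by (auto simp: bounded_by_def)
  with C have "norm (z k i) \<le> K * (C * W k) * (D * V k)" for k i using assms(3) by blast
  then show ?thesis by (intro bounded_byI[of _ "K * C * D"]) (simp add: mult_ac)
qed

lemma bounded_by_add:
  assumes "bounded_by W x" "bounded_by W y" shows "bounded_by W (\<lambda>k i. x k i + y k i)"
proof -
  obtain C where C: "\<And>k i. norm (x k i) \<le> C * W k" using assms(1) by (auto simp: bounded_by_def)
  obtain D where "\<And>k i. norm (y k i) \<le> D * W k" using assms(2) by (auto simp: bounded_by_def)
  with C show ?thesis
    by (intro bounded_byI[of _ "C + D"]) (auto simp: distrib_right intro: norm_triangle_mono)
qed

lemma bounded_by_prod:
  assumes "bounded_bilinear f" and "bounded_by W x" and "bounded_by V y"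
  shows "bounded_by (\<lambda>k. W k * V k) (\<lambda>k i. f (x k i) (y k i))"
proof -
  interpret bounded_bilinear f by fact
  obtain K where "0 \<le> K" and K: "\<And>a b. norm (f a b) \<le> norm a * norm b * K"
    using nonneg_bounded by blast
  show ?thesis
  proof (rule bounded_by_compose2[OF assms(2,3)])
    fix k A B i
    assume A: "\<And>j. norm (x k j) \<le> A" and B: "\<And>j. norm (y k j) \<le> B"
    have "0 \<le> A" using A[of 0] norm_ge_zero order_trans by blast
    have "norm (f (x k i) (y k i)) \<le> norm (x k i) * norm (y k i) * K" by (rule K)
    also have "\<dots> \<le> A * B * K"
      using A[of i] B[of i] \<open>0 \<le> A\<close> \<open>0 \<le> K\<close> by (intro mult_mono mult_right_mono) auto
    finally show "norm (f (x k i) (y k i)) \<le> K * A * B" by (simp add: mult_ac)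
  qed
qed

lemma bounded_by_decay:
  assumes "\<And>k. 0 < \<eta> k" "\<And>k. \<eta> k \<le> 1" and "bounded_by (\<lambda>k. W k * \<eta> k) x"
  shows "bounded_by W x"
proof -
  obtain C where C: "\<And>k i. norm (x k i) \<le> C * (W k * \<eta> k)"
    using assms(3) by (auto simp: bounded_by_def)
  have "C * (W k * \<eta> k) \<le> C * W k" for k
  proof -
    \<comment> \<open>Neither \<open>C\<close> nor \<open>W\<close> has a known sign; nonnegativity
      of the product is read off from the norm that it bounds.\<close>
    have "0 \<le> (C * W k) * \<eta> k"
      using order_trans[OF norm_ge_zero C[of k 0]] by (simp add: mult_ac)
    then have "0 \<le> C * W k" using assms(1)[of k] by (simp add: zero_le_mult_iff)
    then have "(C * W k) * \<eta> k \<le> (C * W k) * 1" using assms(2) by (intro mult_left_mono)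
    then show ?thesis by (simp add: mult_ac)
  qed
  then show ?thesis using C by (meson bounded_byI order_trans)
qed

section \<open>Calculus of the \<open>dominated\<close> classes\<close>

lemma dominated_imp_bounded: "dominated m \<eta> W x \<Longrightarrow> bounded_by W x"
  by (cases m) auto

lemma bdiff_add: "bdiff (\<lambda>i. x i + y i) = (\<lambda>i. bdiff x i + bdiff y i)"
  by (simp add: bdiff_def[abs_def] algebra_simps)

lemma bdiff_linear: "linear f \<Longrightarrow> bdiff (\<lambda>i. f (x i)) = (\<lambda>i. f (bdiff x i))"
  by (simp add: bdiff_def[abs_def] linear_diff)

lemma dominated_Suc_imp: "dominated (Suc m) \<eta> W x \<Longrightarrow> dominated m \<eta> W x"
  by (induction m arbitrary: W x) auto

lemma dominated_add:
  "dominated m \<eta> W x \<Longrightarrow> dominated m \<eta> W y \<Longrightarrow> dominated m \<eta> W (\<lambda>k i. x k i + y k i)"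
  by (induction m arbitrary: W x y) (auto simp: bounded_by_add bdiff_add)

lemma bounded_by_linear:
  assumes "bounded_linear f" and "bounded_by W x" shows "bounded_by W (\<lambda>k i. f (x k i))"
proof -
  obtain K where K: "\<And>v. norm (f v) \<le> norm v * K" "0 \<le> K"
    using bounded_linear.nonneg_bounded[OF assms(1)] by blast
  show ?thesis
  proof (rule bounded_by_compose[OF assms(2), where K = K])
    fix k A i
    assume "\<And>j. norm (x k j) \<le> A"
    then have "norm (x k i) * K \<le> A * K" using K(2) by (intro mult_right_mono)
    then show "norm (f (x k i)) \<le> K * A" using K(1)[of "x k i"] by (simp add: mult.commute)
  qed
qed

lemma dominated_linear:
  assumes "bounded_linear f"
  shows "dominated m \<eta> W x \<Longrightarrow> dominated m \<eta> W (\<lambda>k i. f (x k i))"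
  by (induction m arbitrary: W x)
    (auto simp: bdiff_linear[OF bounded_linear.linear[OF assms]] bounded_by_linear[OF assms])

lemma dominated_uminus: "dominated m \<eta> W x \<Longrightarrow> dominated m \<eta> W (\<lambda>k i. - x k i)"
  by (rule dominated_linear[OF bounded_linear_minus[OF bounded_linear_ident]])

lemma dominated_scaleR: "dominated m \<eta> W x \<Longrightarrow> dominated m \<eta> W (\<lambda>k i. r *\<^sub>R x k i)"
  by (rule dominated_linear[OF bounded_linear_scaleR_right])

lemma dominated_diff:
  assumes "dominated m \<eta> W x" "dominated m \<eta> W y" shows "dominated m \<eta> W (\<lambda>k i. x k i - y k i)"
  using dominated_add[OF assms(1) dominated_uminus[OF assms(2)]] by simp

lemma dominated_zero: "dominated m \<eta> W (\<lambda>k i. 0)"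
proof (induction m arbitrary: W)
  case (Suc m)
  have "bdiff (\<lambda>i. 0 :: 'a) = (\<lambda>i. 0)" by (simp add: bdiff_def[abs_def])
  then show ?case using Suc by (auto intro: bounded_byI[of _ 0])
qed (auto intro: bounded_byI[of _ 0])

lemma dominated_sum:
  "finite A \<Longrightarrow> (\<And>t. t \<in> A \<Longrightarrow> dominated m \<eta> W (x t)) \<Longrightarrow> dominated m \<eta> W (\<lambda>k i. \<Sum>t\<in>A. x t k i)"
  by (induction A rule: finite_induct) (auto intro: dominated_zero dominated_add)

lemma dominated_const: "dominated m \<eta> (\<lambda>_. 1) (\<lambda>k i. v)"
proof (cases m)
  case (Suc n)
  have "bdiff (\<lambda>i. v) = (\<lambda>i. 0)" by (simp add: bdiff_def[abs_def])
  then show ?thesis using Suc dominated_zero[of n] by (auto intro: bounded_byI[of _ "norm v"])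
qed (auto intro: bounded_byI[of _ "norm v"])

lemma dominated_shift: "dominated m \<eta> W x \<Longrightarrow> dominated m \<eta> W (\<lambda>k i. x k (i - e))"
proof (induction m arbitrary: W x)
  case (Suc m)
  have "bdiff (\<lambda>i. x k (i - e)) = (\<lambda>i. bdiff (x k) (i - e))" for k
    by (simp add: bdiff_def[abs_def] algebra_simps)
  moreover have "bounded_by W (\<lambda>k i. x k (i - e))"
    using dominated_imp_bounded[OF Suc.prems] unfolding bounded_by_def by blast
  moreover have "dominated m \<eta> (\<lambda>k. W k * \<eta> k) (\<lambda>k i. bdiff (x k) (i - e))"
    using Suc.prems by (intro Suc.IH) simp
  ultimately show ?case by simp
next
  case 0
  then show ?case unfolding dominated.simps bounded_by_def by blast
qed

text \<open>The Leibniz rule is asymmetric; its \<open>x (i - 1)\<close> is the source of the index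
  shifts carried through the product estimates below.\<close>

lemma bdiff_prod:
  assumes "bounded_bilinear f"
  shows "bdiff (\<lambda>i. f (x i) (y i)) = (\<lambda>i. f (bdiff x i) (y i) + f (x (i - 1)) (bdiff y i))"
  by (simp add: bdiff_def[abs_def] bounded_bilinear.diff_left[OF assms]
      bounded_bilinear.diff_right[OF assms])

lemma dominated_prod:
  assumes "bounded_bilinear f"
  shows "dominated m \<eta> W x \<Longrightarrow> dominated m \<eta> V y
    \<Longrightarrow> dominated m \<eta> (\<lambda>k. W k * V k) (\<lambda>k i. f (x k i) (y k i))"
proof (induction m arbitrary: W x V y)
  case (Suc m)
  have "dominated m \<eta> (\<lambda>k. W k * \<eta> k * V k) (\<lambda>k i. f (bdiff (x k) i) (y k i))"
    using Suc.prems by (intro Suc.IH) (auto intro: dominated_Suc_imp)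
  moreover have "dominated m \<eta> (\<lambda>k. W k * (V k * \<eta> k)) (\<lambda>k i. f (x k (i - 1)) (bdiff (y k) i))"
    using Suc.prems dominated_shift[of m \<eta> W x 1] dominated_Suc_imp[of m \<eta> W x] by (intro Suc.IH) auto
  ultimately have "dominated m \<eta> (\<lambda>k. W k * V k * \<eta> k)
      (\<lambda>k i. f (bdiff (x k) i) (y k i) + f (x k (i - 1)) (bdiff (y k) i))"
    by (intro dominated_add) (simp_all add: mult_ac)
  moreover have "bounded_by (\<lambda>k. W k * V k) (\<lambda>k i. f (x k i) (y k i))"
    using Suc.prems by (intro bounded_by_prod[OF assms]) auto
  ultimately show ?case by (simp add: bdiff_prod[OF assms])
qed (simp add: bounded_by_prod[OF assms])

text \<open>Size substitutes for smoothness: a difference at most doubles the sup norm, so a family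
  of size \<open>W k * \<eta> k ^ m\<close> meets the requirement at every order up to
  \<open>m\<close>.\<close>

lemma dominated_of_small:
  assumes "\<And>k. 0 < \<eta> k" "\<And>k. \<eta> k \<le> 1"
  shows "bounded_by (\<lambda>k. W k * \<eta> k ^ m) x \<Longrightarrow> dominated m \<eta> W x"
proof (induction m arbitrary: W x)
  case (Suc m)
  have "bounded_by W x"
  proof -
    have "bounded_by (\<lambda>k. W k * \<eta> k ^ n) x \<Longrightarrow> bounded_by W x" for n
    proof (induction n)
      case (Suc n)
      then show ?case using bounded_by_decay[OF assms, where W = "\<lambda>k. W k * \<eta> k ^ n" and x = x] by (simp add: mult_ac)
    qed simp
    then show ?thesis using Suc.prems by blast
  qed
  moreover have "dominated m \<eta> (\<lambda>k. W k * \<eta> k) (\<lambda>k. bdiff (x k))"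
  proof (rule Suc.IH)
    have "bounded_by (\<lambda>k. W k * \<eta> k ^ Suc m) (\<lambda>k. bdiff (x k))"
    proof (rule bounded_by_compose[OF Suc.prems])
      fix k A i
      assume "\<And>j. norm (x k j) \<le> A"
      then show "norm (bdiff (x k) i) \<le> 2 * A"
        using norm_triangle_ineq4[of "x k i" "x k (i - 1)"] unfolding bdiff_def
        by (smt (verit))
    qed
    then show "bounded_by (\<lambda>k. W k * \<eta> k * \<eta> k ^ m) (\<lambda>k. bdiff (x k))" by (simp add: mult_ac)
  qed
  ultimately show ?case by simp
qed simp

lemma dominated_imp_funpow:
  "dominated m \<eta> W x \<Longrightarrow> s \<le> m \<Longrightarrow> bounded_by (\<lambda>k. W k * \<eta> k ^ s) (\<lambda>k. (bdiff ^^ s) (x k))"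
proof (induction m arbitrary: W x s)
  case (Suc m)
  show ?case
  proof (cases s)
    case (Suc t)
    then have "bounded_by (\<lambda>k. W k * \<eta> k * \<eta> k ^ t) (\<lambda>k. (bdiff ^^ t) (bdiff (x k)))"
      using Suc.prems by (intro Suc.IH) auto
    then show ?thesis by (simp add: Suc funpow_Suc_right mult_ac del: funpow.simps)
  qed (use Suc.prems in simp)
qed simp

lemma dominated_of_funpow:
  "(\<And>s. s \<le> m \<Longrightarrow> bounded_by (\<lambda>k. W k * \<eta> k ^ s) (\<lambda>k. (bdiff ^^ s) (x k))) \<Longrightarrow> dominated m \<eta> W x"
proof (induction m arbitrary: W x)
  case (Suc m)
  have "dominated m \<eta> (\<lambda>k. W k * \<eta> k) (\<lambda>k. bdiff (x k))"
  proof (rule Suc.IH)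
    fix s assume "s \<le> m"
    then show "bounded_by (\<lambda>k. W k * \<eta> k * \<eta> k ^ s) (\<lambda>k. (bdiff ^^ s) (bdiff (x k)))"
      using Suc.prems[of "Suc s"] by (simp add: funpow_Suc_right mult_ac del: funpow.simps)
  qed
  then show ?case using Suc.prems[of 0] by simp
next
  case 0
  then show ?case using 0[of 0] by simp
qed

text \<open>The difference of 1/x is -bdiff x / (x(i) x(i-1)), which involves reciprocals only at
  one order less, so the induction closes by the product rule.\<close>

lemma dominated_inverse:
  fixes x :: "nat \<Rightarrow> real polygon"
  assumes "0 < d" and lower: "\<And>k i. d \<le> x k i"
  shows "dominated m \<eta> (\<lambda>_. 1) x \<Longrightarrow> dominated m \<eta> (\<lambda>_. 1) (\<lambda>k i. 1 / x k i)"
proof (induction m)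
  case 0
  have "norm (1 / x k i) \<le> 1 / d * 1" for k i
    using assms(1) lower[of k i] by (simp add: frac_le)
  then show ?case unfolding dominated.simps by (rule bounded_byI[of _ "1 / d"])
next
  case (Suc m)
  have inv: "dominated m \<eta> (\<lambda>_. 1) (\<lambda>k i. 1 / x k i)"
    using Suc dominated_Suc_imp by blast
  have "dominated m \<eta> (\<lambda>k. \<eta> k * (1 * 1)) (\<lambda>k i. bdiff (x k) i * (1 / x k i * (1 / x k (i - 1))))"
    using Suc.prems
    by (intro dominated_prod[OF bounded_bilinear_mult] inv dominated_shift[OF inv]) simp
  then have "dominated m \<eta> \<eta> (\<lambda>k i. - (bdiff (x k) i * (1 / x k i * (1 / x k (i - 1)))))"
    using dominated_uminus by fastforce
  moreover have "- (bdiff (x k) i * (1 / x k i * (1 / x k (i - 1)))) = bdiff (\<lambda>i. 1 / x k i) i" for k i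
  proof -
    have "x k i \<noteq> 0" "x k (i - 1) \<noteq> 0" using assms(1) lower[of k i] lower[of k "i - 1"] by auto
    then show ?thesis by (simp add: bdiff_def field_simps)
  qed
  ultimately show ?case using dominated_imp_bounded[OF inv] by simp
qed

text \<open>Makes lengths accessible through inner products: the difference of x is the difference
  of x^2 divided by x(i) + x(i-1), and the divisor is bounded below.\<close>

lemma dominated_sqrt:
  fixes x :: "nat \<Rightarrow> real polygon"
  assumes "0 < d" and lower: "\<And>k i. d \<le> x k i"
  shows "dominated m \<eta> (\<lambda>_. 1) (\<lambda>k i. x k i * x k i) \<Longrightarrow> dominated m \<eta> (\<lambda>_. 1) x"
proof (induction m)
  case 0
  then obtain C where C: "\<And>k i. \<bar>x k i * x k i\<bar> \<le> C" by (auto simp: bounded_by_def)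
  \<comment> \<open>Completing the square gives |x| \<le> x^2 + 1/4.\<close>
  have "\<bar>x k i\<bar> \<le> 1 + C" for k i
    using C[of k i] zero_le_square[of "\<bar>x k i\<bar> - 1/2"]
    by (simp add: algebra_simps abs_mult abs_mult_self_eq)
  then show ?case by (auto intro!: bounded_byI[of _ "1 + C"])
next
  case (Suc m)
  have x: "dominated m \<eta> (\<lambda>_. 1) x"
    using Suc dominated_Suc_imp by blast
  have "2 * d \<le> x k i + x k (i - 1)" for k i using lower[of k i] lower[of k "i - 1"] by simp
  then have inv: "dominated m \<eta> (\<lambda>_. 1) (\<lambda>k i. 1 / (x k i + x k (i - 1)))"
    using assms(1) by (intro dominated_inverse[of "2 * d"] dominated_add x dominated_shift) auto
  have "dominated m \<eta> (\<lambda>k. \<eta> k * 1) (\<lambda>k i. bdiff (\<lambda>i. x k i * x k i) i * (1 / (x k i + x k (i - 1))))"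
    using Suc.prems by (intro dominated_prod[OF bounded_bilinear_mult] inv) simp
  moreover have "bdiff (\<lambda>i. x k i * x k i) i * (1 / (x k i + x k (i - 1))) = bdiff (x k) i" for k i
  proof -
    have "x k i + x k (i - 1) \<noteq> 0" using assms(1) lower[of k i] lower[of k "i - 1"] by auto
    then show ?thesis by (simp add: bdiff_def field_simps)
  qed
  ultimately show ?case using dominated_imp_bounded[OF x] by simp
qed

section \<open>Subdivision is multiplicative to leading order\<close>

lemma norm_diff_le_bdiff:
  assumes "\<And>j. norm (bdiff X j) \<le> A"
  shows "norm (X a - X b) \<le> of_int \<bar>a - b\<bar> * A"
proof -
  have up: "norm (X (b + int n) - X b) \<le> of_nat n * A" for b n
  proof (induction n)
    case (Suc n)
    have "X (b + int (Suc n)) - X b = bdiff X (b + int (Suc n)) + (X (b + int n) - X b)"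
      by (simp add: bdiff_def algebra_simps)
    also have "norm \<dots> \<le> A + of_nat n * A"
      by (rule norm_triangle_mono[OF assms Suc])
    finally show ?case by (simp add: algebra_simps)
  qed simp
  show ?thesis
  proof (cases "b \<le> a")
    case True
    then show ?thesis using up[of b "nat (a - b)"] by simp
  next
    case False
    then show ?thesis using up[of a "nat (b - a)"] by (simp add: norm_minus_commute)
  qed
qed

text \<open>As the mask reproduces constants, \<open>X l - subdiv c X i\<close> is the combination
  of the \<open>X l - X j\<close> over the stencil of \<open>i\<close>, and every such
  \<open>j\<close> lies within \<open>N + L\<close> of \<open>l\<close>.\<close>

lemma norm_diff_subdiv_le:
  assumes "affine_mask c" and "\<And>i. c i \<noteq> 0 \<Longrightarrow> \<bar>i\<bar> \<le> N"
    and "\<And>j. norm (bdiff X j) \<le> A" and "\<bar>i - 2 * l\<bar> \<le> L"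
  shows "norm (X l - subdiv c X i) \<le> mask_norm c * (of_int (N + L) * A)"
proof -
  have A: "0 \<le> A" using order_trans[OF norm_ge_zero assms(3)] .
  have "X l - subdiv c X i = subdiv c (\<lambda>j. X l - X j) i"
    using subdiv_diff[of c "\<lambda>j. X l" X i] subdiv_const[OF assms(1)] by metis
  also have "norm \<dots> \<le> mask_norm c * (of_int (N + L) * A)"
  proof (rule norm_subdiv_le[OF affine_mask_finite[OF assms(1)]])
    fix j assume "c (i - 2 * j) \<noteq> 0"
    then have "\<bar>l - j\<bar> \<le> N + L" using assms(2)[of "i - 2 * j"] assms(4) by auto
    then have "of_int \<bar>l - j\<bar> * A \<le> of_int (N + L) * A"
      using A by (intro mult_right_mono) (simp_all only: of_int_le_iff)
    then show "norm (X l - X j) \<le> of_int (N + L) * A"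
      using norm_diff_le_bdiff[of X A l j] assms(3) by simp
  next
    obtain i0 where "c i0 \<noteq> 0"
      using affine_mask_stencil_nonempty[OF assms(1)] by blast
    then have "0 \<le> N + L" using assms(2)[of i0] assms(4) by linarith
    then have "0 \<le> real_of_int (N + L)" by linarith
    then show "0 \<le> of_int (N + L) * A" using A by (rule mult_nonneg_nonneg)
  qed
  finally show ?thesis .
qed

lemma mask_radius:
  fixes c :: mask
  assumes "finite {i. c i \<noteq> 0}"
  obtains N where "\<And>i. c i \<noteq> 0 \<Longrightarrow> \<bar>i\<bar> \<le> N"
proof
  fix i assume "c i \<noteq> 0"
  then show "\<bar>i\<bar> \<le> Max (abs ` {i. c i \<noteq> 0})" using assms by (intro Max_ge) auto
qed

text \<open>Only one factor has to oscillate little: \<open>X\<close> is frozen at the value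
  \<open>subdiv d X (i - e)\<close>, which by linearity passes through \<open>subdiv c\<close>, and
  what remains is subdivision of \<open>f (X - v) Y\<close>. Any affine mask \<open>d\<close> yields
  a suitable value to freeze at; the shift \<open>e\<close> provides for the shifts of the Leibniz
  rule.\<close>

lemma subdiv_prod_defect_bound:
  fixes f :: "'a::real_normed_vector \<Rightarrow> 'b::real_normed_vector \<Rightarrow> 'c::real_normed_vector"
  assumes "bounded_bilinear f" and c: "affine_mask c" and d: "affine_mask d"
  obtains K where "\<And>X Y A B i. (\<And>j. norm (bdiff X j) \<le> A) \<Longrightarrow> (\<And>j. norm (Y j) \<le> B) \<Longrightarrow>
    norm (subdiv c (\<lambda>j. f (X (j - e)) (Y j)) i - f (subdiv d X (i - e)) (subdiv c Y i)) \<le> K * A * B"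
proof -
  interpret bounded_bilinear f by fact
  obtain F where F: "0 \<le> F" "\<And>a b. norm (f a b) \<le> norm a * norm b * F"
    using nonneg_bounded by blast
  obtain N where N: "\<And>i. c i \<noteq> 0 \<Longrightarrow> \<bar>i\<bar> \<le> N" using mask_radius[OF affine_mask_finite[OF c]] by blast
  obtain N' where N': "\<And>i. d i \<noteq> 0 \<Longrightarrow> \<bar>i\<bar> \<le> N'" using mask_radius[OF affine_mask_finite[OF d]] by blast
  define K where "K = mask_norm d * of_int (N' + (N + \<bar>e\<bar>))"
  show thesis
  proof (rule that[of "mask_norm c * (F * K)"])
    fix X :: "'a polygon" and Y :: "'b polygon" and A B :: real and i
    assume X: "\<And>j. norm (bdiff X j) \<le> A" and Y: "\<And>j. norm (Y j) \<le> B"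
    define v where "v = subdiv d X (i - e)"
    have B: "0 \<le> B" using order_trans[OF norm_ge_zero Y] .
    have XK: "norm (X (j - e) - v) \<le> K * A" if "c (i - 2 * j) \<noteq> 0" for j
    proof -
      have "\<bar>(i - e) - 2 * (j - e)\<bar> \<le> N + \<bar>e\<bar>" using N[OF that] by presburger
      then have "norm (X (j - e) - v) \<le> mask_norm d * (of_int (N' + (N + \<bar>e\<bar>)) * A)"
        unfolding v_def by (intro norm_diff_subdiv_le[OF d N' X])
      then show ?thesis by (simp add: K_def mult.assoc)
    qed
    obtain j0 where "c (i - 2 * j0) \<noteq> 0"
      using affine_mask_stencil_nonempty[OF c] by blast
    from XK[OF this] have KA: "0 \<le> K * A" using order_trans[OF norm_ge_zero] by blast
    have "subdiv c (\<lambda>j. f (X (j - e)) (Y j)) i - f v (subdiv c Y i)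
        = subdiv c (\<lambda>j. f (X (j - e) - v) (Y j)) i"
      using subdiv_diff[of c "\<lambda>j. f (X (j - e)) (Y j)" "\<lambda>j. f v (Y j)" i]
        subdiv_linear[OF bounded_linear.linear[OF bounded_linear_right[of v]], of c Y i]
      by (simp add: diff_left)
    also have "norm \<dots> \<le> mask_norm c * (K * A * B * F)"
    proof (rule norm_subdiv_le[OF affine_mask_finite[OF c]])
      fix j assume j: "c (i - 2 * j) \<noteq> 0"
      have "norm (f (X (j - e) - v) (Y j)) \<le> norm (X (j - e) - v) * norm (Y j) * F" by (rule F)
      also have "\<dots> \<le> K * A * B * F"
        using XK[OF j] Y[of j] KA F(1) by (intro mult_right_mono mult_mono) auto
      finally show "norm (f (X (j - e) - v) (Y j)) \<le> K * A * B * F" .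
    qed (use KA B F in auto)
    finally show "norm (subdiv c (\<lambda>j. f (X (j - e)) (Y j)) i - f (subdiv d X (i - e)) (subdiv c Y i))
        \<le> mask_norm c * (F * K) * A * B" by (simp add: v_def mult_ac)
  qed
qed

text \<open>The product defect with the constant factor 1: two masks that reproduce constants differ
  only by the oscillation of the polygon.\<close>

lemma subdiv_change_mask_bound:
  assumes c: "affine_mask c" and d: "affine_mask d"
  obtains K where "\<And>(X::'a::real_normed_vector polygon) A i. (\<And>j. norm (bdiff X j) \<le> A) \<Longrightarrow>
    norm (subdiv c X i - subdiv d X i) \<le> K * A"
proof -
  obtain K where K: "\<And>(X::'a polygon) Y A B i. (\<And>j. norm (bdiff X j) \<le> A) \<Longrightarrow> (\<And>j. norm (Y j) \<le> B) \<Longrightarrow>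
    norm (subdiv c (\<lambda>j. Y j *\<^sub>R X (j - 0)) i - subdiv c Y i *\<^sub>R subdiv d X (i - 0)) \<le> K * A * B"
    using subdiv_prod_defect_bound[OF bounded_bilinear.flip[OF bounded_bilinear_scaleR] c d, of 0] by blast
  show thesis
  proof (rule that[of K])
    fix X :: "'a polygon" and A i
    assume "\<And>j. norm (bdiff X j) \<le> A"
    then show "norm (subdiv c X i - subdiv d X i) \<le> K * A"
      using K[of X A "\<lambda>j. 1" 1 i] by (simp add: subdiv_const[OF c])
  qed
qed

text \<open>\<open>c s\<close> is the mask that governs the differences of order \<open>s\<close>.
  In the application \<open>c 0\<close> is \<open>a\<close>, \<open>c m\<close> is \<open>b\<close>,
  and each step from \<open>s\<close> to \<open>Suc s\<close> strips one factor (1 + z) / 2 from the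
  symbol.\<close>

locale mask_chain =
  fixes c :: "nat \<Rightarrow> mask" and m :: nat
  assumes affine: "s \<le> m \<Longrightarrow> affine_mask (c s)"
    and avg: "s < m \<Longrightarrow> c s = mask_avg (c (Suc s))"
begin

lemma bdiff_subdiv:
  "s < m \<Longrightarrow> bdiff (subdiv (c s) P) = (\<lambda>i. (1/2) *\<^sub>R subdiv (c (Suc s)) (bdiff P) i)"
  using avg affine[of "Suc s"] bdiff_subdiv_mask_avg[OF affine_mask_finite] by simp

lemma funpow_bdiff_subdiv:
  "s \<le> m \<Longrightarrow> (bdiff ^^ s) (subdiv (c 0) P) = (\<lambda>i. (1/2) ^ s *\<^sub>R subdiv (c s) ((bdiff ^^ s) P) i)"
proof (induction s)
  case (Suc s)
  then have "(bdiff ^^ Suc s) (subdiv (c 0) P)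
      = bdiff (\<lambda>i. (1/2) ^ s *\<^sub>R subdiv (c s) ((bdiff ^^ s) P) i)" by simp
  also have "\<dots> = (\<lambda>i. (1/2) ^ s *\<^sub>R bdiff (subdiv (c s) ((bdiff ^^ s) P)) i)"
    by (rule bdiff_linear) (simp add: linear_iff scaleR_right_distrib)
  finally show ?case using Suc.prems by (simp add: bdiff_subdiv)
qed simp

lemma bounded_by_subdiv:
  assumes "s \<le> m" and "bounded_by W x" shows "bounded_by W (\<lambda>l. subdiv (c s) (x l))"
proof (rule bounded_by_compose[OF assms(2)])
  fix k A i assume "\<And>j. norm (x k j) \<le> A"
  then show "norm (subdiv (c s) (x k) i) \<le> mask_norm (c s) * A"
    using order_trans[OF norm_ge_zero] affine[OF assms(1)]
    by (intro norm_subdiv_le affine_mask_finite) blast+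
qed

lemma dominated_subdiv:
  "u + k \<le> m \<Longrightarrow> dominated k \<eta> W x \<Longrightarrow> dominated k \<eta> W (\<lambda>l. subdiv (c u) (x l))"
proof (induction k arbitrary: u W x)
  case (Suc k)
  have "dominated k \<eta> (\<lambda>l. W l * \<eta> l) (\<lambda>l. subdiv (c (Suc u)) (bdiff (x l)))"
    using Suc.prems by (intro Suc.IH) auto
  then have "dominated k \<eta> (\<lambda>l. W l * \<eta> l) (\<lambda>l i. (1/2) *\<^sub>R subdiv (c (Suc u)) (bdiff (x l)) i)"
    by (rule dominated_scaleR)
  then show ?case using Suc.prems by (simp add: bounded_by_subdiv bdiff_subdiv)
qed (simp add: bounded_by_subdiv)

text \<open>If \<open>v = 0\<close> and \<open>u \<noteq> 0\<close>, the factor \<open>y\<close> is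
  frozen and the product already carries the mask \<open>c u\<close> of \<open>x\<close>. Otherwise
  \<open>x\<close> is frozen, and then \<open>c (u + v)\<close> is exchanged for \<open>c v\<close>
  on \<open>y\<close>, which is void for \<open>u = 0\<close> and else costs the oscillation of
  \<open>y\<close>. The alternatives in the assumptions on \<open>x\<close> and \<open>y\<close>
  record exactly which oscillations these cases use.\<close>

lemma bounded_by_prod_defect:
  fixes f :: "'a::real_normed_vector \<Rightarrow> 'b::real_normed_vector \<Rightarrow> 'c::real_normed_vector"
  assumes "bounded_bilinear f" and uv: "u + v \<le> m"
    and x: "bounded_by W x" "v = 0 \<and> u \<noteq> 0 \<or> bounded_by (\<lambda>l. W l * \<eta> l) (\<lambda>l. bdiff (x l))"
    and y: "bounded_by V y" "u = 0 \<or> bounded_by (\<lambda>l. V l * \<eta> l) (\<lambda>l. bdiff (y l))"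
  shows "bounded_by (\<lambda>l. W l * V l * \<eta> l)
    (\<lambda>l i. subdiv (c (u + v)) (\<lambda>j. f (x l (j - int v)) (y l j)) i
         - f (subdiv (c u) (x l) (i - int v)) (subdiv (c v) (y l) i))"
proof -
  interpret bounded_bilinear f by fact
  have ac: "affine_mask (c (u + v))" "affine_mask (c u)" "affine_mask (c v)"
    using affine uv by auto
  show ?thesis
  proof (cases "v = 0 \<and> u \<noteq> 0")
    case True
    then have dy: "bounded_by (\<lambda>l. V l * \<eta> l) (\<lambda>l. bdiff (y l))" using y by auto
    obtain K where "\<And>Y X A B i. (\<And>j. norm (bdiff Y j) \<le> A) \<Longrightarrow> (\<And>j. norm (X j) \<le> B) \<Longrightarrow>
        norm (subdiv (c u) (\<lambda>j. f (X j) (Y (j - 0))) i - f (subdiv (c u) X i) (subdiv (c v) Y (i - 0)))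
          \<le> K * A * B"
      using subdiv_prod_defect_bound[OF flip ac(2,3), of 0] by blast
    then have "bounded_by (\<lambda>l. V l * \<eta> l * W l)
        (\<lambda>l i. subdiv (c u) (\<lambda>j. f (x l j) (y l j)) i - f (subdiv (c u) (x l) i) (subdiv (c v) (y l) i))"
      by (intro bounded_by_compose2[OF dy x(1), where K = K]) simp
    then show ?thesis using True by (simp add: mult_ac)
  next
    case False
    then have dx: "bounded_by (\<lambda>l. W l * \<eta> l) (\<lambda>l. bdiff (x l))" using x by auto
    obtain K where "\<And>X Y A B i. (\<And>j. norm (bdiff X j) \<le> A) \<Longrightarrow> (\<And>j. norm (Y j) \<le> B) \<Longrightarrow>
        norm (subdiv (c (u + v)) (\<lambda>j. f (X (j - int v)) (Y j)) i
          - f (subdiv (c u) X (i - int v)) (subdiv (c (u + v)) Y i)) \<le> K * A * B"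
      using subdiv_prod_defect_bound[OF assms(1) ac(1,2), of "int v"] by blast
    then have 1: "bounded_by (\<lambda>l. W l * \<eta> l * V l)
        (\<lambda>l i. subdiv (c (u + v)) (\<lambda>j. f (x l (j - int v)) (y l j)) i
          - f (subdiv (c u) (x l) (i - int v)) (subdiv (c (u + v)) (y l) i))"
      by (intro bounded_by_compose2[OF dx y(1), where K = K]) simp
    have 2: "bounded_by (\<lambda>l. W l * (V l * \<eta> l)) (\<lambda>l i. f (subdiv (c u) (x l) (i - int v))
        (subdiv (c (u + v)) (y l) i - subdiv (c v) (y l) i))"
    proof (cases "u = 0")
      case True
      then show ?thesis by (simp add: zero_right bounded_byI[of _ 0])
    next
      case False
      then have dy: "bounded_by (\<lambda>l. V l * \<eta> l) (\<lambda>l. bdiff (y l))" using y by auto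
      obtain K where "\<And>(Y::'b polygon) A i. (\<And>j. norm (bdiff Y j) \<le> A) \<Longrightarrow>
          norm (subdiv (c (u + v)) Y i - subdiv (c v) Y i) \<le> K * A"
        using subdiv_change_mask_bound[OF ac(1,3)] by blast
      then have "bounded_by (\<lambda>l. V l * \<eta> l) (\<lambda>l i. subdiv (c (u + v)) (y l) i - subdiv (c v) (y l) i)"
        by (intro bounded_by_compose[OF dy, where K = K]) simp
      moreover have "bounded_by W (\<lambda>l i. subdiv (c u) (x l) (i - int v))"
        using bounded_by_subdiv[of u W x] x(1) uv by (auto simp: bounded_by_def)
      ultimately show ?thesis by (intro bounded_by_prod[OF assms(1)])
    qed
    have "bounded_by (\<lambda>l. W l * V l * \<eta> l)
        (\<lambda>l i. (subdiv (c (u + v)) (\<lambda>j. f (x l (j - int v)) (y l j)) i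
          - f (subdiv (c u) (x l) (i - int v)) (subdiv (c (u + v)) (y l) i))
          + f (subdiv (c u) (x l) (i - int v)) (subdiv (c (u + v)) (y l) i - subdiv (c v) (y l) i))"
      by (rule bounded_by_add) (use 1 2 in \<open>simp_all only: mult_ac\<close>)
    then show ?thesis by (simp add: diff_right)
  qed
qed

text \<open>The induction has to keep track of \<open>u\<close> differences taken of \<open>x\<close> and \<open>v\<close> of \<open>y\<close>; the latter
  produce the shift of \<open>x\<close>. No oscillation bound is available for a factor that has used up all its
  differences, but then the masks of the product and of that factor agree.\<close>

lemma dominated_prod_defect:
  fixes f :: "'a::real_normed_vector \<Rightarrow> 'b::real_normed_vector \<Rightarrow> 'c::real_normed_vector"
  assumes "bounded_bilinear f"
  shows "u + v + k \<le> m \<Longrightarrow> 0 < u + v + k \<Longrightarrow> dominated (k + v) \<eta> W x \<Longrightarrow> dominated (k + u) \<eta> V y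
    \<Longrightarrow> dominated k \<eta> (\<lambda>l. W l * V l * \<eta> l)
      (\<lambda>l i. subdiv (c (u + v)) (\<lambda>j. f (x l (j - int v)) (y l j)) i
         - f (subdiv (c u) (x l) (i - int v)) (subdiv (c v) (y l) i))"
proof (induction k arbitrary: u v W V x y)
  case 0
  have "v = 0 \<or> bounded_by (\<lambda>l. W l * \<eta> l) (\<lambda>l. bdiff (x l))"
    using 0(3) by (cases v) (auto dest: dominated_imp_bounded)
  moreover have "u = 0 \<or> bounded_by (\<lambda>l. V l * \<eta> l) (\<lambda>l. bdiff (y l))"
    using 0(4) by (cases u) (auto dest: dominated_imp_bounded)
  ultimately show ?case
    using 0 bounded_by_prod_defect[OF assms, of u v W x \<eta> V y] by (auto dest: dominated_imp_bounded)
next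
  case (Suc k)
  interpret bounded_bilinear f by fact
  let ?D = "\<lambda>u v x y (l::nat) i. subdiv (c (u + v)) (\<lambda>j. f (x l (j - int v)) (y l j)) i
         - f (subdiv (c u) (x l) (i - int v)) (subdiv (c v) (y l) i)"
  have x: "bounded_by W x" "bounded_by (\<lambda>l. W l * \<eta> l) (\<lambda>l. bdiff (x l))"
    using Suc.prems(3) by (auto dest: dominated_imp_bounded)
  have y: "bounded_by V y" "bounded_by (\<lambda>l. V l * \<eta> l) (\<lambda>l. bdiff (y l))"
    using Suc.prems(4) by (auto dest: dominated_imp_bounded)
  have bd: "bounded_by (\<lambda>l. W l * V l * \<eta> l) (?D u v x y)"
    using Suc.prems x y by (intro bounded_by_prod_defect[OF assms]) auto
  have 1: "dominated k \<eta> (\<lambda>l. W l * V l * \<eta> l * \<eta> l) (?D (Suc u) v (\<lambda>l. bdiff (x l)) y)"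
    using Suc.IH[of "Suc u" v "\<lambda>l. W l * \<eta> l" "\<lambda>l. bdiff (x l)" V y] Suc.prems by (simp add: mult_ac)
  have 2: "dominated k \<eta> (\<lambda>l. W l * V l * \<eta> l * \<eta> l) (?D u (Suc v) x (\<lambda>l. bdiff (y l)))"
    using Suc.IH[of u "Suc v" W x "\<lambda>l. V l * \<eta> l" "\<lambda>l. bdiff (y l)"] Suc.prems by (simp add: mult_ac)
  \<comment> \<open>By the Leibniz rule a difference falls on \<open>x\<close> and raises
    \<open>u\<close>, or falls on \<open>y\<close> and raises \<open>v\<close>.
    \<open>bdiff_subdiv\<close> supplies the same factor 1/2 in the subdivided product and in the
    product of subdivisions, so the difference of a defect is half the sum of two defects of the
    same form.\<close>
  have "bdiff (?D u v x y l) i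
      = (1/2) *\<^sub>R (?D (Suc u) v (\<lambda>l. bdiff (x l)) y l i + ?D u (Suc v) x (\<lambda>l. bdiff (y l)) l i)" for l i
  proof -
    have "bdiff (\<lambda>j. f (x l (j - int v)) (y l j))
        = (\<lambda>j. f (bdiff (x l) (j - int v)) (y l j) + f (x l (j - int (Suc v))) (bdiff (y l) j))"
      using bdiff_prod[OF assms, of "\<lambda>j. x l (j - int v)" "y l"]
      by (simp add: bdiff_def[of "\<lambda>j. x l (j - int v)"] bdiff_def[of "x l"] algebra_simps)
    then have p: "bdiff (subdiv (c (u + v)) (\<lambda>j. f (x l (j - int v)) (y l j))) i
        = (1/2) *\<^sub>R (subdiv (c (Suc (u + v))) (\<lambda>j. f (bdiff (x l) (j - int v)) (y l j)) i
          + subdiv (c (Suc (u + v))) (\<lambda>j. f (x l (j - int (Suc v))) (bdiff (y l) j)) i)"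
      using Suc.prems(1) by (simp add: bdiff_subdiv subdiv_add)
    have bx: "bdiff (\<lambda>i. subdiv (c u) (x l) (i - int v)) i
        = (1/2) *\<^sub>R subdiv (c (Suc u)) (bdiff (x l)) (i - int v)"
    proof -
      have "bdiff (\<lambda>i. subdiv (c u) (x l) (i - int v)) i = bdiff (subdiv (c u) (x l)) (i - int v)"
        by (simp add: bdiff_def algebra_simps)
      then show ?thesis using Suc.prems(1) by (simp add: bdiff_subdiv)
    qed
    have by': "bdiff (subdiv (c v) (y l)) i = (1/2) *\<^sub>R subdiv (c (Suc v)) (bdiff (y l)) i"
      using Suc.prems(1) by (simp add: bdiff_subdiv)
    have q: "bdiff (\<lambda>i. f (subdiv (c u) (x l) (i - int v)) (subdiv (c v) (y l) i)) i
        = (1/2) *\<^sub>R (f (subdiv (c (Suc u)) (bdiff (x l)) (i - int v)) (subdiv (c v) (y l) i)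
          + f (subdiv (c u) (x l) (i - int (Suc v))) (subdiv (c (Suc v)) (bdiff (y l)) i))"
      by (simp add: bdiff_prod[OF assms] bx by' scaleR_left scaleR_right scaleR_right_distrib algebra_simps)
    have "bdiff (?D u v x y l) i = bdiff (subdiv (c (u + v)) (\<lambda>j. f (x l (j - int v)) (y l j))) i
        - bdiff (\<lambda>i. f (subdiv (c u) (x l) (i - int v)) (subdiv (c v) (y l) i)) i"
      by (simp add: bdiff_def)
    then show ?thesis unfolding p q by (simp add: scaleR_right_diff_distrib scaleR_right_distrib)
  qed
  then have "(\<lambda>l. bdiff (?D u v x y l))
      = (\<lambda>l i. (1/2) *\<^sub>R (?D (Suc u) v (\<lambda>l. bdiff (x l)) y l i + ?D u (Suc v) x (\<lambda>l. bdiff (y l)) l i))"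
    by (intro ext)
  moreover have "dominated k \<eta> (\<lambda>l. W l * V l * \<eta> l * \<eta> l)
     (\<lambda>l i. (1/2) *\<^sub>R (?D (Suc u) v (\<lambda>l. bdiff (x l)) y l i + ?D u (Suc v) x (\<lambda>l. bdiff (y l)) l i))"
    by (rule dominated_scaleR[OF dominated_add[OF 1 2]])
  ultimately have "dominated k \<eta> (\<lambda>l. W l * V l * \<eta> l * \<eta> l) (\<lambda>l. bdiff (?D u v x y l))" by simp
  with bd show ?case by simp
qed

lemma dominated_subdiv_prod:
  assumes "bounded_bilinear f" and "0 < m" and "dominated m \<eta> W x" and "dominated m \<eta> V y"
  shows "dominated m \<eta> (\<lambda>l. W l * V l * \<eta> l)
    (\<lambda>l i. subdiv (c 0) (\<lambda>j. f (x l j) (y l j)) i - f (subdiv (c 0) (x l) i) (subdiv (c 0) (y l) i))"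
  using dominated_prod_defect[OF assms(1), of 0 0 m \<eta> W x V y] assms by simp

end

section \<open>The perturbation of the linear scheme by the normals\<close>

lemma dominated_power:
  fixes x :: "nat \<Rightarrow> real polygon"
  assumes "dominated m \<eta> (\<lambda>_. 1) x" shows "dominated m \<eta> (\<lambda>_. 1) (\<lambda>l i. x l i ^ r)"
proof (induction r)
  case 0
  show ?case using dominated_const[of m \<eta> 1] by simp
next
  case (Suc r)
  show ?case using dominated_prod[OF bounded_bilinear_mult assms Suc] by simp
qed

lemma geometric_remainder:
  fixes x :: real
  assumes "x \<noteq> 2"
  shows "1 / (2 - x) = (\<Sum>r<m. x ^ r / 2 ^ Suc r) + x ^ m / (2 ^ m * (2 - x))"
proof (induction m)
  case (Suc m)
  have "x ^ m / (2 ^ m * (2 - x)) = x ^ m / 2 ^ Suc m + x ^ Suc m / (2 ^ Suc m * (2 - x))"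
    using assms by (simp add: divide_simps) (simp add: algebra_simps)
  then show ?case using Suc by simp
qed simp

lemma inner_unit_defect:
  fixes x y :: "'a::real_inner"
  assumes "norm x = 1" "norm y = 1" shows "1 - x \<bullet> y = norm (x - y) ^ 2 / 2"
proof -
  have "x \<bullet> x = 1" "y \<bullet> y = 1" using assms by (simp_all flip: power2_norm_eq_inner)
  then show ?thesis
    by (simp add: power2_norm_eq_inner inner_diff_left inner_diff_right inner_commute[of y x])
qed

context mask_chain
begin

abbreviation "S \<equiv> subdiv (c 0)"

lemma affine0: "affine_mask (c 0)" by (simp add: affine)

lemma dominated_S: "dominated m \<eta> W x \<Longrightarrow> dominated m \<eta> W (\<lambda>l. S (x l))"
  using dominated_subdiv[of 0 m] by simp

text \<open>The power couples the old index \<open>j\<close> with the new index \<open>i\<close>.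
  Expanding one inner product in coordinates separates them: the component of \<open>n'\<close>
  leaves the sum over \<open>j\<close>, while that of \<open>n\<close> is absorbed into
  \<open>z\<close>. Hence the induction on \<open>r\<close> is for all \<open>z\<close>.\<close>

lemma dominated_S_power:
  fixes n n' :: "nat \<Rightarrow> 'a::euclidean_space polygon" and z :: "nat \<Rightarrow> 'b::real_normed_vector polygon"
  assumes "0 < m" and n: "dominated m \<eta> (\<lambda>_. 1) n" and n': "dominated m \<eta> (\<lambda>_. 1) n'"
  shows "dominated m \<eta> W z \<Longrightarrow> dominated m \<eta> (\<lambda>l. W l * \<eta> l)
    (\<lambda>l i. S (\<lambda>j. (1 - n l j \<bullet> n' l i) ^ r *\<^sub>R z l j) i
      - (1 - S (n l) i \<bullet> n' l i) ^ r *\<^sub>R S (z l) i)"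
proof (induction r arbitrary: z)
  case 0
  show ?case by (simp add: dominated_zero)
next
  case (Suc r)
  define D where "D = (\<lambda>(z :: nat \<Rightarrow> 'b polygon) l i. S (\<lambda>j. (1 - n l j \<bullet> n' l i) ^ r *\<^sub>R z l j) i
      - (1 - S (n l) i \<bullet> n' l i) ^ r *\<^sub>R S (z l) i)"
  define M where "M = (\<lambda>b l i. S (\<lambda>j. (n l j \<bullet> b) *\<^sub>R z l j) i - (S (n l) i \<bullet> b) *\<^sub>R S (z l) i)"
  have comp: "dominated m \<eta> (\<lambda>_. 1) (\<lambda>l i. x l i \<bullet> b)" if "dominated m \<eta> (\<lambda>_. 1) x"
    for x :: "nat \<Rightarrow> 'a polygon" and b
    using dominated_linear[OF bounded_linear_inner_left that] .
  have Sb: "S (\<lambda>j. n l j \<bullet> b) i = S (n l) i \<bullet> b" for l i b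
    by (rule subdiv_linear) (simp add: linear_iff inner_add_left)
  \<comment> \<open>One factor 1 - v \<bullet> w is expanded over the basis on both sides. Each
    coordinate leaves a defect with exponent \<open>r\<close> for the enlarged \<open>z\<close>, and
    an ordinary product defect \<open>M b\<close> of a component of \<open>n\<close> with
    \<open>z\<close>.\<close>
  have eq: "S (\<lambda>j. (1 - n l j \<bullet> n' l i) ^ Suc r *\<^sub>R z l j) i
      - (1 - S (n l) i \<bullet> n' l i) ^ Suc r *\<^sub>R S (z l) i
    = D z l i - (\<Sum>b\<in>Basis. (n' l i \<bullet> b) *\<^sub>R (D (\<lambda>l j. (n l j \<bullet> b) *\<^sub>R z l j) l i
        + (1 - S (n l) i \<bullet> n' l i) ^ r *\<^sub>R M b l i))" for l i
  proof -
    have split: "(1 - v \<bullet> w) ^ Suc r *\<^sub>R y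
        = (1 - v \<bullet> w) ^ r *\<^sub>R y - (\<Sum>b\<in>Basis. (w \<bullet> b) *\<^sub>R (1 - v \<bullet> w) ^ r *\<^sub>R (v \<bullet> b) *\<^sub>R y)"
      for v w :: 'a and y :: 'b
    proof -
      have "(\<Sum>b\<in>Basis. (w \<bullet> b) *\<^sub>R (1 - v \<bullet> w) ^ r *\<^sub>R (v \<bullet> b) *\<^sub>R y)
          = (\<Sum>b\<in>Basis. (v \<bullet> b) * (w \<bullet> b)) *\<^sub>R (1 - v \<bullet> w) ^ r *\<^sub>R y"
        unfolding scaleR_left.sum by (rule sum.cong) (simp_all add: mult_ac)
      then show ?thesis by (simp add: euclidean_inner[symmetric] algebra_simps)
    qed
    have "S (\<lambda>j. (1 - n l j \<bullet> n' l i) ^ Suc r *\<^sub>R z l j) i = S (\<lambda>j. (1 - n l j \<bullet> n' l i) ^ r *\<^sub>R z l j) i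
        - (\<Sum>b\<in>Basis. (n' l i \<bullet> b) *\<^sub>R S (\<lambda>j. (1 - n l j \<bullet> n' l i) ^ r *\<^sub>R (n l j \<bullet> b) *\<^sub>R z l j) i)"
      unfolding split subdiv_diff subdiv_sum subdiv_scaleR ..
    then show ?thesis
      unfolding split[of "S (n l) i"] D_def M_def
      by (simp add: scaleR_right_diff_distrib scaleR_right_distrib sum.distrib sum_subtractf)
  qed
  have Dz: "dominated m \<eta> (\<lambda>l. W l * \<eta> l) (D z)"
    unfolding D_def by (rule Suc.IH[OF Suc.prems])
  have Dnz: "dominated m \<eta> (\<lambda>l. W l * \<eta> l) (D (\<lambda>l j. (n l j \<bullet> b) *\<^sub>R z l j))" for b
    unfolding D_def
    using dominated_prod[OF bounded_bilinear_scaleR comp[OF n] Suc.prems] by (intro Suc.IH) simp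
  have Mb: "dominated m \<eta> (\<lambda>l. W l * \<eta> l) (M b)" for b
    using dominated_subdiv_prod[OF bounded_bilinear_scaleR assms(1) comp[OF n] Suc.prems]
    by (simp add: M_def Sb)
  have sum_inner: "dominated m \<eta> (\<lambda>_. 1) (\<lambda>l i. 1 - S (n l) i \<bullet> n' l i)"
    using dominated_prod[OF bounded_bilinear_inner dominated_S[OF n] n']
    by (intro dominated_diff dominated_const) simp
  have PM: "dominated m \<eta> (\<lambda>l. W l * \<eta> l) (\<lambda>l i. (1 - S (n l) i \<bullet> n' l i) ^ r *\<^sub>R M b l i)" for b
    using dominated_prod[OF bounded_bilinear_scaleR dominated_power[OF sum_inner] Mb] by simp
  have "dominated m \<eta> (\<lambda>l. W l * \<eta> l) (\<lambda>l i. (n' l i \<bullet> b) *\<^sub>R (D (\<lambda>l j. (n l j \<bullet> b) *\<^sub>R z l j) l i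
        + (1 - S (n l) i \<bullet> n' l i) ^ r *\<^sub>R M b l i))" for b
    using dominated_prod[OF bounded_bilinear_scaleR comp[OF n'] dominated_add[OF Dnz PM]] by simp
  then show ?case
    unfolding eq by (intro dominated_diff Dz dominated_sum) auto
qed

lemma dominated_PN_height:
  fixes n n' p :: "nat \<Rightarrow> 'a::euclidean_space polygon"
  assumes "0 < m" and \<eta>: "\<And>l. 0 < \<eta> l" "\<And>l. \<eta> l \<le> 1"
    and n: "dominated m \<eta> (\<lambda>_. 1) n" and n': "dominated m \<eta> (\<lambda>_. 1) n'"
    and p: "dominated m \<eta> W p"
    and unit: "\<And>l i. norm (n l i) = 1" "\<And>l i. norm (n' l i) = 1"
    and near: "\<And>l i j. c 0 (i - 2 * j) \<noteq> 0 \<Longrightarrow> norm (n l j - n' l i) \<le> C * \<eta> l"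
    and "0 < d" and lower: "\<And>l i j. c 0 (i - 2 * j) \<noteq> 0 \<Longrightarrow> d \<le> \<bar>(n l j + n' l i) \<bullet> n' l i\<bar>"
  shows "dominated m \<eta> (\<lambda>l. W l * \<eta> l)
    (\<lambda>l i. S (\<lambda>j. PN_height (n l j) (n' l i) (p l j) (S (p l) i)) i *\<^sub>R n' l i)"
proof -
  define \<delta> where "\<delta> = (\<lambda>l i j. 1 - n l j \<bullet> n' l i)"
  define N where "N = (\<lambda>l i j. (n l j + n' l i) \<bullet> (p l j - S (p l) i))"
  define R where "R = (\<lambda>l i. S (\<lambda>j. \<delta> l i j ^ m / (2 ^ m * (2 - \<delta> l i j)) * N l i j) i)"
  have denom: "(n l j + n' l i) \<bullet> n' l i = 2 - \<delta> l i j" for l i j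
    using unit by (simp add: \<delta>_def inner_add_left flip: power2_norm_eq_inner)

  have K: "dominated m \<eta> (\<lambda>l. W l * \<eta> l) (\<lambda>l i. S (\<lambda>j. \<delta> l i j ^ r * N l i j) i)" for r
  proof -
    define P where "P = (\<lambda>l i. (1 - S (n l) i \<bullet> n' l i) ^ r)"
    define D1 where "D1 = (\<lambda>l i. S (\<lambda>j. \<delta> l i j ^ r *\<^sub>R (n l j \<bullet> p l j)) i - P l i *\<^sub>R S (\<lambda>j. n l j \<bullet> p l j) i)"
    define D2 where "D2 = (\<lambda>l i. S (\<lambda>j. \<delta> l i j ^ r *\<^sub>R p l j) i - P l i *\<^sub>R S (p l) i)"
    define D3 where "D3 = (\<lambda>l i. S (\<lambda>j. \<delta> l i j ^ r *\<^sub>R n l j) i - P l i *\<^sub>R S (n l) i)"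
    define D4 where "D4 = (\<lambda>l i. S (\<lambda>j. \<delta> l i j ^ r *\<^sub>R (1::real)) i - P l i *\<^sub>R S (\<lambda>j. 1::real) i)"
    define D5 where "D5 = (\<lambda>l i. S (\<lambda>j. n l j \<bullet> p l j) i - S (n l) i \<bullet> S (p l) i)"
    have np: "dominated m \<eta> W (\<lambda>l i. n l i \<bullet> p l i)"
      using dominated_prod[OF bounded_bilinear_inner n p] by simp
    have D1: "dominated m \<eta> (\<lambda>l. W l * \<eta> l) D1"
      unfolding D1_def P_def \<delta>_def by (rule dominated_S_power[OF assms(1) n n' np])
    have D2: "dominated m \<eta> (\<lambda>l. W l * \<eta> l) D2"
      unfolding D2_def P_def \<delta>_def by (rule dominated_S_power[OF assms(1) n n' p])
    have D3: "dominated m \<eta> \<eta> D3"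
      using dominated_S_power[OF assms(1) n n' n, of r] by (simp add: D3_def P_def \<delta>_def)
    have D4: "dominated m \<eta> \<eta> D4"
      using dominated_S_power[OF assms(1) n n' dominated_const[of _ _ "1::real"], of r]
      by (simp add: D4_def P_def \<delta>_def)
    have D5: "dominated m \<eta> (\<lambda>l. W l * \<eta> l) D5"
      using dominated_subdiv_prod[OF bounded_bilinear_inner assms(1) n p] by (simp add: D5_def)
    have P: "dominated m \<eta> (\<lambda>_. 1) P"
      unfolding P_def using dominated_prod[OF bounded_bilinear_inner dominated_S[OF n] n']
      by (intro dominated_power dominated_diff dominated_const) simp
    have 1: "dominated m \<eta> (\<lambda>l. W l * \<eta> l) (\<lambda>l i. n' l i \<bullet> D2 l i)"
      using dominated_prod[OF bounded_bilinear_inner n' D2] by simp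
    have 2: "dominated m \<eta> (\<lambda>l. W l * \<eta> l) (\<lambda>l i. D3 l i \<bullet> S (p l) i)"
      using dominated_prod[OF bounded_bilinear_inner D3 dominated_S[OF p]] by (simp add: mult.commute)
    have 3: "dominated m \<eta> (\<lambda>l. W l * \<eta> l) (\<lambda>l i. (n' l i \<bullet> S (p l) i) * D4 l i)"
      using dominated_prod[OF bounded_bilinear_mult dominated_prod[OF bounded_bilinear_inner n' dominated_S[OF p]] D4]
      by simp
    have 4: "dominated m \<eta> (\<lambda>l. W l * \<eta> l) (\<lambda>l i. P l i * D5 l i)"
      using dominated_prod[OF bounded_bilinear_mult P D5] by simp
    \<comment> \<open>Multiplying out \<open>N\<close> gives four sums. With every \<open>S\<close>
      of a product replaced by the product of the \<open>S\<close>, they become \<open>P\<close>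
      times Sn \<bullet> Sp + n' \<bullet> Sp - Sn \<bullet> Sp - n' \<bullet> Sp, which is 0; only
      the five defects remain.\<close>
    have eq: "S (\<lambda>j. \<delta> l i j ^ r * N l i j) i
        = D1 l i + n' l i \<bullet> D2 l i - D3 l i \<bullet> S (p l) i - (n' l i \<bullet> S (p l) i) * D4 l i + P l i * D5 l i" for l i
    proof -
      have a: "S (\<lambda>j. n' l i \<bullet> (\<delta> l i j ^ r *\<^sub>R p l j)) i = n' l i \<bullet> S (\<lambda>j. \<delta> l i j ^ r *\<^sub>R p l j) i"
        by (rule subdiv_linear) (simp add: linear_iff inner_add_right)
      have b: "S (\<lambda>j. (\<delta> l i j ^ r *\<^sub>R n l j) \<bullet> S (p l) i) i = S (\<lambda>j. \<delta> l i j ^ r *\<^sub>R n l j) i \<bullet> S (p l) i"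
        by (rule subdiv_linear) (simp add: linear_iff inner_add_left)
      have e: "S (\<lambda>j. (n' l i \<bullet> S (p l) i) * \<delta> l i j ^ r) i = (n' l i \<bullet> S (p l) i) * S (\<lambda>j. \<delta> l i j ^ r) i"
        by (rule subdiv_mult_left)
      have "\<delta> l i j ^ r * N l i j = \<delta> l i j ^ r * (n l j \<bullet> p l j) + n' l i \<bullet> (\<delta> l i j ^ r *\<^sub>R p l j)
          - (\<delta> l i j ^ r *\<^sub>R n l j) \<bullet> S (p l) i - (n' l i \<bullet> S (p l) i) * \<delta> l i j ^ r" for j
        by (simp add: N_def inner_add_left inner_diff_right algebra_simps)
      then have "S (\<lambda>j. \<delta> l i j ^ r * N l i j) i
          = S (\<lambda>j. \<delta> l i j ^ r * (n l j \<bullet> p l j)) i + n' l i \<bullet> S (\<lambda>j. \<delta> l i j ^ r *\<^sub>R p l j) i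
            - S (\<lambda>j. \<delta> l i j ^ r *\<^sub>R n l j) i \<bullet> S (p l) i - (n' l i \<bullet> S (p l) i) * S (\<lambda>j. \<delta> l i j ^ r) i"
        by (simp only: subdiv_diff subdiv_add a b e)
      then show ?thesis
        by (simp add: D1_def D2_def D3_def D4_def D5_def inner_diff_right inner_diff_left
            subdiv_const[OF affine0] algebra_simps)
    qed
    show ?thesis unfolding eq by (intro dominated_add dominated_diff D1 1 2 3 4)
  qed

  \<comment> \<open>The remainder keeps the coupled denominator but is tiny: \<open>\<delta>\<close>
    is half a squared distance of unit normals, hence O(\<eta>), so \<open>\<delta> ^ m\<close>
    gives \<open>\<eta> ^ m\<close>, and p(j) - Sp(i) gives one more \<open>\<eta>\<close>. This
    explains the length \<open>m\<close> of the partial sum.\<close>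
  have R: "dominated m \<eta> (\<lambda>l. W l * \<eta> l) R"
  proof (rule dominated_of_small[OF \<eta>])
    have "bounded_by (\<lambda>l. W l * \<eta> l) (\<lambda>l. bdiff (p l))"
      using p \<open>0 < m\<close> by (cases m) (auto dest: dominated_imp_bounded)
    then obtain B where B: "\<And>l i. norm (bdiff (p l) i) \<le> B * (W l * \<eta> l)"
      by (auto simp: bounded_by_def)
    obtain L where L: "\<And>i. c 0 i \<noteq> 0 \<Longrightarrow> \<bar>i\<bar> \<le> L" using mask_radius[OF affine_mask_finite[OF affine0]] by blast
    define Q where "Q = mask_norm (c 0) * of_int (L + L) * B"
    have pq: "norm (p l j - S (p l) i) \<le> Q * (W l * \<eta> l)" if "c 0 (i - 2 * j) \<noteq> 0" for l i j
      using norm_diff_subdiv_le[OF affine0 L B L, of i j l] that by (simp add: Q_def mult_ac)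
    show "bounded_by (\<lambda>l. W l * \<eta> l * \<eta> l ^ m) R"
    proof (rule bounded_byI)
      fix l i
      obtain j0 where j0: "c 0 (i - 2 * j0) \<noteq> 0"
        using affine_mask_stencil_nonempty[OF affine0] by blast
      have Q0: "0 \<le> Q * (W l * \<eta> l)" using order_trans[OF norm_ge_zero pq[OF j0]] .
      let ?b = "(C\<^sup>2 / 2) ^ m * \<eta> l ^ m * (1 / (2 ^ m * d)) * (2 * (Q * (W l * \<eta> l)))"
      have "norm (R l i) \<le> mask_norm (c 0) * ?b"
        unfolding R_def
      proof (rule norm_subdiv_le[OF affine_mask_finite[OF affine0]])
        fix j assume j: "c 0 (i - 2 * j) \<noteq> 0"
        have \<delta>_eq: "\<delta> l i j = norm (n l j - n' l i) ^ 2 / 2"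
          unfolding \<delta>_def by (rule inner_unit_defect) (use unit in auto)
        have "norm (n l j - n' l i) ^ 2 \<le> (C * \<eta> l) ^ 2"
          by (rule power_mono[OF near[OF j]]) simp
        moreover have "(C * \<eta> l) ^ 2 \<le> C\<^sup>2 * \<eta> l"
        proof -
          have "\<eta> l ^ 2 \<le> \<eta> l" using \<eta>[of l] by (simp add: power2_eq_square mult_left_le)
          then show ?thesis unfolding power_mult_distrib by (rule mult_left_mono) simp
        qed
        ultimately have \<delta>: "0 \<le> \<delta> l i j" "\<delta> l i j \<le> (C\<^sup>2 / 2) * \<eta> l"
          unfolding \<delta>_eq by simp_all
        have \<delta>m: "\<bar>\<delta> l i j ^ m\<bar> \<le> (C\<^sup>2 / 2) ^ m * \<eta> l ^ m"
          using power_mono[OF \<delta>(2,1), of m] \<delta>(1) unfolding power_mult_distrib by simp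
        have den: "\<bar>1 / (2 ^ m * (2 - \<delta> l i j))\<bar> \<le> 1 / (2 ^ m * d)"
          using lower[OF j] \<open>0 < d\<close> by (simp add: denom abs_mult frac_le)
        have "\<bar>N l i j\<bar> \<le> norm (n l j + n' l i) * norm (p l j - S (p l) i)"
          unfolding N_def by (rule Cauchy_Schwarz_ineq2)
        also have "\<dots> \<le> 2 * (Q * (W l * \<eta> l))"
          using pq[OF j] norm_triangle_ineq[of "n l j" "n' l i"] unit by (intro mult_mono) auto
        finally have Nb: "\<bar>N l i j\<bar> \<le> 2 * (Q * (W l * \<eta> l))" .
        have "norm (\<delta> l i j ^ m / (2 ^ m * (2 - \<delta> l i j)) * N l i j)
            = \<bar>\<delta> l i j ^ m\<bar> * \<bar>1 / (2 ^ m * (2 - \<delta> l i j))\<bar> * \<bar>N l i j\<bar>"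
          by (simp add: abs_mult)
        also have "\<dots> \<le> ?b"
          using \<delta>m den Nb \<open>0 < d\<close> \<eta>(1)[of l] by (intro mult_mono mult_nonneg_nonneg) auto
        finally show "norm (\<delta> l i j ^ m / (2 ^ m * (2 - \<delta> l i j)) * N l i j) \<le> ?b" .
      qed (use Q0 \<open>0 < d\<close> \<eta>(1)[of l] in \<open>auto intro!: mult_nonneg_nonneg\<close>)
      then show "norm (R l i) \<le> mask_norm (c 0) * ((C\<^sup>2 / 2) ^ m * (1 / (2 ^ m * d)) * (2 * Q))
          * (W l * \<eta> l * \<eta> l ^ m)" by (simp add: mult_ac)
    qed
  qed

  have eq: "S (\<lambda>j. PN_height (n l j) (n' l i) (p l j) (S (p l) i)) i
      = (\<Sum>r<m. (1 / 2 ^ Suc r) *\<^sub>R S (\<lambda>j. \<delta> l i j ^ r * N l i j) i) + R l i" for l i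
  proof -
    have "S (\<lambda>j. PN_height (n l j) (n' l i) (p l j) (S (p l) i)) i
        = S (\<lambda>j. (\<Sum>r<m. (1 / 2 ^ Suc r) *\<^sub>R (\<delta> l i j ^ r * N l i j))
            + \<delta> l i j ^ m / (2 ^ m * (2 - \<delta> l i j)) * N l i j) i"
    proof (rule subdiv_cong)
      fix j assume "c 0 (i - 2 * j) \<noteq> 0"
      from lower[OF this, of l] have ne: "\<delta> l i j \<noteq> 2" using \<open>0 < d\<close> by (auto simp: denom)
      have "PN_height (n l j) (n' l i) (p l j) (S (p l) i) = 1 / (2 - \<delta> l i j) * N l i j"
        by (simp add: PN_height_def denom N_def)
      then show "PN_height (n l j) (n' l i) (p l j) (S (p l) i)
          = (\<Sum>r<m. (1 / 2 ^ Suc r) *\<^sub>R (\<delta> l i j ^ r * N l i j))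
            + \<delta> l i j ^ m / (2 ^ m * (2 - \<delta> l i j)) * N l i j"
        unfolding geometric_remainder[OF ne, of m] by (simp add: sum_distrib_right distrib_right)
    qed
    then show ?thesis by (simp only: subdiv_add subdiv_sum subdiv_scaleR R_def)
  qed
  have "dominated m \<eta> (\<lambda>l. W l * \<eta> l) (\<lambda>l i. S (\<lambda>j. PN_height (n l j) (n' l i) (p l j) (S (p l) i)) i)"
    unfolding eq by (intro dominated_add dominated_sum dominated_scaleR K R) simp
  from dominated_prod[OF bounded_bilinear_scaleR this n'] show ?thesis by simp
qed

end

text \<open>In the deviation from \<open>n' \<bullet> (p - q)\<close> only the component of
  \<open>n\<close> orthogonal to \<open>n'\<close> survives, and for unit vectors its length is at
  most 2 * norm (n - n').\<close>

lemma PN_height_bound: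
  fixes n n' p q :: "'a::real_inner"
  assumes "norm n = 1" "norm n' = 1" and "0 < d" "d \<le> \<bar>(n + n') \<bullet> n'\<bar>"
  shows "\<bar>PN_height n n' p q - n' \<bullet> (p - q)\<bar> \<le> 2 / d * norm (n - n') * norm (p - q)"
proof -
  define s where "s = (n + n') \<bullet> n'"
  have s: "s = n \<bullet> n' + 1" "s \<noteq> 0" "d \<le> \<bar>s\<bar>"
    using assms by (auto simp: s_def inner_add_left simp flip: power2_norm_eq_inner)
  have "1 - n \<bullet> n' = (n' - n) \<bullet> n'"
    using assms by (simp add: inner_diff_left flip: power2_norm_eq_inner)
  then have ip: "\<bar>1 - n \<bullet> n'\<bar> \<le> norm (n - n')"
    using Cauchy_Schwarz_ineq2[of "n' - n" n'] assms(2) by (simp add: norm_minus_commute)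
  have "n - (n \<bullet> n') *\<^sub>R n' = (n - n') + (1 - n \<bullet> n') *\<^sub>R n'" by (simp add: algebra_simps)
  also have "norm \<dots> \<le> 2 * norm (n - n')"
    using norm_triangle_ineq[of "n - n'" "(1 - n \<bullet> n') *\<^sub>R n'"] ip assms(2) by simp
  finally have t: "norm (n - (n \<bullet> n') *\<^sub>R n') \<le> 2 * norm (n - n')" .
  have "PN_height n n' p q - n' \<bullet> (p - q) = ((n - (n \<bullet> n') *\<^sub>R n') \<bullet> (p - q)) / s"
    unfolding PN_height_def s_def[symmetric] using s
    by (simp add: divide_simps inner_add_left inner_diff_left inner_diff_right algebra_simps)
  also have "\<bar>\<dots>\<bar> \<le> (2 * norm (n - n') * norm (p - q)) / d"
    unfolding abs_divide
    by (rule frac_le) (use s(3) assms(3) t in \<open>auto intro!: order_trans[OF Cauchy_Schwarz_ineq2] mult_right_mono\<close>)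
  finally show ?thesis by (simp add: field_simps)
qed

section \<open>Piecewise linear curves and their limits\<close>

lemma pl_curve_near:
  assumes "norm (P \<lfloor>2 ^ k * t\<rfloor> - v) \<le> B" and "norm (P (\<lfloor>2 ^ k * t\<rfloor> + 1) - v) \<le> B"
  shows "norm (pl_curve k P t - v) \<le> B"
proof -
  define s where "s = 2 ^ k * t - of_int \<lfloor>2 ^ k * t\<rfloor>"
  have s: "0 \<le> s" "s \<le> 1" unfolding s_def by linarith+
  have "pl_curve k P t - v
      = (1 - s) *\<^sub>R (P \<lfloor>2 ^ k * t\<rfloor> - v) + s *\<^sub>R (P (\<lfloor>2 ^ k * t\<rfloor> + 1) - v)"
    by (simp add: pl_curve_def s_def Let_def algebra_simps)
  also have "norm \<dots> \<le> (1 - s) * B + s * B"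
    using s assms by (intro norm_triangle_mono) (auto intro!: mult_left_mono)
  finally show ?thesis by (simp add: algebra_simps)
qed

lemma pl_curve_diff: "pl_curve k P t - pl_curve k Q t = pl_curve k (\<lambda>i. P i - Q i) t"
  by (simp add: pl_curve_def Let_def algebra_simps)

lemma norm_pl_curve_diff_le:
  assumes "\<And>i. norm (P i - Q i) \<le> B" shows "norm (pl_curve k P t - pl_curve k Q t) \<le> B"
  using pl_curve_near[of "\<lambda>i. P i - Q i" k t 0 B] assms by (simp add: pl_curve_diff)

lemma pl_curve_knot: "pl_curve k P (of_int i / 2 ^ k) = P i"
  by (simp add: pl_curve_def Let_def)

lemma pl_curve_rescale: "pl_curve (l + r) P t = pl_curve r P (2 ^ l * t)"
  by (simp add: pl_curve_def power_add mult_ac)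

lemma uniform_limit_geometric:
  fixes f :: "nat \<Rightarrow> 'b \<Rightarrow> 'a::banach"
  assumes "0 \<le> \<theta>" "\<theta> < 1" and "\<And>k t. norm (f (Suc k) t - f k t) \<le> C * \<theta> ^ k"
  obtains F where "uniform_limit UNIV f F sequentially"
proof -
  have "summable (\<lambda>k. C * \<theta> ^ k)" using assms(1,2) by (intro summable_mult summable_geometric) auto
  then have "uniform_limit UNIV (\<lambda>n t. \<Sum>i<n. f (Suc i) t - f i t)
      (\<lambda>t. suminf (\<lambda>i. f (Suc i) t - f i t)) sequentially"
    by (rule Weierstrass_m_test[rotated]) (use assms(3) in auto)
  then have "uniform_limit UNIV (\<lambda>n t. f 0 t + (\<Sum>i<n. f (Suc i) t - f i t))
      (\<lambda>t. f 0 t + suminf (\<lambda>i. f (Suc i) t - f i t)) sequentially"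
    by (intro uniform_limit_intros)
  moreover have "(\<lambda>n t. f 0 t + (\<Sum>i<n. f (Suc i) t - f i t)) = f"
    by (intro ext) (simp add: sum_lessThan_telescope[of "\<lambda>i. f i _"])
  ultimately show thesis by (intro that) simp
qed

text \<open>Local form of the telescoping bound, for polygons whose differences are known to be
  small only on a window.\<close>

lemma norm_diff_le_bdiff_range:
  assumes "b \<le> a" and "\<And>j. b < j \<Longrightarrow> j \<le> a \<Longrightarrow> norm (bdiff X j) \<le> A"
  shows "norm (X a - X b) \<le> of_int (a - b) * A"
  using assms
proof (induction a rule: int_ge_induct)
  case (step a)
  have "X (a + 1) - X b = bdiff X (a + 1) + (X a - X b)" by (simp add: bdiff_def)
  also have "norm \<dots> \<le> A + of_int (a - b) * A"
    by (rule norm_triangle_mono) (use step in auto)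
  finally show ?case by (simp add: algebra_simps)
qed simp

text \<open>A mean value inequality survives the passage to the limit: where \<open>G\<close> stays
  within \<open>e\<close> of a vector \<open>v\<close>, the increments of \<open>F\<close> stay
  within \<open>e\<close> times the length of those of slope \<open>v\<close>. With
  \<open>v = G t\<close> and continuity of \<open>G\<close> this is differentiability at
  \<open>t\<close>.\<close>

lemma limit_curve_derivative:
  assumes Y: "limit_curve Y F" and Z: "limit_curve Z G" and G: "continuous_on UNIV G"
    and diff: "\<And>k i. Z k i = 2 ^ k *\<^sub>R bdiff (Y k) i" and bounded: "\<And>k i. norm (Z k i) \<le> A"
  shows "(F has_vector_derivative G t) (at t)"
proof -
  have bdY: "bdiff (Y k) i = (1 / 2 ^ k) *\<^sub>R Z k i" for k i by (simp add: diff)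
  have pow0: "(\<lambda>k. 1 / (2::real) ^ k) \<longlonglongrightarrow> 0"
    using LIMSEQ_realpow_zero[of "1/2"] by (simp add: power_one_over)
  \<comment> \<open>Bounded \<open>Z\<close> means that neighbouring values of \<open>Y k\<close>
    differ by O(2^(-k)), so the curve may be replaced by its value at the knot to the left.\<close>
  have lim: "(\<lambda>k. Y k \<lfloor>2 ^ k * u\<rfloor>) \<longlonglongrightarrow> F u" for u
  proof -
    have "(\<lambda>k. pl_curve k (Y k) u - Y k \<lfloor>2 ^ k * u\<rfloor>) \<longlonglongrightarrow> 0"
    proof (rule Lim_null_comparison)
      show "\<forall>\<^sub>F k in sequentially. norm (pl_curve k (Y k) u - Y k \<lfloor>2 ^ k * u\<rfloor>) \<le> A * (1 / 2 ^ k)"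
      proof (intro always_eventually allI pl_curve_near)
        have A: "0 \<le> A" using order_trans[OF norm_ge_zero bounded] .
        then show "norm (Y k \<lfloor>2 ^ k * u\<rfloor> - Y k \<lfloor>2 ^ k * u\<rfloor>) \<le> A * (1 / 2 ^ k)" for k by simp
        show "norm (Y k (\<lfloor>2 ^ k * u\<rfloor> + 1) - Y k \<lfloor>2 ^ k * u\<rfloor>) \<le> A * (1 / 2 ^ k)" for k
          using bounded[of k "\<lfloor>2 ^ k * u\<rfloor> + 1"] bdY[of k "\<lfloor>2 ^ k * u\<rfloor> + 1"]
          by (simp add: bdiff_def divide_right_mono)
      qed
      show "(\<lambda>k. A * (1 / 2 ^ k)) \<longlonglongrightarrow> 0" using tendsto_mult_right_zero[OF pow0] .
    qed
    moreover have "(\<lambda>k. pl_curve k (Y k) u) \<longlonglongrightarrow> F u"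
      using Y unfolding limit_curve_def by (rule tendsto_uniform_limitI) simp
    ultimately show ?thesis using tendsto_diff by fastforce
  qed
  have floor_lim: "(\<lambda>k. of_int \<lfloor>2 ^ k * u\<rfloor> / 2 ^ k) \<longlonglongrightarrow> u" for u :: real
  proof -
    have "(\<lambda>k. of_int \<lfloor>2 ^ k * u\<rfloor> / 2 ^ k - u) \<longlonglongrightarrow> 0"
    proof (rule Lim_null_comparison[OF _ pow0])
      show "\<forall>\<^sub>F k in sequentially. norm (of_int \<lfloor>2 ^ k * u\<rfloor> / 2 ^ k - u) \<le> 1 / 2 ^ k"
      proof (intro always_eventually allI)
        fix k
        have "of_int \<lfloor>2 ^ k * u\<rfloor> / 2 ^ k - u = (of_int \<lfloor>2 ^ k * u\<rfloor> - 2 ^ k * u) / 2 ^ k"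
          by (simp add: field_simps)
        moreover have "\<bar>of_int \<lfloor>2 ^ k * u\<rfloor> - 2 ^ k * u\<bar> \<le> 1" by linarith
        ultimately show "norm (of_int \<lfloor>2 ^ k * u\<rfloor> / 2 ^ k - u) \<le> 1 / 2 ^ k"
          by (simp add: divide_right_mono abs_divide)
      qed
    qed
    then show ?thesis by (simp add: LIM_zero_iff)
  qed
  have main: "norm (F w - F u - (w - u) *\<^sub>R v) \<le> (w - u) * e"
    if "u \<le> w" and near: "\<And>\<tau>. u \<le> \<tau> \<Longrightarrow> \<tau> \<le> w \<Longrightarrow> norm (G \<tau> - v) \<le> e" for u w v e
  proof (rule field_le_epsilon)
    fix e' :: real assume "0 < e'"
    define \<epsilon> where "\<epsilon> = e' / (w - u + 1)"
    have \<epsilon>: "0 < \<epsilon>" using \<open>0 < e'\<close> \<open>u \<le> w\<close> by (simp add: \<epsilon>_def)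
    have "norm (F w - F u - (w - u) *\<^sub>R v) \<le> (w - u) * (e + \<epsilon>)"
    proof (rule tendsto_le[OF sequentially_bot])
      let ?i = "\<lambda>k u. \<lfloor>2 ^ k * u\<rfloor>"
      show "(\<lambda>k. norm (Y k (?i k w) - Y k (?i k u) - (of_int (?i k w) / 2 ^ k - of_int (?i k u) / 2 ^ k) *\<^sub>R v))
          \<longlonglongrightarrow> norm (F w - F u - (w - u) *\<^sub>R v)"
        by (intro tendsto_intros lim floor_lim)
      show "(\<lambda>k. (of_int (?i k w) / 2 ^ k - of_int (?i k u) / 2 ^ k) * (e + \<epsilon>)) \<longlonglongrightarrow> (w - u) * (e + \<epsilon>)"
        by (intro tendsto_intros floor_lim)
      have "\<forall>\<^sub>F k in sequentially. \<forall>t\<in>UNIV. dist (pl_curve k (Z k) t) (G t) < \<epsilon>"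
        using Z \<epsilon> unfolding limit_curve_def by (rule uniform_limitD)
      then show "\<forall>\<^sub>F k in sequentially.
          norm (Y k (?i k w) - Y k (?i k u) - (of_int (?i k w) / 2 ^ k - of_int (?i k u) / 2 ^ k) *\<^sub>R v)
          \<le> (of_int (?i k w) / 2 ^ k - of_int (?i k u) / 2 ^ k) * (e + \<epsilon>)"
      proof eventually_elim
        fix k assume k: "\<forall>t\<in>UNIV. dist (pl_curve k (Z k) t) (G t) < \<epsilon>"
        \<comment> \<open>Removing the line of slope \<open>v\<close> leaves differences 2^(-k) (Z -
          v), which are small at all knots between \<open>u\<close> and \<open>w\<close>.\<close>
        define D where "D = (\<lambda>i. Y k i - (of_int i / 2 ^ k) *\<^sub>R v)"
        have "norm (bdiff D j) \<le> (e + \<epsilon>) / 2 ^ k" if j: "?i k u < j" "j \<le> ?i k w" for j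
        proof -
          define \<tau> where "\<tau> = real_of_int j / 2 ^ k"
          have "2 ^ k * u \<le> of_int j" "of_int j \<le> 2 ^ k * w" using j by linarith+
          then have "u \<le> \<tau>" "\<tau> \<le> w" by (simp_all add: \<tau>_def field_simps)
          then have "norm (G \<tau> - v) \<le> e" by (rule near)
          moreover have "norm (Z k j - G \<tau>) < \<epsilon>"
            using k by (simp add: \<tau>_def dist_norm flip: pl_curve_knot[of k "Z k" j])
          ultimately have "norm (Z k j - v) \<le> e + \<epsilon>"
            using norm_triangle_ineq[of "Z k j - G \<tau>" "G \<tau> - v"] by simp
          moreover have "bdiff D j = (1 / 2 ^ k) *\<^sub>R (Z k j - v)"
          proof -
            have "bdiff D j = bdiff (Y k) j - (1 / 2 ^ k) *\<^sub>R v"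
              by (simp add: D_def bdiff_def diff_divide_distrib algebra_simps)
            then show ?thesis by (simp add: bdY scaleR_right_diff_distrib)
          qed
          ultimately show ?thesis by (simp add: divide_right_mono)
        qed
        moreover have "?i k u \<le> ?i k w" using \<open>u \<le> w\<close> by (intro floor_mono) simp
        ultimately have "norm (D (?i k w) - D (?i k u)) \<le> of_int (?i k w - ?i k u) * ((e + \<epsilon>) / 2 ^ k)"
          by (intro norm_diff_le_bdiff_range)
        moreover have "D (?i k w) - D (?i k u)
            = Y k (?i k w) - Y k (?i k u) - (of_int (?i k w) / 2 ^ k - of_int (?i k u) / 2 ^ k) *\<^sub>R v"
          by (simp add: D_def algebra_simps)
        moreover have "of_int (j - l) * ((e + \<epsilon>) / 2 ^ k) = (of_int j / 2 ^ k - of_int l / 2 ^ k) * (e + \<epsilon>)" for j l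
          by (simp add: field_simps)
        ultimately show "norm (Y k (?i k w) - Y k (?i k u)
            - (of_int (?i k w) / 2 ^ k - of_int (?i k u) / 2 ^ k) *\<^sub>R v)
          \<le> (of_int (?i k w) / 2 ^ k - of_int (?i k u) / 2 ^ k) * (e + \<epsilon>)"
          by (simp only:)
      qed
    qed
    also have "(w - u) * (e + \<epsilon>) \<le> (w - u) * e + e'"
    proof -
      have "(w - u) * \<epsilon> \<le> (w - u + 1) * \<epsilon>" using \<epsilon> by (intro mult_right_mono) auto
      also have "\<dots> = e'" using \<open>u \<le> w\<close> by (simp add: \<epsilon>_def)
      finally show ?thesis by (simp add: distrib_left)
    qed
    finally show "norm (F w - F u - (w - u) *\<^sub>R v) \<le> (w - u) * e + e'" .
  qed
  show ?thesis
    unfolding has_vector_derivative_def has_derivative_at_alt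
  proof (intro conjI allI impI)
    fix e :: real assume "0 < e"
    then obtain d where d: "0 < d" "\<And>\<tau>. dist \<tau> t < d \<Longrightarrow> dist (G \<tau>) (G t) < e"
      using G unfolding continuous_on_iff by blast
    have near: "norm (G \<tau> - G t) \<le> e" if "\<bar>\<tau> - t\<bar> < d" for \<tau>
      using d(2)[of \<tau>] that by (simp add: dist_norm)
    show "\<exists>d>0. \<forall>y. norm (y - t) < d \<longrightarrow> norm (F y - F t - (y - t) *\<^sub>R G t) \<le> e * norm (y - t)"
    proof (intro exI[of _ d] conjI allI impI d(1))
      fix y assume y: "norm (y - t) < d"
      show "norm (F y - F t - (y - t) *\<^sub>R G t) \<le> e * norm (y - t)"
      proof (cases "t \<le> y")
        case True
        then have "norm (F y - F t - (y - t) *\<^sub>R G t) \<le> (y - t) * e"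
          by (rule main) (use y in \<open>auto intro!: near\<close>)
        with True show ?thesis by (simp add: mult.commute)
      next
        case False
        then have "norm (F t - F y - (t - y) *\<^sub>R G t) \<le> (t - y) * e"
          by (intro main) (use y in \<open>auto intro!: near\<close>)
        moreover have "F t - F y - (t - y) *\<^sub>R G t = - (F y - F t - (y - t) *\<^sub>R G t)"
          by (simp add: algebra_simps)
        moreover have "norm (y - t) = t - y" using False by simp
        ultimately show ?thesis by (simp only: norm_minus_cancel mult.commute)
      qed
    qed
  qed (rule bounded_linear_scaleR_left)
qed

section \<open>Power boundedness of convergent linear schemes\<close>

lemma refine_linear_scheme: "refine (linear_scheme b) P r = (subdiv b ^^ r) P"
  by (induction r) (simp_all add: linear_scheme_def)

lemma funpow_subdiv_diff:
  "(subdiv b ^^ r) (\<lambda>j. P j - Q j) i = (subdiv b ^^ r) P i - (subdiv b ^^ r) Q i"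
proof (induction r arbitrary: i)
  case (Suc r)
  then have "(subdiv b ^^ r) (\<lambda>j. P j - Q j) = (\<lambda>i. (subdiv b ^^ r) P i - (subdiv b ^^ r) Q i)"
    by (intro ext)
  then show ?case by (simp add: subdiv_diff)
qed simp

lemma funpow_subdiv_sum:
  "(subdiv b ^^ r) (\<lambda>j. \<Sum>t\<in>A. P t j) i = (\<Sum>t\<in>A. (subdiv b ^^ r) (P t) i)"
proof (induction r arbitrary: i)
  case (Suc r)
  then have "(subdiv b ^^ r) (\<lambda>j. \<Sum>t\<in>A. P t j) = (\<lambda>i. \<Sum>t\<in>A. (subdiv b ^^ r) (P t) i)"
    by (intro ext)
  then show ?case by (simp add: subdiv_sum)
qed simp

lemma funpow_subdiv_scaleR_vec:
  fixes v :: "'a::real_vector"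
  shows "(subdiv b ^^ r) (\<lambda>j. x j *\<^sub>R v) i = (subdiv b ^^ r) x i *\<^sub>R v"
proof (induction r arbitrary: i)
  case (Suc r)
  have "subdiv b (\<lambda>j. (subdiv b ^^ r) x j *\<^sub>R v) i = subdiv b ((subdiv b ^^ r) x) i *\<^sub>R v"
    by (rule subdiv_linear) (simp add: linear_iff scaleR_left_distrib)
  moreover have "(subdiv b ^^ r) (\<lambda>j. x j *\<^sub>R v) = (\<lambda>j. (subdiv b ^^ r) x j *\<^sub>R v)"
    using Suc by (intro ext)
  ultimately show ?case by simp
qed simp

lemma funpow_subdiv_shift:
  "(subdiv b ^^ r) (\<lambda>j. P (j - t)) i = (subdiv b ^^ r) P (i - 2 ^ r * t)"
proof (induction r arbitrary: i)
  case (Suc r)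
  have "(subdiv b ^^ r) (\<lambda>j. P (j - t)) = (\<lambda>i. (subdiv b ^^ r) P (i - 2 ^ r * t))"
    using Suc by (intro ext)
  then show ?case using subdiv_shift[of b "(subdiv b ^^ r) P" "2 ^ r * t" i] by (simp add: mult.assoc)
qed simp

text \<open>The radius is N (1 + 2 + ... + 2^(r-1)): each refinement doubles the reach and adds
  \<open>N\<close>.\<close>

lemma funpow_subdiv_local:
  assumes N: "\<And>i. b i \<noteq> 0 \<Longrightarrow> \<bar>i\<bar> \<le> N"
  shows "(\<And>j. \<bar>i - 2 ^ r * j\<bar> \<le> N * (2 ^ r - 1) \<Longrightarrow> P j = Q j)
    \<Longrightarrow> (subdiv b ^^ r) P i = (subdiv b ^^ r) Q i"
proof (induction r arbitrary: i)
  case (Suc r)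
  have "subdiv b ((subdiv b ^^ r) P) i = subdiv b ((subdiv b ^^ r) Q) i"
  proof (rule subdiv_cong, rule Suc.IH, rule Suc.prems)
    fix l j assume "b (i - 2 * l) \<noteq> 0" and *: "\<bar>l - 2 ^ r * j\<bar> \<le> N * (2 ^ r - 1)"
    have sum: "\<bar>x + 2 * y\<bar> \<le> A + 2 * B" if "\<bar>x\<bar> \<le> A" "\<bar>y\<bar> \<le> B" for x y A B :: int
      using that by linarith
    have "i - 2 ^ Suc r * j = (i - 2 * l) + 2 * (l - 2 ^ r * j)" by simp
    moreover have "N * (2 ^ Suc r - 1) = N + 2 * (N * (2 ^ r - 1))" by (simp add: algebra_simps)
    ultimately show "\<bar>i - 2 ^ Suc r * j\<bar> \<le> N * (2 ^ Suc r - 1)"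
      using sum[OF N[OF \<open>b (i - 2 * l) \<noteq> 0\<close>] *] by (simp only:)
  qed
  then show ?case by simp
qed simp

lemma funpow_subdiv_norm_le:
  assumes "affine_mask b" and "\<And>i. norm (P i) \<le> A"
  shows "norm ((subdiv b ^^ r) P i) \<le> mask_norm b ^ r * A"
proof (induction r arbitrary: i)
  case (Suc r)
  have "0 \<le> mask_norm b ^ r * A" using order_trans[OF norm_ge_zero Suc] .
  then have "norm (subdiv b ((subdiv b ^^ r) P) i) \<le> mask_norm b * (mask_norm b ^ r * A)"
    using Suc by (intro norm_subdiv_le affine_mask_finite assms(1))
  then show ?case by (simp add: mult_ac)
qed (simp add: assms(2))

text \<open>Uniform convergence with tolerance 1 controls all levels from some \<open>R\<close> on,
  and the finitely many levels up to \<open>R\<close> are bounded by powers of the mask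
  norm.\<close>

lemma convergent_scheme_orbit_bounded:
  fixes P :: "'a::real_normed_vector polygon"
  assumes b: "affine_mask b" and conv: "scheme_C 0 (linear_scheme b :: 'a scheme)"
    and P: "\<And>i. norm (P i) \<le> A"
  shows "\<exists>B. \<forall>r i. norm ((subdiv b ^^ r) P i) \<le> B"
proof -
  have "bounded (range P)" using P by (auto simp: bounded_iff)
  then obtain f where "limit_curve (refine (linear_scheme b) P) f"
    using conv by (auto simp: scheme_C_def)
  then have "uniform_limit UNIV (\<lambda>r. pl_curve r ((subdiv b ^^ r) P)) f sequentially"
    by (simp add: limit_curve_def refine_linear_scheme)
  from uniform_limitD[OF this, of 1] obtain R where
    R: "\<And>r t. R \<le> r \<Longrightarrow> dist (pl_curve r ((subdiv b ^^ r) P) t) (f t) < 1"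
    unfolding eventually_sequentially by auto
  define M where "M = (\<Sum>r\<le>R. mask_norm b ^ r * A)"
  have A: "0 \<le> A" using order_trans[OF norm_ge_zero P] .
  have M: "norm ((subdiv b ^^ r) P i) \<le> M" if "r \<le> R" for r i
  proof -
    have "mask_norm b ^ r * A \<le> M"
      unfolding M_def using that A mask_norm_nonneg[of b] by (intro member_le_sum) auto
    then show ?thesis by (rule order_trans[OF funpow_subdiv_norm_le[OF b P]])
  qed
  \<comment> \<open>Above level \<open>R\<close>, a value at a knot is within 1 of the limit curve,
    which there is within 1 of the curve of level \<open>R\<close>, itself bounded by
    \<open>M\<close>.\<close>
  have "norm ((subdiv b ^^ r) P i) \<le> M + 2" for r i
  proof (cases "r \<le> R")
    case True
    then show ?thesis using M[of r i] by simp
  next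
    case False
    define t where "t = real_of_int i / 2 ^ r"
    have "norm (pl_curve R ((subdiv b ^^ R) P) t - 0) \<le> M"
      by (rule pl_curve_near) (use M[OF order_refl] in simp_all)
    moreover have "dist (pl_curve R ((subdiv b ^^ R) P) t) (f t) < 1" by (rule R) simp
    moreover have "dist ((subdiv b ^^ r) P i) (f t) < 1"
      using R[of r t] False by (simp add: t_def pl_curve_knot)
    ultimately show ?thesis
      using norm_triangle_sub[of "(subdiv b ^^ r) P i" "pl_curve R ((subdiv b ^^ R) P) t"]
        dist_triangle2[of "(subdiv b ^^ r) P i" "pl_curve R ((subdiv b ^^ R) P) t" "f t"]
      unfolding dist_norm diff_0_right by linarith
  qed
  then show ?thesis by blast
qed

text \<open>By locality only boundedly many translates of the unit impulse contribute to each value,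
  so it suffices to bound the orbit of the impulse.\<close>

lemma convergent_scheme_power_bounded:
  assumes b: "affine_mask b" and conv: "scheme_C 0 (linear_scheme b :: 'a::euclidean_space scheme)"
  obtains B where "0 \<le> B"
    and "\<And>r (P::'a polygon) A i. (\<And>j. norm (P j) \<le> A) \<Longrightarrow> norm ((subdiv b ^^ r) P i) \<le> B * A"
proof -
  \<comment> \<open>Convergence is assumed for vector-valued polygons; an impulse along a unit
    vector reads off the scalar orbit of the impulse.\<close>
  obtain e :: 'a where "e \<in> Basis" using nonempty_Basis by blast
  then have e: "norm e = 1" by (rule norm_Basis)
  define \<delta> where "\<delta> = (\<lambda>j::int. if j = 0 then 1 else 0 :: real)"
  have "norm (\<delta> j *\<^sub>R e) \<le> 1" for j by (simp add: \<delta>_def e)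
  then have "\<exists>B0. \<forall>r i. norm ((subdiv b ^^ r) (\<lambda>j. \<delta> j *\<^sub>R e) i) \<le> B0"
    by (rule convergent_scheme_orbit_bounded[OF b conv, of "\<lambda>j. \<delta> j *\<^sub>R e" 1])
  then obtain B0 where B0': "\<forall>r i. norm ((subdiv b ^^ r) (\<lambda>j. \<delta> j *\<^sub>R e) i) \<le> B0" ..
  have B0: "\<bar>(subdiv b ^^ r) \<delta> i\<bar> \<le> B0" for r i
    using spec[OF spec[OF B0', of r], of i] unfolding funpow_subdiv_scaleR_vec norm_scaleR e by simp
  have B0_nonneg: "0 \<le> B0" using order_trans[OF abs_ge_zero B0] .
  obtain N where N: "\<And>i. b i \<noteq> 0 \<Longrightarrow> \<bar>i\<bar> \<le> N" using mask_radius[OF affine_mask_finite[OF b]] by blast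
  show thesis
  proof (rule that[of "of_nat (nat (2 * N + 1)) * B0"])
    fix r i and P :: "'a polygon" and A
    assume P: "\<And>j. norm (P j) \<le> A"
    have A: "0 \<le> A" using order_trans[OF norm_ge_zero P] .
    \<comment> \<open>The coarse indices whose impulse can reach \<open>i\<close> after
      \<open>r\<close> refinements; there are 2N + 1 of them, for every \<open>r\<close>.\<close>
    define J where "J = {i div 2 ^ r - N..i div 2 ^ r + N}"
    have "(subdiv b ^^ r) P i = (subdiv b ^^ r) (\<lambda>j. \<Sum>t\<in>J. \<delta> (j - t) *\<^sub>R P t) i"
    proof (rule funpow_subdiv_local[OF N])
      fix j assume j: "\<bar>i - 2 ^ r * j\<bar> \<le> N * (2 ^ r - 1)"
      define q \<rho> where "q = i div 2 ^ r" and "\<rho> = i mod 2 ^ r"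
      have i: "i = 2 ^ r * q + \<rho>" "0 \<le> \<rho>" "\<rho> < 2 ^ r" by (simp_all add: q_def \<rho>_def)
      have N0: "0 \<le> N"
      proof -
        obtain i0 where "b i0 \<noteq> 0"
          using affine_mask_stencil_nonempty[OF b] by blast
        then show ?thesis using N[of i0] by linarith
      qed
      have i_j: "i - 2 ^ r * j = 2 ^ r * (q - j) + \<rho>" unfolding i(1) by (simp add: right_diff_distrib)
      have bd: "2 ^ r * (q - j) + \<rho> \<le> 2 ^ r * N - N" "- (2 ^ r * N - N) \<le> 2 ^ r * (q - j) + \<rho>"
        using j unfolding i_j by (auto simp: abs_le_iff right_diff_distrib mult.commute[of N])
      have "2 ^ r * (q - j) \<le> 2 ^ r * N" using bd(1) i(2) N0 by linarith
      then have "q - j \<le> N" by simp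
      moreover have "2 ^ r * (j - q) < 2 ^ r * (N + 1)"
        using bd(2) i(3) N0 unfolding right_diff_distrib distrib_left by linarith
      then have "j - q < N + 1" by simp
      ultimately have "j \<in> J" by (auto simp: J_def q_def)
      have "(\<Sum>t\<in>J. \<delta> (j - t) *\<^sub>R P t) = (\<Sum>t\<in>J. if t = j then P t else 0)"
        by (rule sum.cong) (auto simp: \<delta>_def)
      then show "P j = (\<Sum>t\<in>J. \<delta> (j - t) *\<^sub>R P t)"
        using \<open>j \<in> J\<close> by (simp add: J_def)
    qed
    also have "\<dots> = (\<Sum>t\<in>J. (subdiv b ^^ r) \<delta> (i - 2 ^ r * t) *\<^sub>R P t)"
      by (simp add: funpow_subdiv_sum funpow_subdiv_scaleR_vec funpow_subdiv_shift)
    also have "norm \<dots> \<le> (\<Sum>t\<in>J. B0 * A)"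
      by (rule sum_norm_le) (auto intro!: mult_mono B0 P B0_nonneg)
    also have "\<dots> = of_nat (nat (2 * N + 1)) * B0 * A"
      by (simp add: J_def)
    finally show "norm ((subdiv b ^^ r) P i) \<le> of_nat (nat (2 * N + 1)) * B0 * A" .
  qed (simp add: B0_nonneg)
qed

section \<open>Smoothness of perturbed schemes\<close>

definition sup_norm :: "'a::real_normed_vector polygon \<Rightarrow> real" where
  "sup_norm P = (SUP i. norm (P i))"

text \<open>The real supremum is informative only for bounded polygons, so boundedness at each
  single level has to be established before any uniform estimate.\<close>

lemma le_sup_norm: "bounded (range P) \<Longrightarrow> norm (P i) \<le> sup_norm P"
  unfolding sup_norm_def by (rule cSUP_upper) (auto simp: bounded_iff bdd_above_def)

lemma sup_norm_le: "(\<And>i. norm (P i) \<le> B) \<Longrightarrow> sup_norm P \<le> B"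
  unfolding sup_norm_def by (rule cSUP_least) auto

lemma sup_norm_nonneg: "bounded (range P) \<Longrightarrow> 0 \<le> sup_norm P"
  using order_trans[OF norm_ge_zero le_sup_norm] .

lemma bounded_rangeI: "(\<And>i. norm (P i) \<le> B) \<Longrightarrow> bounded (range P)"
  by (auto simp: bounded_iff)

lemma bounded_bdiff:
  fixes P :: "'a::real_normed_vector polygon"
  assumes "bounded (range P)" shows "bounded (range (bdiff P))"
proof (rule bounded_rangeI)
  show "norm (bdiff P i) \<le> sup_norm P + sup_norm P" for i
    unfolding bdiff_def by (rule order_trans[OF norm_triangle_ineq4 add_mono[OF le_sup_norm le_sup_norm]]) fact+
qed

lemma bounded_funpow_bdiff:
  fixes P :: "'a::real_normed_vector polygon"
  shows "bounded (range P) \<Longrightarrow> bounded (range ((bdiff ^^ s) P))"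
  by (induction s) (auto intro: bounded_bdiff)

lemma bounded_subdiv:
  fixes P :: "'a::real_normed_vector polygon"
  assumes "finite {i. c i \<noteq> 0}" "bounded (range P)" shows "bounded (range (subdiv c P))"
  by (rule bounded_rangeI, rule norm_subdiv_le[OF assms(1) le_sup_norm[OF assms(2)] sup_norm_nonneg[OF assms(2)]])

lemma geometric_partial_sum_le:
  fixes \<theta> :: real
  assumes "0 \<le> \<theta>" "\<theta> < 1" shows "(\<Sum>q<r. \<theta> ^ q) \<le> 1 / (1 - \<theta>)"
  using assms by (simp add: sum_gp_strict divide_right_mono)

text \<open>The right-hand side \<open>V\<close> dominates \<open>T\<close> and grows by at most the
  factor 1 + C \<theta>^k \<le> exp (C \<theta>^k) per step; the exponents have a finite
  sum.\<close>

lemma gronwall_geometric: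
  fixes T :: "nat \<Rightarrow> real"
  assumes "0 \<le> \<theta>" "\<theta> < 1" "0 \<le> C" "0 \<le> C0" and "\<And>k. T k \<le> C0 + C * (\<Sum>l<k. \<theta> ^ l * T l)"
  shows "T k \<le> C0 * exp (C / (1 - \<theta>))"
proof -
  define V where "V k = C0 + C * (\<Sum>l<k. \<theta> ^ l * T l)" for k
  have V: "V k \<le> C0 * exp (C * (\<Sum>l<k. \<theta> ^ l))" for k
  proof (induction k)
    case (Suc k)
    have "V (Suc k) = V k + C * \<theta> ^ k * T k" by (simp add: V_def algebra_simps)
    also have "\<dots> \<le> V k + C * \<theta> ^ k * V k"
      using assms by (intro add_left_mono mult_left_mono) (auto simp: V_def)
    also have "\<dots> = V k * (1 + C * \<theta> ^ k)" by (simp add: algebra_simps)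
    also have "\<dots> \<le> C0 * exp (C * (\<Sum>l<k. \<theta> ^ l)) * exp (C * \<theta> ^ k)"
      using assms by (intro mult_mono Suc exp_ge_add_one_self) auto
    also have "\<dots> = C0 * exp (C * (\<Sum>l<Suc k. \<theta> ^ l))" by (simp add: distrib_left exp_add)
    finally show ?case .
  qed (simp add: V_def)
  have "T k \<le> V k" using assms(5) by (simp add: V_def)
  also have "\<dots> \<le> C0 * exp (C * (\<Sum>l<k. \<theta> ^ l))" by (rule V)
  also have "\<dots> \<le> C0 * exp (C * (1 / (1 - \<theta>)))"
    using assms geometric_partial_sum_le[OF assms(1,2), of k]
    by (intro mult_left_mono) (auto simp del: times_divide_eq_right intro!: mult_left_mono)
  finally show ?thesis by simp
qed

text \<open>Discrete variation of constants: the error made at each level is transported by the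
  remaining power of the linear operator, at the price \<open>B\<close>.\<close>

lemma perturbed_orbit:
  fixes Y e :: "nat \<Rightarrow> 'a::real_normed_vector polygon"
  assumes B: "\<And>r (P::'a polygon) A i. (\<And>j. norm (P j) \<le> A) \<Longrightarrow> norm ((subdiv b ^^ r) P i) \<le> B * A"
    and Y: "\<And>k i. Y (Suc k) i = subdiv b (Y k) i + e k i" and e: "\<And>k i. norm (e k i) \<le> \<epsilon> k"
  shows "norm (Y (l + r) i - (subdiv b ^^ r) (Y l) i) \<le> B * (\<Sum>q<r. \<epsilon> (l + q))"
proof (induction r arbitrary: l i)
  case (Suc r)
  have "Y (l + Suc r) i - (subdiv b ^^ Suc r) (Y l) i
      = (Y (Suc l + r) i - (subdiv b ^^ r) (Y (Suc l)) i) + (subdiv b ^^ r) (\<lambda>j. Y (Suc l) j - subdiv b (Y l) j) i"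
    by (simp add: funpow_subdiv_diff funpow_Suc_right del: funpow.simps)
  also have "norm \<dots> \<le> B * (\<Sum>q<r. \<epsilon> (Suc l + q)) + B * \<epsilon> l"
    by (intro norm_triangle_mono Suc B) (simp add: Y e)
  also have "\<dots> = B * (\<Sum>q<Suc r. \<epsilon> (l + q))"
    unfolding sum.lessThan_Suc_shift by (simp add: distrib_left)
  finally show ?case .
qed simp

text \<open>\<open>conv\<close> comes with no rate, so increments cannot simply be summed. The
  perturbed sequence is compared instead with the unperturbed orbits started at each level
  \<open>l\<close>: these have continuous limits, and from level \<open>l\<close> on they miss the
  perturbed sequence by at most \<open>\<epsilon> l\<close>.\<close>

lemma perturbed_convergent_scheme:
  fixes Y e :: "nat \<Rightarrow> 'a::euclidean_space polygon"
  assumes b: "affine_mask b" and conv: "scheme_C 0 (linear_scheme b :: 'a scheme)"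
    and Y: "\<And>k i. Y (Suc k) i = subdiv b (Y k) i + e k i" and bd: "\<And>k. bounded (range (Y k))"
    and \<theta>: "0 < \<theta>" "\<theta> < 1" and e: "\<And>k i. norm (e k i) \<le> C * \<theta> ^ k"
  obtains F where "limit_curve Y F" and "continuous_on UNIV F"
proof -
  obtain B where B0: "0 \<le> B" and
    B: "\<And>r (P::'a polygon) A i. (\<And>j. norm (P j) \<le> A) \<Longrightarrow> norm ((subdiv b ^^ r) P i) \<le> B * A"
    using convergent_scheme_power_bounded[OF b conv] by blast
  have C0: "0 \<le> C" using order_trans[OF norm_ge_zero e[of 0 0]] by simp
  \<comment> \<open>The power bound times the tail of the geometric series of errors from level
    \<open>l\<close> on.\<close>
  define \<epsilon> where "\<epsilon> l = B * (C / (1 - \<theta>)) * \<theta> ^ l" for l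
  have \<epsilon>0: "\<epsilon> \<longlonglongrightarrow> 0"
    unfolding \<epsilon>_def[abs_def] using \<theta> by (intro tendsto_mult_right_zero LIMSEQ_realpow_zero) auto
  have orbit: "norm (Y (l + r) i - (subdiv b ^^ r) (Y l) i) \<le> \<epsilon> l" for l r i
  proof -
    have "norm (Y (l + r) i - (subdiv b ^^ r) (Y l) i) \<le> B * (\<Sum>q<r. C * \<theta> ^ (l + q))"
      by (rule perturbed_orbit[where \<epsilon> = "\<lambda>k. C * \<theta> ^ k", OF B Y e])
    also have "(\<Sum>q<r. C * \<theta> ^ (l + q)) = C * \<theta> ^ l * (\<Sum>q<r. \<theta> ^ q)"
      by (simp add: power_add sum_distrib_left mult_ac)
    also have "B * \<dots> \<le> B * (C * \<theta> ^ l * (1 / (1 - \<theta>)))"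
      using geometric_partial_sum_le[of \<theta> r] \<theta> B0 C0 by (intro mult_left_mono) auto
    finally show ?thesis by (simp add: \<epsilon>_def mult_ac)
  qed
  have "\<exists>g. limit_curve (refine (linear_scheme b) (Y l)) g \<and> C_curve 0 g" for l
    using conv bd[of l] unfolding scheme_C_def by blast
  then obtain g where g: "\<And>l. limit_curve (refine (linear_scheme b) (Y l)) (g l)" "\<And>l. C_curve 0 (g l)"
    by metis
  \<comment> \<open>An orbit started at \<open>Y l\<close> has its initial knots at the integers,
    whereas the knots of level \<open>l\<close> are the multiples of 2^(-l).\<close>
  define G where "G l t = g l (2 ^ l * t)" for l t
  have contG: "continuous_on UNIV (G l)" for l
  proof -
    have "continuous_on UNIV (g l)" using g(2)[of l] by (auto simp: C_curve_def)
    then show ?thesis unfolding G_def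
      by (rule continuous_on_compose2) (auto intro: continuous_intros)
  qed
  have ev: "\<forall>\<^sub>F k in sequentially. \<forall>t. dist (pl_curve k (Y k) t) (G l t) < \<epsilon> l + d" if "0 < d" for l d
  proof -
    from uniform_limitD[OF g(1)[of l, unfolded limit_curve_def] that]
    obtain R where R: "\<And>r t. R \<le> r \<Longrightarrow> dist (pl_curve r ((subdiv b ^^ r) (Y l)) t) (g l t) < d"
      unfolding eventually_sequentially refine_linear_scheme by auto
    have "dist (pl_curve (l + r) (Y (l + r)) t) (G l t) < \<epsilon> l + d" if "R \<le> r" for r t
    proof -
      have "norm (pl_curve (l + r) (Y (l + r)) t - pl_curve (l + r) ((subdiv b ^^ r) (Y l)) t) \<le> \<epsilon> l"
        by (rule norm_pl_curve_diff_le[OF orbit])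
      moreover have "dist (pl_curve (l + r) ((subdiv b ^^ r) (Y l)) t) (G l t) < d"
        using R[OF that] by (simp add: G_def pl_curve_rescale)
      ultimately show ?thesis
        using dist_triangle[of "pl_curve (l + r) (Y (l + r)) t" "G l t" "pl_curve (l + r) ((subdiv b ^^ r) (Y l)) t"]
        unfolding dist_norm by linarith
    qed
    then have "\<forall>k\<ge>l + R. \<forall>t. dist (pl_curve k (Y k) t) (G l t) < \<epsilon> l + d"
      by (metis add_le_cancel_left le_add1 le_iff_add order_trans)
    then show ?thesis unfolding eventually_sequentially by blast
  qed
  have "uniformly_Cauchy_on UNIV (\<lambda>k. pl_curve k (Y k))"
    unfolding uniformly_Cauchy_on_def
  proof (intro allI impI)
    fix d :: real assume "0 < d"
    then have "\<forall>\<^sub>F l in sequentially. \<epsilon> l < d / 4" by (intro order_tendstoD(2)[OF \<epsilon>0]) simp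
    then obtain l where l: "\<epsilon> l < d / 4" unfolding eventually_sequentially by blast
    obtain K where K: "\<And>k t. K \<le> k \<Longrightarrow> dist (pl_curve k (Y k) t) (G l t) < \<epsilon> l + d / 4"
      using ev[of "d / 4" l] \<open>0 < d\<close> unfolding eventually_sequentially by auto
    have "dist (pl_curve k (Y k) t) (pl_curve k' (Y k') t) < d" if "K \<le> k" "K \<le> k'" for k k' t
      using K[OF that(1), of t] K[OF that(2), of t] l
        dist_triangle2[of "pl_curve k (Y k) t" "pl_curve k' (Y k') t" "G l t"] by linarith
    then show "\<exists>M. \<forall>x\<in>UNIV. \<forall>k\<ge>M. \<forall>n\<ge>M. dist (pl_curve k (Y k) x) (pl_curve n (Y n) x) < d"
      by blast
  qed
  then obtain F where F: "uniform_limit UNIV (\<lambda>k. pl_curve k (Y k)) F sequentially"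
    using Cauchy_uniformly_convergent uniformly_convergent_uniform_limit_iff by blast
  have GF: "dist (G l t) (F t) \<le> \<epsilon> l" for l t
  proof (rule field_le_epsilon)
    fix d :: real assume "0 < d"
    have "\<forall>\<^sub>F k in sequentially. dist (pl_curve k (Y k) t) (G l t) \<le> \<epsilon> l + d"
      using ev[OF \<open>0 < d\<close>, of l] by eventually_elim (simp add: less_imp_le)
    moreover have "(\<lambda>k. dist (pl_curve k (Y k) t) (G l t)) \<longlonglongrightarrow> dist (F t) (G l t)"
      using tendsto_uniform_limitI[OF F] by (intro tendsto_intros) simp
    ultimately show "dist (G l t) (F t) \<le> \<epsilon> l + d"
      using tendsto_upperbound[of "\<lambda>k. dist (pl_curve k (Y k) t) (G l t)"] by (simp add: dist_commute)
  qed
  have "uniform_limit UNIV G F sequentially"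
    unfolding uniform_limit_iff
  proof (intro allI impI)
    fix d :: real assume "0 < d"
    then have "\<forall>\<^sub>F l in sequentially. \<epsilon> l < d" by (intro order_tendstoD(2)[OF \<epsilon>0])
    then show "\<forall>\<^sub>F l in sequentially. \<forall>t\<in>UNIV. dist (G l t) (F t) < d"
      by eventually_elim (use GF in \<open>auto intro: le_less_trans\<close>)
  qed
  then have "continuous_on UNIV F"
    by (rule uniform_limit_theorem[rotated]) (auto simp: contG)
  with F show thesis by (intro that) (simp add: limit_curve_def)
qed

text \<open>Compares values at nearly equal parameters of consecutive levels. The tolerance 2 covers
  both ends of a fine segment when \<open>l\<close> is the left end of the coarse segment containing
  it.\<close>

lemma perturbed_subdiv_near:
  assumes d: "affine_mask d"
  obtains K where "0 \<le> K" and "\<And>(Y::'a::real_normed_vector polygon) Y' A \<epsilon> i l.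
    (\<And>j. norm (bdiff Y j) \<le> A) \<Longrightarrow> (\<And>j. norm (Y' j - subdiv d Y j) \<le> \<epsilon>) \<Longrightarrow> \<bar>i - 2 * l\<bar> \<le> 2
    \<Longrightarrow> norm (Y' i - Y l) \<le> K * A + \<epsilon>"
proof -
  obtain N where N: "\<And>i. d i \<noteq> 0 \<Longrightarrow> \<bar>i\<bar> \<le> N" using mask_radius[OF affine_mask_finite[OF d]] by blast
  define K where "K = mask_norm d * of_int (N + 2)"
  have "0 \<le> N"
  proof -
    obtain i0 where "d i0 \<noteq> 0"
      using affine_mask_stencil_nonempty[OF d] by blast
    then show ?thesis using N[of i0] by linarith
  qed
  show thesis
  proof (rule that[of K])
    show "0 \<le> K" using mask_norm_nonneg[of d] \<open>0 \<le> N\<close> by (simp add: K_def)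
    fix Y :: "'a polygon" and Y' A \<epsilon> i l
    assume A: "\<And>j. norm (bdiff Y j) \<le> A" and \<epsilon>: "\<And>j. norm (Y' j - subdiv d Y j) \<le> \<epsilon>"
      and il: "\<bar>i - 2 * l\<bar> \<le> (2::int)"
    have "norm (Y l - subdiv d Y i) \<le> K * A"
      using norm_diff_subdiv_le[OF d N A il] by (simp add: K_def mult.assoc)
    then show "norm (Y' i - Y l) \<le> K * A + \<epsilon>"
      using norm_triangle_ineq4[of "Y' i - subdiv d Y i" "Y l - subdiv d Y i"] \<epsilon>[of i] by simp
  qed
qed

text \<open>Serves the orders below \<open>m\<close>, for whose masks no convergence is at hand:
  geometrically decaying differences make successive curves geometrically close.\<close>

lemma perturbed_scheme_limit:
  fixes Y :: "nat \<Rightarrow> 'a::banach polygon"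
  assumes d: "affine_mask d" and \<theta>: "0 < \<theta>" "\<theta> < 1"
    and Y: "\<And>k i. norm (Y (Suc k) i - subdiv d (Y k) i) \<le> C * \<theta> ^ k"
    and bd: "\<And>k i. norm (bdiff (Y k) i) \<le> D * \<theta> ^ k"
  obtains F where "limit_curve Y F"
proof -
  obtain K where K: "0 \<le> K" "\<And>(Y::'a polygon) Y' A \<epsilon> i l.
    (\<And>j. norm (bdiff Y j) \<le> A) \<Longrightarrow> (\<And>j. norm (Y' j - subdiv d Y j) \<le> \<epsilon>) \<Longrightarrow> \<bar>i - 2 * l\<bar> \<le> 2
    \<Longrightarrow> norm (Y' i - Y l) \<le> K * A + \<epsilon>"
    using perturbed_subdiv_near[OF d] by blast
  have "norm (pl_curve (Suc k) (Y (Suc k)) t - pl_curve k (Y k) t) \<le> (K * D + C + D) * \<theta> ^ k" for k t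
  proof -
    define l where "l = \<lfloor>2 ^ k * t\<rfloor>"
    define i where "i = \<lfloor>2 ^ Suc k * t\<rfloor>"
    have "2 * l \<le> i" "i \<le> 2 * l + 1" unfolding l_def i_def by (simp_all, linarith+)
    then have il: "\<bar>i - 2 * l\<bar> \<le> 2" "\<bar>i + 1 - 2 * l\<bar> \<le> 2" by auto
    have "norm (pl_curve (Suc k) (Y (Suc k)) t - Y k l) \<le> K * (D * \<theta> ^ k) + C * \<theta> ^ k"
      by (rule pl_curve_near; unfold i_def[symmetric]; rule K(2)[OF bd Y]) (use il in auto)
    moreover have "norm (pl_curve k (Y k) t - Y k l) \<le> D * \<theta> ^ k"
      by (rule pl_curve_near; unfold l_def[symmetric])
        (use bd[of k "l + 1"] order_trans[OF norm_ge_zero bd[of k l]] in \<open>auto simp: bdiff_def\<close>)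
    ultimately show ?thesis
      using norm_triangle_ineq4[of "pl_curve (Suc k) (Y (Suc k)) t - Y k l" "pl_curve k (Y k) t - Y k l"]
      by (simp add: algebra_simps)
  qed
  then show thesis
    using uniform_limit_geometric[of \<theta> "\<lambda>k. pl_curve k (Y k)"] \<theta> that unfolding limit_curve_def
    by (metis less_imp_le)
qed

text \<open>These are difference quotients for knots of spacing 2^(-k), without the factorials; in
  the limit they become the \<open>s\<close>-th derivative.\<close>

definition scaled_diff :: "(nat \<Rightarrow> 'a::real_vector polygon) \<Rightarrow> nat \<Rightarrow> nat \<Rightarrow> 'a polygon" where
  "scaled_diff p s k i = 2 ^ (k * s) *\<^sub>R (bdiff ^^ s) (p k) i"

lemma scaled_diff_0: "scaled_diff p 0 = p"
  by (simp add: scaled_diff_def fun_eq_iff)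

lemma scaled_diff_Suc: "scaled_diff p (Suc s) k i = 2 ^ k *\<^sub>R bdiff (scaled_diff p s k) i"
proof -
  have "bdiff (scaled_diff p s k) = (\<lambda>i. 2 ^ (k * s) *\<^sub>R bdiff ((bdiff ^^ s) (p k)) i)"
    unfolding scaled_diff_def[abs_def] by (rule bdiff_linear) (simp add: linear_iff scaleR_right_distrib)
  then show ?thesis by (simp add: scaled_diff_def power_add)
qed

lemma bounded_scaled_diff:
  fixes p :: "nat \<Rightarrow> 'a::real_normed_vector polygon"
  assumes "bounded (range (p k))" shows "bounded (range (scaled_diff p s k))"
proof (rule bounded_rangeI)
  show "norm (scaled_diff p s k i) \<le> 2 ^ (k * s) * sup_norm ((bdiff ^^ s) (p k))" for i
    using le_sup_norm[OF bounded_funpow_bdiff[OF assms]] by (simp add: scaled_diff_def)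
qed

lemma funpow_bdiff_diff: "(bdiff ^^ s) (\<lambda>i. P i - Q i) = (\<lambda>i. (bdiff ^^ s) P i - (bdiff ^^ s) Q i)"
  by (induction s) (simp_all add: bdiff_def[abs_def] algebra_simps)

context mask_chain
begin

lemma scaled_diff_step:
  assumes "s \<le> m"
  shows "scaled_diff p s (Suc k) i - subdiv (c s) (scaled_diff p s k) i
    = 2 ^ (Suc k * s) *\<^sub>R (bdiff ^^ s) (\<lambda>i. p (Suc k) i - S (p k) i) i"
proof -
  have "2 ^ (Suc k * s) * (1/2) ^ s = (2::real) ^ (k * s)"
    by (simp add: power_add power_one_over)
  moreover have "subdiv (c s) (scaled_diff p s k) i = 2 ^ (k * s) *\<^sub>R subdiv (c s) ((bdiff ^^ s) (p k)) i"
    unfolding scaled_diff_def[abs_def] by (rule subdiv_scaleR)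
  ultimately show ?thesis
    unfolding funpow_bdiff_diff funpow_bdiff_subdiv[OF assms]
    by (simp add: scaled_diff_def scaleR_right_diff_distrib)
qed

text \<open>The errors of a scheme that acts linearly on the points are proportional to their
  differences, hence the factor \<open>T k\<close> in \<open>err\<close>. Once \<open>T\<close> is
  shown to be bounded, the errors are summable outright, the scaled differences of every order
  converge, and their limits are successive derivatives.\<close>

lemma perturbed_scheme_C:
  fixes p :: "nat \<Rightarrow> 'a::euclidean_space polygon"
  assumes conv: "scheme_C 0 (linear_scheme (c m) :: 'a scheme)"
    and bd: "\<And>k. bounded (range (p k))" and \<theta>: "1 / 2 \<le> \<theta>" "\<theta> < 1" and C: "0 \<le> C"
    and T: "\<And>k. T k = (\<Sum>s\<le>m. sup_norm (scaled_diff p s k))"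
    and err: "\<And>s k i. s \<le> m \<Longrightarrow>
      norm ((bdiff ^^ s) (\<lambda>i. p (Suc k) i - S (p k) i) i) \<le> C * \<theta> ^ k * T k / 2 ^ (k * s)"
  shows "\<exists>f. limit_curve p f \<and> C_curve m f"
proof -
  define y where "y = scaled_diff p"
  define t where "t s k = sup_norm (y s k)" for s k
  define E where "E = 2 ^ m * C"
  have E: "0 \<le> E" using C by (simp add: E_def)
  have by': "bounded (range (y s k))" for s k
    unfolding y_def by (rule bounded_scaled_diff[OF bd])
  have t: "norm (y s k i) \<le> t s k" "0 \<le> t s k" for s k i
    unfolding t_def using le_sup_norm[OF by'] sup_norm_nonneg[OF by'] by auto
  have tT: "t s k \<le> T k" if "s \<le> m" for s k
    unfolding T y_def[symmetric] t_def[symmetric] using that t(2) by (intro member_le_sum) auto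
  have T0: "0 \<le> T k" for k using t(2)[of 0 k] tT[of 0 k] by simp
  have \<theta>0: "0 < \<theta>" using \<theta> by simp
  \<comment> \<open>The lower bound on \<open>\<theta>\<close> lets a single rate absorb both the
    perturbation and the factor 2^(-k) of an unscaled difference.\<close>
  have half: "1 / 2 ^ k \<le> \<theta> ^ k" for k
    using power_mono[OF \<theta>(1), of k] by (simp add: power_one_over)
  have step: "norm (y s (Suc k) i - subdiv (c s) (y s k) i) \<le> E * (\<theta> ^ k * T k)" if "s \<le> m" for s k i
  proof -
    have "norm (y s (Suc k) i - subdiv (c s) (y s k) i)
        = 2 ^ (Suc k * s) * norm ((bdiff ^^ s) (\<lambda>i. p (Suc k) i - S (p k) i) i)"
      unfolding y_def scaled_diff_step[OF that] by simp
    also have "\<dots> \<le> 2 ^ (Suc k * s) * (C * \<theta> ^ k * T k / 2 ^ (k * s))"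
      by (intro mult_left_mono err that) simp
    also have "\<dots> = 2 ^ s * (C * \<theta> ^ k * T k)" by (simp add: power_add)
    also have "\<dots> \<le> 2 ^ m * (C * \<theta> ^ k * T k)"
      using that C \<theta>0 T0 by (intro mult_right_mono power_increasing mult_nonneg_nonneg) auto
    finally show ?thesis by (simp add: E_def mult_ac)
  qed
  have bdiff_y: "norm (bdiff (y s k) i) \<le> t (Suc s) k / 2 ^ k" for s k i
    using t(1)[of "Suc s" k i] unfolding y_def scaled_diff_Suc by (simp add: field_simps)
  have bdiff_y': "norm (bdiff (y s k) i) \<le> T k * \<theta> ^ k" if "s < m" for s k i
  proof -
    have "norm (bdiff (y s k) i) \<le> t (Suc s) k * (1 / 2 ^ k)" using bdiff_y[of s k i] by simp
    also have "\<dots> \<le> T k * \<theta> ^ k" using tT[of "Suc s" k] T0 half that by (intro mult_mono) auto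
    finally show ?thesis .
  qed
  \<comment> \<open>Below the top order the next scaled difference is part of \<open>T\<close>, so a
    refinement step moves the values only by a multiple of \<theta>^k T k.\<close>
  have lower: "\<exists>K\<ge>0. \<forall>k. t s (Suc k) \<le> t s k + K * (\<theta> ^ k * T k)" if s: "s < m" for s
  proof -
    obtain K where K: "0 \<le> K" "\<And>(Y::'a polygon) Y' A \<epsilon> i l.
      (\<And>j. norm (bdiff Y j) \<le> A) \<Longrightarrow> (\<And>j. norm (Y' j - subdiv (c s) Y j) \<le> \<epsilon>) \<Longrightarrow> \<bar>i - 2 * l\<bar> \<le> 2
      \<Longrightarrow> norm (Y' i - Y l) \<le> K * A + \<epsilon>"
      using perturbed_subdiv_near[OF affine, of s] s by (metis less_imp_le)
    have "t s (Suc k) \<le> t s k + (K + E) * (\<theta> ^ k * T k)" for k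
      unfolding t_def[of s "Suc k"]
    proof (rule sup_norm_le)
      fix i
      have "norm (y s (Suc k) i - y s k (i div 2)) \<le> K * (T k * \<theta> ^ k) + E * (\<theta> ^ k * T k)"
        by (rule K(2)[OF bdiff_y'[OF s] step]) (use s in auto)
      then show "norm (y s (Suc k) i) \<le> t s k + (K + E) * (\<theta> ^ k * T k)"
        using t(1)[of s k "i div 2"] norm_triangle_sub[of "y s (Suc k) i" "y s k (i div 2)"]
        by (simp add: algebra_simps)
    qed
    then show ?thesis using K(1) E by (intro exI[of _ "K + E"]) auto
  qed
  then obtain K where K: "\<And>s. s < m \<Longrightarrow> 0 \<le> K s"
    "\<And>s k. s < m \<Longrightarrow> t s (Suc k) \<le> t s k + K s * (\<theta> ^ k * T k)" by metis
  define K' where "K' = (\<Sum>s<m. K s)"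
  have K': "0 \<le> K'" unfolding K'_def using K(1) by (intro sum_nonneg) auto
  have low: "(\<Sum>s<m. t s k) \<le> (\<Sum>s<m. t s 0) + K' * (\<Sum>l<k. \<theta> ^ l * T l)" for k
  proof (induction k)
    case (Suc k)
    have "(\<Sum>s<m. t s (Suc k)) \<le> (\<Sum>s<m. t s k + K s * (\<theta> ^ k * T k))"
      by (rule sum_mono) (use K(2) in auto)
    also have "\<dots> = (\<Sum>s<m. t s k) + K' * (\<theta> ^ k * T k)"
      unfolding K'_def sum.distrib sum_distrib_right ..
    finally show ?case using Suc by (simp add: algebra_simps)
  qed simp
  obtain B where B0: "0 \<le> B" and
    B: "\<And>r (P::'a polygon) A i. (\<And>j. norm (P j) \<le> A) \<Longrightarrow> norm ((subdiv (c m) ^^ r) P i) \<le> B * A"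
    using convergent_scheme_power_bounded[OF affine[OF order_refl] conv] by blast
  define e where "e k i = y m (Suc k) i - subdiv (c m) (y m k) i" for k i
  have y_rec: "y m (Suc k) i = subdiv (c m) (y m k) i + e k i" for k i by (simp add: e_def)
  have e: "norm (e k i) \<le> E * (\<theta> ^ k * T k)" for k i unfolding e_def by (rule step) simp
  \<comment> \<open>At order \<open>m\<close> no further difference is available; power boundedness
    of \<open>S_b\<close> takes its place.\<close>
  have top: "t m k \<le> B * t m 0 + B * E * (\<Sum>l<k. \<theta> ^ l * T l)" for k
    unfolding t_def[of m k]
  proof (rule sup_norm_le)
    fix i
    have "norm (y m (0 + k) i - (subdiv (c m) ^^ k) (y m 0) i) \<le> B * (\<Sum>q<k. E * (\<theta> ^ (0 + q) * T (0 + q)))"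
      by (rule perturbed_orbit[where \<epsilon> = "\<lambda>k. E * (\<theta> ^ k * T k)", OF B y_rec e])
    moreover have "norm ((subdiv (c m) ^^ k) (y m 0) i) \<le> B * t m 0" by (rule B[OF t(1)])
    ultimately show "norm (y m k i) \<le> B * t m 0 + B * E * (\<Sum>l<k. \<theta> ^ l * T l)"
      using norm_triangle_sub[of "y m k i" "(subdiv (c m) ^^ k) (y m 0) i"]
      by (simp add: sum_distrib_left mult_ac)
  qed
  define M where "M = ((\<Sum>s<m. t s 0) + B * t m 0) * exp ((K' + B * E) / (1 - \<theta>))"
  have M: "T k \<le> M" for k
    unfolding M_def
  proof (rule gronwall_geometric)
    fix k
    have "T k = (\<Sum>s<m. t s k) + t m k" by (simp add: T t_def y_def flip: lessThan_Suc_atMost)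
    then show "T k \<le> (\<Sum>s<m. t s 0) + B * t m 0 + (K' + B * E) * (\<Sum>l<k. \<theta> ^ l * T l)"
      using low[of k] top[of k] by (simp add: algebra_simps)
  qed (use \<theta> K' B0 E t(2) in \<open>auto intro!: add_nonneg_nonneg sum_nonneg\<close>)
  have step': "norm (y s (Suc k) i - subdiv (c s) (y s k) i) \<le> (E * M) * \<theta> ^ k" if "s \<le> m" for s k i
  proof -
    have "E * (\<theta> ^ k * T k) \<le> E * (\<theta> ^ k * M)" using M E \<theta>0 by (intro mult_left_mono) auto
    with step[OF that, of k i] show ?thesis by (simp add: mult_ac)
  qed
  have "\<exists>F. limit_curve (y s) F \<and> (s = m \<longrightarrow> continuous_on UNIV F)" if "s \<le> m" for s
  proof (cases "s = m")
    case True
    have "norm (e k i) \<le> (E * M) * \<theta> ^ k" for k i using step'[of m] by (simp add: e_def)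
    from perturbed_convergent_scheme[OF affine[OF order_refl] conv y_rec by' \<theta>0 \<theta>(2) this]
    show ?thesis using True by metis
  next
    case False
    then have s: "s < m" using that by simp
    have "norm (bdiff (y s k) i) \<le> M * \<theta> ^ k" for k i
      using order_trans[OF bdiff_y'[OF s, of k i]] M[of k] \<theta>0 by (simp add: mult_right_mono)
    from perturbed_scheme_limit[OF affine[OF that] \<theta>0 \<theta>(2) step'[OF that] this]
    show ?thesis using False by metis
  qed
  then obtain F where F: "\<And>s. s \<le> m \<Longrightarrow> limit_curve (y s) (F s)" "continuous_on UNIV (F m)"
    by (metis order_refl)
  have deriv_F: "(F s has_vector_derivative F (Suc s) x) (at x)"
    if "s < m" "continuous_on UNIV (F (Suc s))" for s x
  proof (rule limit_curve_derivative)
    show "limit_curve (y s) (F s)" "limit_curve (y (Suc s)) (F (Suc s))" using F(1) that by auto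
    show "y (Suc s) k i = 2 ^ k *\<^sub>R bdiff (y s k) i" for k i unfolding y_def by (rule scaled_diff_Suc)
    show "norm (y (Suc s) k i) \<le> M" for k i
      using t(1)[of "Suc s" k i] tT[of "Suc s" k] M[of k] that by simp
  qed fact
  \<comment> \<open>Continuity descends from order \<open>m\<close>: continuity of
    \<open>F (Suc s)\<close> makes \<open>F s\<close> differentiable, hence continuous.\<close>
  have cont: "continuous_on UNIV (F s)" if "s \<le> m" for s
    using that
  proof (induction s rule: inc_induct)
    case (step s)
    then show ?case
      using deriv_F by (intro continuous_at_imp_continuous_on ballI has_vector_derivative_continuous) auto
  qed (rule F(2))
  have "C_curve m (F 0)"
    unfolding C_curve_def using deriv_F cont by (intro exI[of _ F]) auto
  moreover have "limit_curve p (F 0)" using F(1)[of 0] by (simp add: y_def scaled_diff_0)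
  ultimately show ?thesis by blast
qed

end

section \<open>Interpolation between orders of differences\<close>

text \<open>A discrete Landau-Kolmogorov inequality in additive form, with a free step
  \<open>N\<close>: X(i+N) - X(i) is N times the difference at \<open>i\<close> up to N^2 second
  differences.\<close>

lemma sup_norm_bdiff_interpolate:
  fixes X :: "'a::real_normed_vector polygon"
  assumes X: "bounded (range X)"
  shows "of_nat N * sup_norm (bdiff X) \<le> 2 * sup_norm X + of_nat N ^ 2 * sup_norm (bdiff (bdiff X))"
proof (cases "N = 0")
  case False
  have "norm (bdiff X i) \<le> (2 * sup_norm X + of_nat N ^ 2 * sup_norm (bdiff (bdiff X))) / of_nat N" for i
  proof -
    define Z where "Z j = X j - of_int j *\<^sub>R bdiff X i" for j
    have "norm (bdiff Z j) \<le> of_nat N * sup_norm (bdiff (bdiff X))" if "i < j" "j \<le> i + int N" for j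
    proof -
      have "bdiff Z j = bdiff X j - bdiff X i"
        by (simp add: Z_def bdiff_def[of _ j] algebra_simps)
      also have "norm \<dots> \<le> of_int \<bar>j - i\<bar> * sup_norm (bdiff (bdiff X))"
        by (rule norm_diff_le_bdiff[OF le_sup_norm]) (intro bounded_bdiff X)
      also have "\<dots> \<le> of_nat N * sup_norm (bdiff (bdiff X))"
        using that by (intro mult_right_mono sup_norm_nonneg bounded_bdiff X) simp
      finally show ?thesis .
    qed
    then have "norm (Z (i + int N) - Z i) \<le> of_int ((i + int N) - i) * (of_nat N * sup_norm (bdiff (bdiff X)))"
      by (intro norm_diff_le_bdiff_range) auto
    moreover have "of_nat N *\<^sub>R bdiff X i = (X (i + int N) - X i) - (Z (i + int N) - Z i)"
      by (simp add: Z_def algebra_simps)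
    then have "of_nat N * norm (bdiff X i) \<le> (norm (X (i + int N)) + norm (X i)) + norm (Z (i + int N) - Z i)"
      by (metis (no_types) abs_of_nat add_right_mono norm_scaleR norm_triangle_ineq4 order_trans)
    ultimately have "of_nat N * norm (bdiff X i) \<le> 2 * sup_norm X + of_nat N ^ 2 * sup_norm (bdiff (bdiff X))"
      using le_sup_norm[OF X, of "i + int N"] le_sup_norm[OF X, of i] by (simp add: power2_eq_square mult_ac)
    then show ?thesis using False by (simp add: field_simps)
  qed
  then have "sup_norm (bdiff X) \<le> (2 * sup_norm X + of_nat N ^ 2 * sup_norm (bdiff (bdiff X))) / of_nat N"
    by (rule sup_norm_le)
  then show ?thesis using False by (simp add: field_simps)
qed (simp add: sup_norm_nonneg[OF X])

lemma interpolation_next: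
  "\<exists>D\<ge>0. \<forall>(X::'a::real_normed_vector polygon) N. bounded (range X) \<longrightarrow>
    of_nat N ^ s * sup_norm ((bdiff ^^ s) X)
      \<le> D * (sup_norm X + of_nat N ^ Suc s * sup_norm ((bdiff ^^ Suc s) X))"
proof (induction s)
  case 0
  have "sup_norm X \<le> sup_norm X + of_nat N * sup_norm (bdiff X)" if "bounded (range X)"
    for X :: "'a polygon" and N
    using sup_norm_nonneg[OF bounded_bdiff[OF that]] by simp
  then show ?case by (intro exI[of _ 1]) simp
next
  case (Suc s)
  then obtain D where D: "0 \<le> D" "\<And>(X::'a polygon) N. bounded (range X) \<Longrightarrow>
    of_nat N ^ s * sup_norm ((bdiff ^^ s) X)
      \<le> D * (sup_norm X + of_nat N ^ Suc s * sup_norm ((bdiff ^^ Suc s) X))" by blast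
  \<comment> \<open>The inequality for first differences is applied to the \<open>s\<close>-th
    differences with step \<open>K * N\<close>. \<open>K \<ge> 4 * D\<close> makes the coefficient
    of \<open>w (Suc s)\<close> on the right at most half of that on the left, so it can be
    absorbed; the summand 1 keeps \<open>K\<close> positive.\<close>
  define K where "K = nat \<lceil>4 * D\<rceil> + 1"
  have K: "4 * D \<le> of_nat K" "0 < K" unfolding K_def by linarith+
  have "of_nat N ^ Suc s * sup_norm ((bdiff ^^ Suc s) X)
      \<le> (1 + 2 * of_nat K) * (sup_norm X + of_nat N ^ Suc (Suc s) * sup_norm ((bdiff ^^ Suc (Suc s)) X))"
    if X: "bounded (range X)" for X :: "'a polygon" and N
  proof -
    define w where "w t = of_nat N ^ t * sup_norm ((bdiff ^^ t) X)" for t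
    have w: "0 \<le> w t" for t unfolding w_def by (intro mult_nonneg_nonneg sup_norm_nonneg bounded_funpow_bdiff X) simp
    have "of_nat N ^ s * (of_nat (K * N) * sup_norm (bdiff ((bdiff ^^ s) X)))
        \<le> of_nat N ^ s * (2 * sup_norm ((bdiff ^^ s) X)
            + of_nat (K * N) ^ 2 * sup_norm (bdiff (bdiff ((bdiff ^^ s) X))))"
      by (intro mult_left_mono sup_norm_bdiff_interpolate bounded_funpow_bdiff X) simp
    then have "of_nat K * w (Suc s) \<le> 2 * w s + of_nat K ^ 2 * w (Suc (Suc s))"
      by (simp add: w_def algebra_simps power2_eq_square)
    also have "\<dots> \<le> 2 * (D * (sup_norm X + w (Suc s))) + of_nat K ^ 2 * w (Suc (Suc s))"
      using D(2)[OF X, of N] by (simp add: w_def)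
    also have "\<dots> \<le> of_nat K / 2 * (sup_norm X + w (Suc s)) + of_nat K ^ 2 * w (Suc (Suc s))"
    proof -
      have "(2 * D) * (sup_norm X + w (Suc s)) \<le> of_nat K / 2 * (sup_norm X + w (Suc s))"
        using K w[of "Suc s"] sup_norm_nonneg[OF X] by (intro mult_right_mono) auto
      then show ?thesis by simp
    qed
    finally have "of_nat K * w (Suc s) \<le> of_nat K * ((sup_norm X + w (Suc s)) / 2 + of_nat K * w (Suc (Suc s)))"
      by (simp add: algebra_simps power2_eq_square)
    then have "w (Suc s) \<le> (sup_norm X + w (Suc s)) / 2 + of_nat K * w (Suc (Suc s))"
      using K(2) by simp
    moreover have "x \<le> A + 2 * z" if "x \<le> (A + x) / 2 + z" for x A z :: real
      using that by (simp add: field_simps)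
    ultimately have "w (Suc s) \<le> sup_norm X + 2 * of_nat K * w (Suc (Suc s))"
      by (simp only: mult.assoc)
    also have "\<dots> \<le> (1 + 2 * of_nat K) * (sup_norm X + w (Suc (Suc s)))"
      using w[of "Suc (Suc s)"] sup_norm_nonneg[OF X] by (simp add: algebra_simps)
    finally show ?thesis by (simp only: w_def)
  qed
  then show ?case by (intro exI[of _ "1 + 2 * of_nat K"]) auto
qed

lemma interpolation:
  "s \<le> r \<Longrightarrow> \<exists>D\<ge>0. \<forall>(X::'a::real_normed_vector polygon) N. bounded (range X) \<longrightarrow>
    of_nat N ^ s * sup_norm ((bdiff ^^ s) X) \<le> D * (sup_norm X + of_nat N ^ r * sup_norm ((bdiff ^^ r) X))"
proof (induction r rule: dec_induct)
  case base
  have "of_nat N ^ s * sup_norm ((bdiff ^^ s) X) \<le> sup_norm X + of_nat N ^ s * sup_norm ((bdiff ^^ s) X)"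
    if "bounded (range X)" for X :: "'a polygon" and N
    using sup_norm_nonneg[OF that] by simp
  then show ?case by (intro exI[of _ 1]) simp
next
  case (step r)
  obtain D where D: "0 \<le> D" "\<And>(X::'a polygon) N. bounded (range X) \<Longrightarrow>
    of_nat N ^ s * sup_norm ((bdiff ^^ s) X) \<le> D * (sup_norm X + of_nat N ^ r * sup_norm ((bdiff ^^ r) X))"
    using step.IH by blast
  obtain D' where D': "0 \<le> D'" "\<And>(X::'a polygon) N. bounded (range X) \<Longrightarrow>
    of_nat N ^ r * sup_norm ((bdiff ^^ r) X)
      \<le> D' * (sup_norm X + of_nat N ^ Suc r * sup_norm ((bdiff ^^ Suc r) X))"
    using interpolation_next by blast
  have "of_nat N ^ s * sup_norm ((bdiff ^^ s) X)
      \<le> (D * (1 + D')) * (sup_norm X + of_nat N ^ Suc r * sup_norm ((bdiff ^^ Suc r) X))"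
    if X: "bounded (range X)" for X :: "'a polygon" and N
  proof -
    define w where "w = of_nat N ^ Suc r * sup_norm ((bdiff ^^ Suc r) X)"
    have w: "0 \<le> w" unfolding w_def by (intro mult_nonneg_nonneg sup_norm_nonneg bounded_funpow_bdiff X) simp
    have "of_nat N ^ s * sup_norm ((bdiff ^^ s) X) \<le> D * (sup_norm X + D' * (sup_norm X + w))"
      using D(2)[OF X, of N] mult_left_mono[OF add_left_mono[OF D'(2)[OF X, of N]] D(1), of "sup_norm X"]
      unfolding w_def by linarith
    also have "\<dots> \<le> D * ((1 + D') * (sup_norm X + w))"
      using w D(1) by (intro mult_left_mono) (auto simp: algebra_simps)
    finally show ?thesis by (simp only: w_def mult.assoc)
  qed
  then show ?case using D(1) D'(1) by (intro exI[of _ "D * (1 + D')"]) auto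
qed

section \<open>The normals\<close>

lemma summable_increments_bounded:
  fixes t :: "nat \<Rightarrow> real"
  assumes "0 \<le> \<theta>" "\<theta> < 1" "0 \<le> C" and "\<And>k. t (Suc k) \<le> t k + C * \<theta> ^ k"
  shows "t k \<le> t 0 + C / (1 - \<theta>)"
proof -
  have "t k \<le> t 0 + C * (\<Sum>q<k. \<theta> ^ q)"
  proof (induction k)
    case (Suc k)
    then show ?case using assms(4)[of k] by (simp add: distrib_left)
  qed simp
  also have "\<dots> \<le> t 0 + C * (1 / (1 - \<theta>))"
    by (intro add_left_mono mult_left_mono geometric_partial_sum_le assms)
  finally show ?thesis by simp
qed

locale point_normal = mask_chain +
  fixes n0 :: "'a::euclidean_space polygon" and \<delta> :: real
  assumes unit0: "norm (n0 i) = 1" and \<delta>: "0 < \<delta>"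
    and subdiv_lower: "\<delta> \<le> norm (S (normals (c 0) n0 k) i)"
    and denominator_lower: "c 0 (i - 2 * j) \<noteq> 0 \<Longrightarrow>
      \<delta> \<le> \<bar>(normals (c 0) n0 k j + normals (c 0) n0 (Suc k) i) \<bullet> normals (c 0) n0 (Suc k) i\<bar>"
begin

abbreviation "n \<equiv> normals (c 0) n0"

lemma norm_S_pos: "0 < norm (S (n k) i)"
  using subdiv_lower[of k i] \<delta> by linarith

lemma unit: "norm (n k i) = 1"
  using norm_S_pos by (cases k) (auto simp: unit0)

text \<open>Normalizing moves a vector by the deviation of its length from 1, which is at most its
  distance from any unit vector, in particular from \<open>n k j\<close>. Hence the factor 2 on the
  distance to \<open>S (n k) i\<close>.\<close>

lemma normals_near:
  obtains K where "0 \<le> K" and "\<And>k w i j. (\<And>l. norm (bdiff (n k) l) \<le> w) \<Longrightarrow> c 0 (i - 2 * j) \<noteq> 0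
    \<Longrightarrow> norm (n k j - n (Suc k) i) \<le> K * w"
proof -
  obtain L where L: "\<And>i. c 0 i \<noteq> 0 \<Longrightarrow> \<bar>i\<bar> \<le> L" using mask_radius[OF affine_mask_finite[OF affine0]] by blast
  define K where "K = mask_norm (c 0) * of_int (L + L)"
  have "0 \<le> L"
  proof -
    obtain i0 where "c 0 i0 \<noteq> 0"
      using affine_mask_stencil_nonempty[OF affine0] by blast
    then show ?thesis using L[of i0] by linarith
  qed
  then have K: "0 \<le> K" using mask_norm_nonneg[of "c 0"] by (simp add: K_def)
  show thesis
  proof (rule that[of "2 * K"])
    fix k w i j assume w: "\<And>l. norm (bdiff (n k) l) \<le> w" and ij: "c 0 (i - 2 * j) \<noteq> 0"
    have 1: "norm (n k j - S (n k) i) \<le> K * w"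
      using norm_diff_subdiv_le[OF affine0 L w L[OF ij]] by (simp add: K_def mult.assoc)
    define \<rho> where "\<rho> = norm (S (n k) i)"
    have \<rho>: "\<rho> \<noteq> 0" using norm_S_pos[of k i] by (simp add: \<rho>_def)
    have "S (n k) i - n (Suc k) i = (\<rho> - 1) *\<^sub>R n (Suc k) i"
    proof -
      have "(\<rho> - 1) * inverse \<rho> = 1 - inverse \<rho>" using \<rho> by (simp add: field_simps)
      then show ?thesis by (simp add: \<rho>_def[symmetric] scaleR_left_diff_distrib)
    qed
    then have "norm (S (n k) i - n (Suc k) i) = \<bar>\<rho> - 1\<bar>" using unit[of "Suc k" i] by (simp del: normals.simps)
    also have "\<dots> \<le> norm (n k j - S (n k) i)"
      using norm_triangle_ineq3[of "S (n k) i" "n k j"] unit[of k j]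
      by (simp add: \<rho>_def norm_minus_commute)
    finally have 2: "norm (S (n k) i - n (Suc k) i) \<le> K * w" using 1 by simp
    show "norm (n k j - n (Suc k) i) \<le> 2 * K * w"
      using norm_triangle_ineq[of "n k j - S (n k) i" "S (n k) i - n (Suc k) i"] 1 2
      by (simp del: normals.simps)
  qed (use K in simp)
qed

text \<open>The deviation of \<open>S n\<close> from unit length is \<open>S n \<bullet> S n - S (n \<bullet> n)\<close>, a product defect.\<close>

lemma dominated_normalization:
  assumes "0 < m" and n: "dominated m \<eta> (\<lambda>_. 1) n"
  shows "dominated m \<eta> \<eta> (\<lambda>k i. n (Suc k) i - S (n k) i)"
proof -
  define \<rho> where "\<rho> k i = norm (S (n k) i)" for k i
  define g where "g k i = S (\<lambda>j. n k j \<bullet> n k j) i - S (n k) i \<bullet> S (n k) i" for k i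
  have Sn: "dominated m \<eta> (\<lambda>_. 1) (\<lambda>k. S (n k))" by (rule dominated_S[OF n])
  have g: "dominated m \<eta> \<eta> g"
    using dominated_subdiv_prod[OF bounded_bilinear_inner assms(1) n n] by (simp add: g_def[abs_def])
  have \<rho>_sq: "S (n k) i \<bullet> S (n k) i = \<rho> k i * \<rho> k i" for k i
    by (simp add: \<rho>_def dot_square_norm power2_eq_square)
  have \<rho>2: "dominated m \<eta> (\<lambda>_. 1) (\<lambda>k i. \<rho> k i * \<rho> k i)"
    using dominated_prod[OF bounded_bilinear_inner Sn Sn] by (simp add: \<rho>_sq)
  have \<rho>: "dominated m \<eta> (\<lambda>_. 1) \<rho>"
    by (rule dominated_sqrt[OF \<delta> _ \<rho>2]) (simp add: \<rho>_def subdiv_lower)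
  have inv1: "dominated m \<eta> (\<lambda>_. 1) (\<lambda>k i. 1 / \<rho> k i)"
    by (rule dominated_inverse[OF \<delta> _ \<rho>]) (simp add: \<rho>_def subdiv_lower)
  have inv2: "dominated m \<eta> (\<lambda>_. 1) (\<lambda>k i. 1 / (1 + \<rho> k i))"
    by (intro dominated_inverse[of 1] dominated_add dominated_const \<rho>) (simp_all add: \<rho>_def)
  have "dominated m \<eta> (\<lambda>k. \<eta> k * (1 * 1) * 1) (\<lambda>k i. (g k i * (1 / \<rho> k i * (1 / (1 + \<rho> k i)))) *\<^sub>R S (n k) i)"
    by (intro dominated_prod[OF bounded_bilinear_scaleR] dominated_prod[OF bounded_bilinear_mult] g inv1 inv2 Sn)
  \<comment> \<open>The correction is (1/\<rho> - 1) Sn with 1/\<rho> - 1 = (1 - \<rho>^2) / (\<rho>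
    (1 + \<rho>)), and 1 - \<rho>^2 is the defect \<open>g\<close>, the only small factor.\<close>
  moreover have "(g k i * (1 / \<rho> k i * (1 / (1 + \<rho> k i)))) *\<^sub>R S (n k) i = n (Suc k) i - S (n k) i" for k i
  proof -
    have "0 < \<rho> k i" using norm_S_pos by (simp add: \<rho>_def)
    have "n k j \<bullet> n k j = 1" for j using unit[of k j] by (simp add: dot_square_norm del: normals.simps)
    then have "g k i = 1 - \<rho> k i * \<rho> k i"
      unfolding g_def \<rho>_sq by (simp add: subdiv_const[OF affine0])
    then have "g k i * (1 / \<rho> k i * (1 / (1 + \<rho> k i))) = 1 / \<rho> k i - 1"
      using \<open>0 < \<rho> k i\<close> by (simp add: divide_simps) (simp add: algebra_simps)
    then show ?thesis by (simp add: \<rho>_def scaleR_left_diff_distrib inverse_eq_divide)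
  qed
  ultimately show ?thesis by (simp del: normals.simps)
qed

text \<open>First interpolation between \<open>norm n = 1\<close> and the Hoelder bound gives differences of order \<open>s\<close>
  of size \<open>\<eta> ^ s\<close>, where \<open>\<eta> = \<mu> ^ - k\<close> is slightly larger than \<open>2 ^ - k\<close>. This makes the
  normalization summable at every order, so the linear recursion yields the sharp rate.\<close>

lemma normals_dominated:
  assumes "0 < m" and \<theta>: "1 / 2 \<le> \<theta>" "\<theta> < 1"
    and hoelder: "\<And>k i. norm ((bdiff ^^ Suc m) (n k) i) \<le> C * \<theta> ^ k / 2 ^ (k * m)"
  shows "dominated m (\<lambda>k. (1 / 2) ^ k) (\<lambda>_. 1) n"
proof -
  have bn: "bounded (range (n k))" for k by (rule bounded_rangeI[of _ 1]) (simp add: unit del: normals.simps)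
  have sup_n: "sup_norm (n k) \<le> 1" for k by (rule sup_norm_le) (simp add: unit del: normals.simps)
  have C: "0 \<le> C" using order_trans[OF norm_ge_zero hoelder[of 0 0]] by simp
  have \<theta>0: "0 < \<theta>" using \<theta> by simp
  \<comment> \<open>Chosen so that at order \<open>m + 1\<close> the power
    \<open>\<mu> ^ - k\<close> raised to \<open>m + 1\<close> equals \<theta>^k / 2^(km), the rate
    of the Hoelder bound.\<close>
  define \<mu> where "\<mu> = root (Suc m) (2 ^ m / \<theta>)"
  have \<mu>_pow: "\<mu> ^ Suc m = 2 ^ m / \<theta>"
    unfolding \<mu>_def using \<theta>0 by (intro real_root_pow_pos2) auto
  have \<mu>: "1 \<le> \<mu>" "\<mu> \<le> 2"
  proof -
    have "1 * \<theta> \<le> 2 ^ m" using \<theta>(2) one_le_power[of "2::real" m] by linarith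
    then have "1 \<le> 2 ^ m / \<theta>" using \<theta>0 by (simp add: field_simps)
    then show "1 \<le> \<mu>" unfolding \<mu>_def by simp
    have "2 ^ m / \<theta> \<le> 2 ^ Suc m" using \<theta>(1) \<theta>0 by (simp add: field_simps)
    then have "\<mu> \<le> root (Suc m) (2 ^ Suc m)" unfolding \<mu>_def by simp
    then show "\<mu> \<le> 2" by (simp add: real_root_power_cancel del: power_Suc)
  qed
  \<comment> \<open>At order \<open>s\<close> the normalization error is of size
    \<open>\<eta> ^ Suc s\<close>, and scaling by 2^(ks) turns it into the \<open>k\<close>-th power
    of this ratio. The ratio equals \<open>\<theta>\<close> at \<open>s = m\<close> and is no larger
    for smaller \<open>s\<close> because \<open>\<mu> \<le> 2\<close>.\<close>
  have decay: "2 ^ s / \<mu> ^ Suc s \<le> \<theta>" if "s \<le> m" for s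
  proof -
    have "2 ^ s / \<mu> ^ Suc s = (2 ^ m / \<mu> ^ Suc m) * (\<mu> / 2) ^ (m - s)"
      using that \<mu> by (simp add: power_divide field_simps flip: power_add power_Suc)
    also have "\<dots> \<le> (2 ^ m / \<mu> ^ Suc m) * 1"
      using \<mu> by (intro mult_left_mono power_le_one) auto
    also have "\<dots> = \<theta>" unfolding \<mu>_pow using \<theta>0 by simp
    finally show ?thesis .
  qed
  define \<eta> where "\<eta> k = (1 / \<mu>) ^ k" for k :: nat
  have n_weak: "dominated m \<eta> (\<lambda>_. 1) n"
  proof (rule dominated_of_funpow)
    fix s assume "s \<le> m"
    then obtain D where D: "0 \<le> D" "\<And>(X::'a polygon) N. bounded (range X) \<Longrightarrow>
      of_nat N ^ s * sup_norm ((bdiff ^^ s) X) \<le> D * (sup_norm X + of_nat N ^ Suc m * sup_norm ((bdiff ^^ Suc m) X))"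
      using interpolation[of s "Suc m"] by (metis le_SucI)
    have "norm ((bdiff ^^ s) (n k) i) \<le> (D * (1 + 2 ^ Suc m * C)) * (1 * \<eta> k ^ s)" for k i
    proof -
      define \<Lambda> where "\<Lambda> = \<mu> ^ k"
      \<comment> \<open>Interpolation takes an integer step; rounding up
        \<open>\<Lambda> = \<mu> ^ k \<ge> 1\<close> costs at most a factor 2.\<close>
      define N where "N = nat \<lceil>\<Lambda>\<rceil>"
      have \<Lambda>: "1 \<le> \<Lambda>" using \<mu> by (simp add: \<Lambda>_def)
      have N: "\<Lambda> \<le> of_nat N" "of_nat N \<le> 2 * \<Lambda>" using \<Lambda> unfolding N_def by linarith+
      have "of_nat N ^ Suc m * sup_norm ((bdiff ^^ Suc m) (n k)) \<le> (2 * \<Lambda>) ^ Suc m * (C * \<theta> ^ k / 2 ^ (k * m))"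
        using N(2) \<Lambda> by (intro mult_mono power_mono sup_norm_le hoelder sup_norm_nonneg bounded_funpow_bdiff bn) auto
      also have "\<dots> = 2 ^ Suc m * C"
      proof -
        have "\<Lambda> ^ Suc m = (\<mu> ^ Suc m) ^ k" unfolding \<Lambda>_def by (metis power_mult mult.commute)
        also have "\<dots> = 2 ^ (k * m) / \<theta> ^ k"
          unfolding \<mu>_pow by (simp add: power_divide mult.commute flip: power_mult)
        finally show ?thesis using \<theta>0 by (simp add: power_mult_distrib del: power_Suc)
      qed
      finally have "sup_norm (n k) + of_nat N ^ Suc m * sup_norm ((bdiff ^^ Suc m) (n k)) \<le> 1 + 2 ^ Suc m * C"
        using sup_n[of k] by linarith
      then have "of_nat N ^ s * sup_norm ((bdiff ^^ s) (n k)) \<le> D * (1 + 2 ^ Suc m * C)"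
        using D(2)[OF bn, of N k] mult_left_mono[OF _ D(1)] order_trans by blast
      moreover have "\<Lambda> ^ s * norm ((bdiff ^^ s) (n k) i) \<le> of_nat N ^ s * sup_norm ((bdiff ^^ s) (n k))"
        using N(1) \<Lambda> by (intro mult_mono power_mono le_sup_norm bounded_funpow_bdiff bn) auto
      ultimately have "\<Lambda> ^ s * norm ((bdiff ^^ s) (n k) i) \<le> D * (1 + 2 ^ Suc m * C)" by linarith
      moreover have "0 < \<Lambda> ^ s" using \<Lambda> by simp
      ultimately have "norm ((bdiff ^^ s) (n k) i) \<le> (D * (1 + 2 ^ Suc m * C)) / \<Lambda> ^ s"
        by (simp only: pos_le_divide_eq mult.commute)
      moreover have "\<eta> k ^ s = 1 / \<Lambda> ^ s" by (simp add: \<eta>_def \<Lambda>_def power_divide)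
      ultimately show ?thesis by simp
    qed
    then show "bounded_by (\<lambda>k. 1 * \<eta> k ^ s) (\<lambda>k. (bdiff ^^ s) (n k))" by (rule bounded_byI)
  qed
  define G where "G k i = n (Suc k) i - S (n k) i" for k i
  have G: "dominated m \<eta> \<eta> G"
    unfolding G_def[abs_def] by (rule dominated_normalization[OF assms(1) n_weak])
  define y where "y = scaled_diff n"
  define t where "t s k = sup_norm (y s k)" for s k
  have by': "bounded (range (y s k))" for s k
    unfolding y_def by (rule bounded_scaled_diff[where p = n, OF bn])
  have t: "norm (y s k i) \<le> t s k" "0 \<le> t s k" for s k i
    unfolding t_def using le_sup_norm[OF by'] sup_norm_nonneg[OF by'] by auto
  have bdiff_y: "bdiff (y s k) i = (1 / 2 ^ k) *\<^sub>R y (Suc s) k i" for s k i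
    unfolding y_def scaled_diff_Suc by simp
  \<comment> \<open>If the differences of \<open>y s\<close> decay geometrically, refinement with
    the mask \<open>c s\<close> moves the values by a summable amount, and so does the normalization
    error by \<open>decay\<close>.\<close>
  have rec: "\<exists>B\<ge>0. \<forall>k. t s k \<le> B" if s: "s \<le> m"
    and A: "0 \<le> A" "\<And>k i. norm (bdiff (y s k) i) \<le> A * \<theta> ^ k" for s A
  proof -
    obtain D where D: "\<And>k i. norm ((bdiff ^^ s) (G k) i) \<le> D * (\<eta> k * \<eta> k ^ s)"
      using dominated_imp_funpow[OF G s] by (auto simp: bounded_by_def)
    have D0: "0 \<le> D" using order_trans[OF norm_ge_zero D[of 0 0]] by (simp add: \<eta>_def)
    have step: "norm (y s (Suc k) i - subdiv (c s) (y s k) i) \<le> 2 ^ m * D * \<theta> ^ k" for k i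
    proof -
      have "norm (y s (Suc k) i - subdiv (c s) (y s k) i) = 2 ^ (Suc k * s) * norm ((bdiff ^^ s) (G k) i)"
        unfolding y_def scaled_diff_step[OF s] G_def[abs_def] by (simp del: normals.simps)
      also have "\<dots> \<le> 2 ^ (Suc k * s) * (D * (\<eta> k * \<eta> k ^ s))" by (intro mult_left_mono D) simp
      also have "\<dots> = 2 ^ s * D * (2 ^ s / \<mu> ^ Suc s) ^ k"
        by (simp add: \<eta>_def power_add power_divide power_mult_distrib mult.commute[of k] flip: power_mult)
      also have "\<dots> \<le> 2 ^ m * D * \<theta> ^ k"
        using D0 s \<mu> decay[OF s] by (intro mult_mono power_mono) auto
      finally show ?thesis .
    qed
    obtain K where K: "0 \<le> K" "\<And>(Y::'a polygon) Y' A \<epsilon> i l.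
      (\<And>j. norm (bdiff Y j) \<le> A) \<Longrightarrow> (\<And>j. norm (Y' j - subdiv (c s) Y j) \<le> \<epsilon>) \<Longrightarrow> \<bar>i - 2 * l\<bar> \<le> 2
      \<Longrightarrow> norm (Y' i - Y l) \<le> K * A + \<epsilon>"
      using perturbed_subdiv_near[OF affine[OF s]] by metis
    have "t s (Suc k) \<le> t s k + (K * A + 2 ^ m * D) * \<theta> ^ k" for k
      unfolding t_def[of s "Suc k"]
    proof (rule sup_norm_le)
      fix i
      have "norm (y s (Suc k) i - y s k (i div 2)) \<le> K * (A * \<theta> ^ k) + 2 ^ m * D * \<theta> ^ k"
        by (rule K(2)[OF A(2) step]) auto
      then show "norm (y s (Suc k) i) \<le> t s k + (K * A + 2 ^ m * D) * \<theta> ^ k"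
        using t(1)[of s k "i div 2"] norm_triangle_sub[of "y s (Suc k) i" "y s k (i div 2)"]
        by (simp add: algebra_simps)
    qed
    then have "t s k \<le> t s 0 + (K * A + 2 ^ m * D) / (1 - \<theta>)" for k
      using \<theta>0 \<theta> K(1) A(1) D0 by (intro summable_increments_bounded) auto
    moreover have "0 \<le> t s 0 + (K * A + 2 ^ m * D) / (1 - \<theta>)"
      using \<theta> K(1) A(1) D0 t(2) by (intro add_nonneg_nonneg divide_nonneg_pos) auto
    ultimately show ?thesis by blast
  qed
  \<comment> \<open>Descends from order \<open>m\<close>, where the Hoelder bound provides the decay
    required by \<open>rec\<close>. A bound at order \<open>s + 1\<close> then yields decay 2^(-k)
    \<le> \<theta>^k of the differences at order \<open>s\<close>.\<close>
  have sharp: "\<exists>B\<ge>0. \<forall>k. t s k \<le> B" if "s \<le> m" for s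
    using that
  proof (induction s rule: inc_induct)
    case base
    have "norm (bdiff (y m k) i) \<le> C * \<theta> ^ k" for k i
    proof -
      have "norm (bdiff (y m k) i) = 2 ^ (k * m) * norm ((bdiff ^^ Suc m) (n k) i)"
        unfolding bdiff_y by (simp add: y_def scaled_diff_def power_add del: normals.simps)
      also have "\<dots> \<le> 2 ^ (k * m) * (C * \<theta> ^ k / 2 ^ (k * m))" by (intro mult_left_mono hoelder) simp
      finally show ?thesis by simp
    qed
    then show ?case by (intro rec[OF order_refl C])
  next
    case (step s)
    then obtain B where B: "0 \<le> B" "\<And>k. t (Suc s) k \<le> B" by blast
    have "norm (bdiff (y s k) i) \<le> B * \<theta> ^ k" for k i
    proof -
      have "norm (bdiff (y s k) i) = norm (y (Suc s) k i) * (1 / 2) ^ k"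
        unfolding bdiff_y by (simp add: power_divide)
      also have "\<dots> \<le> B * \<theta> ^ k"
        using order_trans[OF t(1) B(2)] B(1) \<theta> by (intro mult_mono power_mono) auto
      finally show ?thesis .
    qed
    then show ?case using step by (intro rec[OF _ B(1)]) auto
  qed
  show ?thesis
  proof (rule dominated_of_funpow)
    fix s assume "s \<le> m"
    then obtain B where B: "\<And>k. t s k \<le> B" using sharp by blast
    have "norm ((bdiff ^^ s) (n k) i) \<le> B * (1 * ((1 / 2) ^ k) ^ s)" for k i
    proof -
      have "2 ^ (k * s) * norm ((bdiff ^^ s) (n k) i) \<le> B"
        using order_trans[OF t(1)[of s k i] B] by (simp add: y_def scaled_diff_def)
      then show ?thesis by (simp add: field_simps power_divide flip: power_mult)
    qed
    then show "bounded_by (\<lambda>k. 1 * ((1 / 2) ^ k) ^ s) (\<lambda>k. (bdiff ^^ s) (n k))" by (rule bounded_byI)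
  qed
qed

section \<open>The displacement of the points along the normals\<close>

definition PN_error :: "nat \<Rightarrow> 'a polygon \<Rightarrow> 'a polygon" where
  "PN_error k p i = S (\<lambda>j. PN_height (n k j) (n (Suc k) i) (p j) (S p i)) i *\<^sub>R n (Suc k) i"

lemma PN_scheme_eq: "PN_scheme (c 0) n0 k p i = S p i + PN_error k p i"
proof -
  have "S (\<lambda>j. PN_height (n k j) (n (Suc k) i) (p j) (S p i)) i
      = (\<Sum>j | c 0 (i - 2 * j) \<noteq> 0. c 0 (i - 2 * j) * PN_height (n k j) (n (Suc k) i) (p j) (S p i))"
    by (simp only: subdiv_def[of _ "\<lambda>j. PN_height (n k j) (n (Suc k) i) (p j) (S p i)"] real_scaleR_def)
  then show ?thesis by (simp only: PN_scheme_def PN_error_def Let_def)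
qed

text \<open>Subtracting \<open>n' \<bullet> (p j - q)\<close> from each height leaves the weighted
  sum unchanged, because \<open>q\<close> is the weighted sum of the \<open>p j\<close>. What
  remains is small with the distance of the normals.\<close>

lemma PN_error_bound:
  obtains K where "0 \<le> K" and "\<And>k p A w i. (\<And>j. norm (p j) \<le> A) \<Longrightarrow>
    (\<And>i j. c 0 (i - 2 * j) \<noteq> 0 \<Longrightarrow> norm (n k j - n (Suc k) i) \<le> w) \<Longrightarrow> norm (PN_error k p i) \<le> K * w * A"
proof -
  define \<nu> where "\<nu> = mask_norm (c 0)"
  have \<nu>: "0 \<le> \<nu>" by (simp add: \<nu>_def mask_norm_nonneg)
  define K where "K = \<nu> * (2 / \<delta> * (1 + \<nu>))"
  show thesis
  proof (rule that[of K])
    show "0 \<le> K" using \<nu> \<delta> by (simp add: K_def)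
    fix k i and p :: "'a polygon" and A w :: real
    assume p: "\<And>j. norm (p j) \<le> A" and w: "\<And>i j. c 0 (i - 2 * j) \<noteq> 0 \<Longrightarrow> norm (n k j - n (Suc k) i) \<le> w"
    define n' where "n' = n (Suc k) i"
    define q where "q = S p i"
    have A: "0 \<le> A" using order_trans[OF norm_ge_zero p] .
    have q: "norm q \<le> \<nu> * A"
      unfolding q_def \<nu>_def by (intro norm_subdiv_le affine_mask_finite affine0 p A)
    obtain j0 where "c 0 (i - 2 * j0) \<noteq> 0"
      using affine_mask_stencil_nonempty[OF affine0] by blast
    from w[OF this] have w0: "0 \<le> w" using order_trans[OF norm_ge_zero] by blast
    have "S (\<lambda>j. n' \<bullet> (p j - q)) i = n' \<bullet> (S p i - q)"
      using subdiv_linear[OF bounded_linear.linear[OF bounded_linear_inner_right], of "c 0" n' "\<lambda>j. p j - q" i]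
      by (simp add: subdiv_diff subdiv_const[OF affine0])
    then have "S (\<lambda>j. PN_height (n k j) n' (p j) q) i = S (\<lambda>j. PN_height (n k j) n' (p j) q - n' \<bullet> (p j - q)) i"
      unfolding subdiv_diff by (simp add: q_def)
    moreover have "norm (S (\<lambda>j. PN_height (n k j) n' (p j) q - n' \<bullet> (p j - q)) i)
        \<le> \<nu> * (2 / \<delta> * w * (A + \<nu> * A))"
      unfolding \<nu>_def
    proof (rule norm_subdiv_le[OF affine_mask_finite[OF affine0]], unfold \<nu>_def[symmetric])
      fix j assume j: "c 0 (i - 2 * j) \<noteq> 0"
      have "\<bar>PN_height (n k j) n' (p j) q - n' \<bullet> (p j - q)\<bar> \<le> 2 / \<delta> * norm (n k j - n') * norm (p j - q)"
        unfolding n'_def by (rule PN_height_bound[OF unit unit \<delta> denominator_lower[OF j]])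
      also have "\<dots> \<le> 2 / \<delta> * w * (A + \<nu> * A)"
        using norm_triangle_ineq4[of "p j" q] p[of j] q w[OF j] \<delta> w0
        by (intro mult_mono) (auto simp: n'_def simp del: normals.simps)
      finally show "norm (PN_height (n k j) n' (p j) q - n' \<bullet> (p j - q)) \<le> 2 / \<delta> * w * (A + \<nu> * A)" by simp
    qed (use \<nu> \<delta> w0 A in auto)
    moreover have "norm n' = 1" unfolding n'_def by (rule unit)
    ultimately have "norm (PN_error k p i) \<le> \<nu> * (2 / \<delta> * w * (A + \<nu> * A))"
      unfolding PN_error_def n'_def[symmetric] q_def[symmetric] by simp
    then show "norm (PN_error k p i) \<le> K * w * A"
      by (simp add: K_def algebra_simps)
  qed
qed

text \<open>Unit normals are at most 2 apart. This keeps every single level bounded, so that sup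
  norms make sense; it gives no bound uniform in the level.\<close>

lemma bounded_PN_error:
  assumes "bounded (range p)" shows "bounded (range (PN_error k p))"
proof -
  obtain K where K: "\<And>k p A w i. (\<And>j. norm (p j) \<le> A) \<Longrightarrow>
    (\<And>i j. c 0 (i - 2 * j) \<noteq> 0 \<Longrightarrow> norm (n k j - n (Suc k) i) \<le> w) \<Longrightarrow> norm (PN_error k p i) \<le> K * w * A"
    using PN_error_bound by metis
  have "norm (n k j - n (Suc k) i) \<le> 2" for i j
    using norm_triangle_ineq4[of "n k j" "n (Suc k) i"] by (simp add: unit del: normals.simps)
  then have "norm (PN_error k p i) \<le> K * 2 * sup_norm p" for i
    by (rule K[OF le_sup_norm[OF assms]])
  then show ?thesis by (rule bounded_rangeI)
qed

theorem scheme_C_PN: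
  assumes conv: "scheme_C 0 (linear_scheme (c m) :: 'a scheme)" and \<theta>: "1 / 2 \<le> \<theta>" "\<theta> < 1"
    and hoelder: "\<And>k i. norm ((bdiff ^^ Suc m) (n k) i) \<le> C * \<theta> ^ k / 2 ^ (k * m)"
  shows "scheme_C m (PN_scheme (c 0) n0)"
  unfolding scheme_C_def
proof (intro allI impI)
  fix P :: "'a polygon" assume P: "bounded (range P)"
  define p where "p = refine (PN_scheme (c 0) n0) P"
  have p_Suc: "p (Suc k) i = S (p k) i + PN_error k (p k) i" for k i
    by (simp add: p_def PN_scheme_eq)
  have bp: "bounded (range (p k))" for k
  proof (induction k)
    case (Suc k)
    have "norm (p (Suc k) i) \<le> sup_norm (S (p k)) + sup_norm (PN_error k (p k))" for i
      unfolding p_Suc using Suc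
      by (intro norm_triangle_mono le_sup_norm bounded_subdiv bounded_PN_error affine_mask_finite affine0)
    then show ?case by (rule bounded_rangeI)
  qed (simp add: p_def P)
  define T where "T k = (\<Sum>s\<le>m. sup_norm (scaled_diff p s k))" for k
  have T: "norm (scaled_diff p s k i) \<le> T k" if "s \<le> m" for s k i
  proof -
    have "sup_norm (scaled_diff p s k) \<le> T k"
      unfolding T_def using that by (intro member_le_sum sup_norm_nonneg bounded_scaled_diff bp) auto
    then show ?thesis using le_sup_norm[OF bounded_scaled_diff[where p = p, OF bp[of k]], of s i] by simp
  qed
  have T0: "0 \<le> T k" for k using order_trans[OF norm_ge_zero T[of 0]] by simp
  have C: "0 \<le> C" using order_trans[OF norm_ge_zero hoelder[of 0 0]] by simp
  have "\<exists>D\<ge>0. \<forall>s\<le>m. \<forall>k i. norm ((bdiff ^^ s) (PN_error k (p k)) i) \<le> D * \<theta> ^ k * T k / 2 ^ (k * s)"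
  proof (cases "m = 0")
    \<comment> \<open>Without differences of the normals at hand, the product defects are replaced
      by the direct estimate: the Hoelder bound makes neighbouring normals \<theta>^k-close.\<close>
    case True
    obtain K where K: "0 \<le> K" "\<And>k w i j. (\<And>l. norm (bdiff (n k) l) \<le> w) \<Longrightarrow> c 0 (i - 2 * j) \<noteq> 0
      \<Longrightarrow> norm (n k j - n (Suc k) i) \<le> K * w" using normals_near by metis
    obtain L where L: "0 \<le> L" "\<And>k p A w i. (\<And>j. norm (p j) \<le> A) \<Longrightarrow>
      (\<And>i j. c 0 (i - 2 * j) \<noteq> 0 \<Longrightarrow> norm (n k j - n (Suc k) i) \<le> w) \<Longrightarrow> norm (PN_error k p i) \<le> L * w * A"
      using PN_error_bound by metis
    have "norm (bdiff (n k) i) \<le> C * \<theta> ^ k" for k i using hoelder[of k i] True by simp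
    moreover have "norm (p k i) \<le> T k" for k i using T[of 0 k i] by (simp add: scaled_diff_0)
    ultimately have "norm (PN_error k (p k) i) \<le> L * (K * (C * \<theta> ^ k)) * T k" for k i
      by (intro L(2) K(2)) auto
    then show ?thesis using True K(1) L(1) C by (intro exI[of _ "L * (K * C)"]) (simp add: mult_ac)
  next
    case False
    define \<eta> where "\<eta> k = (1 / 2 :: real) ^ k" for k :: nat
    have \<eta>: "0 < \<eta> k" "\<eta> k \<le> 1" for k by (simp_all add: \<eta>_def power_le_one)
    have n: "dominated m \<eta> (\<lambda>_. 1) n"
      unfolding \<eta>_def[abs_def] using False by (intro normals_dominated[OF _ \<theta> hoelder]) simp
    have n': "dominated m \<eta> (\<lambda>_. 1) (\<lambda>k. n (Suc k))"
    proof (rule dominated_of_funpow)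
      fix s assume s: "s \<le> m"
      obtain D where D: "\<And>k i. norm ((bdiff ^^ s) (n k) i) \<le> D * \<eta> k ^ s"
        using dominated_imp_funpow[OF n s] by (auto simp: bounded_by_def)
      have "0 \<le> D" using order_trans[OF norm_ge_zero D[of 0 0]] by (simp add: \<eta>_def)
      have "norm ((bdiff ^^ s) (n (Suc k)) i) \<le> D * (1 * \<eta> k ^ s)" for k i
      proof -
        have "\<eta> (Suc k) ^ s \<le> \<eta> k ^ s" by (intro power_mono) (simp_all add: \<eta>_def)
        then have "D * \<eta> (Suc k) ^ s \<le> D * \<eta> k ^ s" using \<open>0 \<le> D\<close> by (rule mult_left_mono)
        then show ?thesis using order_trans[OF D[of "Suc k" i]] by simp
      qed
      then show "bounded_by (\<lambda>k. 1 * \<eta> k ^ s) (\<lambda>k. (bdiff ^^ s) (n (Suc k)))" by (rule bounded_byI)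
    qed
    \<comment> \<open>Holds by the choice of \<open>T\<close> as a sum of all scaled differences up
      to order \<open>m\<close>; this is what makes the resulting error bound relative to
      \<open>T k\<close>.\<close>
    have dp: "dominated m \<eta> T p"
    proof (rule dominated_of_funpow)
      fix s assume s: "s \<le> m"
      have "norm ((bdiff ^^ s) (p k) i) \<le> 1 * (T k * \<eta> k ^ s)" for k i
        using T[OF s, of k i] by (simp add: scaled_diff_def \<eta>_def field_simps power_divide flip: power_mult)
      then show "bounded_by (\<lambda>k. T k * \<eta> k ^ s) (\<lambda>k. (bdiff ^^ s) (p k))" by (rule bounded_byI)
    qed
    obtain B where B: "\<And>k i. norm (bdiff (n k) i) \<le> B * \<eta> k"
      using dominated_imp_funpow[OF n, of 1] False by (auto simp: bounded_by_def)
    obtain K where K: "0 \<le> K" "\<And>k w i j. (\<And>l. norm (bdiff (n k) l) \<le> w) \<Longrightarrow> c 0 (i - 2 * j) \<noteq> 0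
      \<Longrightarrow> norm (n k j - n (Suc k) i) \<le> K * w" using normals_near by metis
    have near: "norm (n k j - n (Suc k) i) \<le> K * B * \<eta> k" if "c 0 (i - 2 * j) \<noteq> 0" for k i j
      using K(2)[OF B that, of k] by (simp only: mult.assoc)
    have "dominated m \<eta> (\<lambda>k. T k * \<eta> k) (\<lambda>k. PN_error k (p k))"
      unfolding PN_error_def[abs_def]
      by (rule dominated_PN_height[OF _ \<eta> n n' dp unit unit near \<delta> denominator_lower]) (use False in auto)
    from dominated_imp_funpow[OF this]
    have "\<forall>s\<le>m. \<exists>D. \<forall>k i. norm ((bdiff ^^ s) (PN_error k (p k)) i) \<le> D * (T k * \<eta> k * \<eta> k ^ s)"
      by (auto simp: bounded_by_def)
    then obtain D where D: "\<And>s k i. s \<le> m \<Longrightarrow>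
        norm ((bdiff ^^ s) (PN_error k (p k)) i) \<le> D s * (T k * \<eta> k * \<eta> k ^ s)" by metis
    define D' where "D' = (\<Sum>s\<le>m. \<bar>D s\<bar>)"
    have "norm ((bdiff ^^ s) (PN_error k (p k)) i) \<le> D' * \<theta> ^ k * T k / 2 ^ (k * s)" if s: "s \<le> m" for s k i
    proof -
      have "\<bar>D s\<bar> \<le> D'" unfolding D'_def using s by (intro member_le_sum) auto
      then have "D s \<le> D'" by simp
      then have "D s * (T k * \<eta> k * \<eta> k ^ s) \<le> D' * (T k * \<theta> ^ k * \<eta> k ^ s)"
        using T0[of k] \<eta>[of k] \<theta>(1) \<open>\<bar>D s\<bar> \<le> D'\<close>
        by (intro mult_mono) (auto simp: \<eta>_def intro!: power_mono mult_nonneg_nonneg)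
      also have "\<dots> = D' * \<theta> ^ k * T k / 2 ^ (k * s)"
        by (simp add: \<eta>_def power_divide flip: power_mult)
      finally show ?thesis using D[OF s, of k i] by simp
    qed
    moreover have "0 \<le> D'" by (simp add: D'_def sum_nonneg)
    ultimately show ?thesis by blast
  qed
  then obtain D where D: "0 \<le> D"
    "\<And>s k i. s \<le> m \<Longrightarrow> norm ((bdiff ^^ s) (PN_error k (p k)) i) \<le> D * \<theta> ^ k * T k / 2 ^ (k * s)" by blast
  have "(\<lambda>i. p (Suc k) i - S (p k) i) = PN_error k (p k)" for k by (simp add: p_Suc)
  with D(2) have "\<exists>f. limit_curve p f \<and> C_curve m f"
    by (intro perturbed_scheme_C[OF conv bp \<theta> D(1) T_def]) simp
  then show "\<exists>f. limit_curve (refine (PN_scheme (c 0) n0) P) f \<and> C_curve m f" by (simp add: p_def)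
qed

end

theorem theorem4p3:
  fixes a b :: mask and m :: nat and \<alpha> :: real
    and n0 :: "'a::euclidean_space polygon"
  assumes "linear_mask a" and "linear_mask b"
    and "\<And>z. z \<noteq> 0 \<Longrightarrow> symbol a z = (1 + z) ^ m / 2 ^ m * symbol b z"
    and "scheme_C 0 (linear_scheme b :: 'a scheme)"
    and "0 < \<alpha>" and "\<alpha> \<le> 1"
    and "scheme_Hoelder \<alpha> (linear_scheme b :: 'a scheme)"
    and "\<And>i. norm (n0 i) = 1"
    and "PN_well_defined a n0"
    and "normals_Hoelder m \<alpha> a n0"
  shows "scheme_C m (PN_scheme a n0)"
proof -
  \<comment> \<open>The chain is built upwards from \<open>b\<close>; that it ends in
    \<open>a\<close> follows from the factorization of the symbol.\<close>
  define c where "c s = (mask_avg ^^ (m - s)) b" for s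
  have b: "affine_mask b" by (rule linear_mask_imp_affine[OF assms(2)])
  have "a = (mask_avg ^^ m) b"
  proof (rule symbol_inject)
    show "finite {i. a i \<noteq> 0}" using assms(1) by (simp add: linear_mask_def)
    show "finite {i. (mask_avg ^^ m) b i \<noteq> 0}"
      using affine_mask_funpow_avg[OF b] by (rule affine_mask_finite)
    fix z :: complex assume "z \<noteq> 0"
    then show "symbol a z = symbol ((mask_avg ^^ m) b) z"
      using assms(3) symbol_funpow_mask_avg[OF affine_mask_finite[OF b], of z m] by simp
  qed
  then have c0: "c 0 = a" by (simp add: c_def)
  have cm: "c m = b" by (simp add: c_def)
  obtain \<delta> where \<delta>: "0 < \<delta>" "\<And>k i. \<delta> \<le> norm (subdiv a (normals a n0 k) i)"
    "\<And>k i j. a (i - 2 * j) \<noteq> 0 \<Longrightarrow>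
      \<delta> \<le> \<bar>(normals a n0 k j + normals a n0 (Suc k) i) \<bullet> normals a n0 (Suc k) i\<bar>"
    using assms(9) unfolding PN_well_defined_def by blast
  interpret point_normal c m n0 \<delta>
  proof
    show "affine_mask (c s)" for s unfolding c_def by (rule affine_mask_funpow_avg[OF b])
    show "c s = mask_avg (c (Suc s))" if "s < m" for s
    proof -
      have "m - s = Suc (m - Suc s)" using that by simp
      then show ?thesis by (simp add: c_def)
    qed
  qed (use assms(8) \<delta> in \<open>simp_all only: c0\<close>)
  \<comment> \<open>The decay of the Hoelder bound per level. \<open>\<alpha> > 0\<close> makes it
    less than 1, and \<open>\<alpha> \<le> 1\<close> makes it at least 1/2, so it absorbs factors
    2^(-k).\<close>
  define \<theta> where "\<theta> = 2 powr - \<alpha>"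
  have \<theta>: "1 / 2 \<le> \<theta>" "\<theta> < 1"
    using assms(5,6) powr_mono[of "-1" "- \<alpha>" 2] powr_less_mono[of "- \<alpha>" 0 2]
    by (simp_all add: \<theta>_def powr_minus_divide)
  obtain C where C: "\<And>k i. norm ((bdiff ^^ m) (n k) i /\<^sub>R 2 powr (- (real k * real m))
      - (bdiff ^^ m) (n k) (i - 1) /\<^sub>R 2 powr (- (real k * real m))) < C * 2 powr (- (real k * \<alpha>))"
    using assms(10) unfolding normals_Hoelder_def c0 by blast
  have "norm ((bdiff ^^ Suc m) (n k) i) \<le> C * \<theta> ^ k / 2 ^ (k * m)" for k i
  proof -
    have "2 powr (- (real k * real m)) = 1 / 2 ^ (k * m)"
      by (simp add: powr_minus_divide powr_realpow flip: of_nat_mult)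
    moreover have "2 powr (- (real k * \<alpha>)) = \<theta> ^ k"
      by (simp add: \<theta>_def powr_power mult.commute)
    ultimately have "2 ^ (k * m) * norm ((bdiff ^^ m) (n k) i - (bdiff ^^ m) (n k) (i - 1)) < C * \<theta> ^ k"
      using C[of k i] by (simp flip: scaleR_right_diff_distrib)
    then show ?thesis by (simp add: bdiff_def[of _ i] field_simps)
  qed
  from scheme_C_PN[OF _ \<theta> this] assms(4) show ?thesis by (simp only: cm c0)
qed

end
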